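(* Let $\mathcal{A}': f'=0$ be a nodal arrangement of $d'\geq 2$ lines in $\mathbb{P}^2$ (i.e. all its multiple points are double points), and let $L$ be a line not belonging to $\mathcal{A}'$ such that exactly $s\geq 1$ double points of $\mathcal{A}'$ lie on $L$. Let $\mathcal{A}=\mathcal{A}'\cup L: f=0$ and $d=d'+1=\deg f$. Then: (1) The multiple points of $\mathcal{A}$ are exactly $n_2=\binom{d}{2}-3s$ double points and $n_3=s$ triple points, where $s\leq d'/2$; hence $\tau(\mathcal{A})=\binom{d}{2}+s$. Moreover $\mathrm{mdr}(f)=d-3$. (2) If $d'=2k\geq 4$ is even and $s=k$, then $\mathcal{A}$ is of type $(d,r,m)=(2k+1,2k-2,k)$ (for any $k\geq 2$). Moreover $\Delta m:=(2r-d+3)-m=k-2$, the numerical invariants (degrees) of the minimal graded free resolution of the Milnor algebra $M(f)$ are determined by $k$, and in particular $\epsilon_j=2$ for all $j=1,\ldots,k-2$.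
   Context: Let $S=\mathbb{C}[x,y,z]$. For a reduced homogeneous $f\in S$ of degree $d$ defining a curve (here a line arrangement), let $J_f=(f_x,f_y,f_z)$, $M(f)=S/J_f$, and $D_0(f)=\{(a,b,c)\in S^3: af_x+bf_y+cf_z=0\}$. $\mathrm{mdr}(f)$ denotes the minimal degree of a nonzero homogeneous element of $D_0(f)$. The curve is of type $(d,r,m)$ if $D_0(f)$ is minimally generated by $m$ homogeneous elements all of degree $r$. The total Tjurina number $\tau$ is the degree of $J_f$ (sum of local Tjurina numbers). When $m\geq 3$, the minimal graded free resolution of $M(f)$ has the form $0\to \bigoplus_{i=1}^{m-2}S(-e_i)\to \bigoplus_{j=1}^m S(1-d-d_j)\to S^3(1-d)\to S$, where $d_1\leq\cdots\leq d_m$ are the degrees of minimal generators of $D_0(f)$, $e_1\leq\cdots\leq e_{m-2}$, and one writes $e_j=d+d_{j+2}-1+\epsilon_j$ with integers $\epsilon_j\geq 1$. *)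

theory Defs
  imports Complex_Main
begin

text \<open>A polynomial is a coefficient function on exponent triples (i,j,l) standing for
  x^i y^j z^l, with finite support (is_poly).  Homogeneous polynomials automatically
  have finite support.\<close>

type_synonym mono = "nat \<times> nat \<times> nat"
type_synonym poly3 = "mono \<Rightarrow> complex"
type_synonym vec3 = "complex \<times> complex \<times> complex"

definition is_poly :: "poly3 \<Rightarrow> bool" where
  "is_poly p \<longleftrightarrow> finite {m. p m \<noteq> 0}"

definition pzero :: poly3 where "pzero = (\<lambda>_. 0)"

definition pone :: poly3 where "pone = (\<lambda>m. if m = (0,0,0) then 1 else 0)"

definition padd :: "poly3 \<Rightarrow> poly3 \<Rightarrow> poly3" where
  "padd p q = (\<lambda>m. p m + q m)"

definition pmul :: "poly3 \<Rightarrow> poly3 \<Rightarrow> poly3" where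
  "pmul p q = (\<lambda>(a1,a2,a3).
     \<Sum>(b,c) \<in> {((b1,b2,b3),(c1,c2,c3)). b1 + c1 = a1 \<and> b2 + c2 = a2 \<and> b3 + c3 = a3}.
        p b * q c)"

definition homog :: "nat \<Rightarrow> poly3 \<Rightarrow> bool" where
  "homog k p \<longleftrightarrow> (\<forall>i j l. p (i,j,l) \<noteq> 0 \<longrightarrow> i + j + l = k)"

definition dx :: "poly3 \<Rightarrow> poly3" where
  "dx p = (\<lambda>(i,j,l). of_nat (Suc i) * p (Suc i, j, l))"
definition dy :: "poly3 \<Rightarrow> poly3" where
  "dy p = (\<lambda>(i,j,l). of_nat (Suc j) * p (i, Suc j, l))"
definition dz :: "poly3 \<Rightarrow> poly3" where
  "dz p = (\<lambda>(i,j,l). of_nat (Suc l) * p (i, j, Suc l))"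

definition cspan :: "poly3 list \<Rightarrow> poly3 set" where
  "cspan B = {(\<lambda>m. \<Sum>i<length B. c i * (B ! i) m) | c. True}"

definition cdim :: "poly3 set \<Rightarrow> nat" where
  "cdim V = (LEAST n. \<exists>B. length B = n \<and> set B \<subseteq> V \<and> V = cspan B)"

definition Sk :: "nat \<Rightarrow> poly3 set" where
  "Sk k = {p. homog k p}"

definition Jideal :: "poly3 \<Rightarrow> poly3 set" where
  "Jideal f = {padd (padd (pmul a (dx f)) (pmul b (dy f))) (pmul c (dz f)) | a b c.
                 is_poly a \<and> is_poly b \<and> is_poly c}"

definition Jk :: "poly3 \<Rightarrow> nat \<Rightarrow> poly3 set" where
  "Jk f k = {g \<in> Jideal f. homog k g}"

definition hilbM :: "poly3 \<Rightarrow> nat \<Rightarrow> nat" where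
  "hilbM f k = cdim (Sk k) - cdim (Jk f k)"

text \<open>Total Tjurina number = degree of J_f; since J_f defines a zero-dimensional
  subscheme of P^2, this is the eventual constant value of the Hilbert function of M(f).\<close>
definition tjurina :: "poly3 \<Rightarrow> nat" where
  "tjurina f = (THE t. \<exists>k0. \<forall>k\<ge>k0. hilbM f k = t)"

definition vcomb :: "nat \<Rightarrow> poly3 list \<Rightarrow> poly3 list list \<Rightarrow> poly3 list" where
  "vcomb n hs G = map (\<lambda>i. (\<lambda>m. \<Sum>j<length G. pmul (hs ! j) ((G ! j) ! i) m)) [0..<n]"

definition submod :: "nat \<Rightarrow> poly3 list list \<Rightarrow> poly3 list set" where
  "submod n G = {vcomb n hs G | hs. length hs = length G \<and> (\<forall>h\<in>set hs. is_poly h)}"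

definition vhomog :: "nat \<Rightarrow> poly3 list \<Rightarrow> bool" where
  "vhomog t v \<longleftrightarrow> (\<forall>c\<in>set v. homog t c)"

definition min_gen_by :: "nat \<Rightarrow> poly3 list set \<Rightarrow> poly3 list list \<Rightarrow> nat \<Rightarrow> bool" where
  "min_gen_by n M G t \<longleftrightarrow>
     M = submod n G \<and>
     (\<forall>g\<in>set G. length g = n \<and> vhomog t g) \<and>
     (\<forall>j<length G. G ! j \<notin> submod n (take j G @ drop (Suc j) G))"

definition D0 :: "poly3 \<Rightarrow> poly3 list set" where
  "D0 f = {[a, b, c] | a b c. is_poly a \<and> is_poly b \<and> is_poly c \<and>
             padd (padd (pmul a (dx f)) (pmul b (dy f))) (pmul c (dz f)) = pzero}"

definition mdr :: "poly3 \<Rightarrow> nat" where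
  "mdr f = (LEAST r. \<exists>v\<in>D0 f. vhomog r v \<and> v \<noteq> replicate 3 pzero)"

definition curve_type :: "poly3 \<Rightarrow> nat \<Rightarrow> nat \<Rightarrow> nat \<Rightarrow> bool" where
  "curve_type f d r m \<longleftrightarrow> homog d f \<and> f \<noteq> pzero \<and>
     (\<exists>G. length G = m \<and> min_gen_by 3 (D0 f) G r)"

text \<open>Syzygies among a list G of generators of D_0(f): the kernel of
  (+)_j S(1-d-d_j) -> S^3(1-d), i.e. the last module of the minimal resolution of M(f).
  A syzygy whose entries are homogeneous of degree t has degree t + (d-1) + r
  when all generators have degree r.\<close>
definition Syz :: "poly3 list list \<Rightarrow> poly3 list set" where
  "Syz G = {hs. length hs = length G \<and> (\<forall>h\<in>set hs. is_poly h) \<and>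
                vcomb 3 hs G = replicate 3 pzero}"

definition lin_form :: "vec3 \<Rightarrow> poly3" where
  "lin_form l = (case l of (a,b,c) \<Rightarrow>
     (\<lambda>m. if m = (1,0,0) then a else if m = (0,1,0) then b else if m = (0,0,1) then c else 0))"

definition arr_poly :: "vec3 list \<Rightarrow> poly3" where
  "arr_poly ls = foldr (\<lambda>l p. pmul (lin_form l) p) ls pone"

definition smul3 :: "complex \<Rightarrow> vec3 \<Rightarrow> vec3" where
  "smul3 c v = (case v of (x,y,z) \<Rightarrow> (c*x, c*y, c*z))"

definition prop_eq :: "vec3 \<Rightarrow> vec3 \<Rightarrow> bool" where
  "prop_eq u v \<longleftrightarrow> (\<exists>c. c \<noteq> 0 \<and> u = smul3 c v)"

definition on_line :: "vec3 \<Rightarrow> vec3 \<Rightarrow> bool" where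
  "on_line l v \<longleftrightarrow> (case l of (a,b,c) \<Rightarrow> case v of (x,y,z) \<Rightarrow> a*x + b*y + c*z = 0)"

definition ppoint :: "vec3 \<Rightarrow> vec3 set" where
  "ppoint v = {smul3 c v | c. c \<noteq> 0}"

definition mult :: "vec3 list \<Rightarrow> vec3 \<Rightarrow> nat" where
  "mult ls v = card {i. i < length ls \<and> on_line (ls ! i) v}"

definition npts :: "vec3 list \<Rightarrow> nat \<Rightarrow> nat" where
  "npts ls k = card {ppoint v | v. v \<noteq> (0,0,0) \<and> mult ls v = k}"

definition line_arrangement :: "vec3 list \<Rightarrow> bool" where
  "line_arrangement ls \<longleftrightarrow> (\<forall>l\<in>set ls. l \<noteq> (0,0,0)) \<and>
     (\<forall>i j. i < length ls \<longrightarrow> j < length ls \<longrightarrow> i \<noteq> j \<longrightarrow> \<not> prop_eq (ls ! i) (ls ! j))"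

definition nodal :: "vec3 list \<Rightarrow> bool" where
  "nodal ls \<longleftrightarrow> (\<forall>v. v \<noteq> (0,0,0) \<longrightarrow> mult ls v \<le> 2)"

end

theory Submission
  imports Defs "HOL-Library.Poly_Mapping" "HOL-Library.Product_Plus"
    "HOL-Library.Product_Lexorder" "HOL-Library.Function_Algebras"
begin

text \<open>
  Let v i be the points where L meets the other lines, q i the product of the lines other than L through
  v i, and Q i the product of the q j with j different from i. Up to multiples of the Euler derivation a
  logarithmic derivation is tangent to L, and then, in coordinates on the plane L = 0, it is a pair (a, b)
  such that each q i divides y i * a - x i * b, where v i = (x i, y i). Nodality says that any three of the
  q i form a regular sequence; this forces such pairs to be generated by the Q i v i, with relations exactly
  the (q i c i) for which the sum of the c i v i vanishes. Since Q i has degree d' - deg (q i) with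
  deg (q i) at most 2, this resolution yields mdr, the Hilbert function of the Milnor algebra and hence the
  Tjurina number, and, when all q i are quadrics, the type and the degrees of the relations.
\<close>

section \<open>The polynomial ring\<close>

text \<open>Subtracting a multiple of the Euler derivation preserves tangency to every line, and
  exactly one multiple makes a logarithmic derivation kill F, because Euler multiplies F by its
  degree, which is nonzero in characteristic 0. This is why passing to pairs tangent to L loses
  nothing, and why the Euler term can be restored at the end. Regularity of the q i is phrased
  through nonzerodivisors: such conditions pass from linear forms to products factor by factor, so
  no factorization theory enters. The triple condition is what the induction behind generation
  consumes, and it is where nodality away from L is needed. Write delta_i for deg q_i. In degree t +
  d' the module D_0 has dimension equal to the sum of the binomials (t + delta_i + 2 choose 2),
  minus (n - 2) times (t + 2 choose 2). A linear q_i exceeds the subtracted term by t + 2, a quadric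
  by 2(t + 2) + 1; the delta_i sum to d', so the number n of points cancels and each quadric leaves
  one extra unit. These units are the s in tau. When all q_i are quadrics, the basic relations have
  entries constant times q_i; their degree 2 is epsilon_j.\<close>

instance prod :: ("{ordered_cancel_comm_monoid_add, linorder}",
    "{ordered_cancel_comm_monoid_add, linorder}") ordered_cancel_comm_monoid_add
proof
  fix a b c :: "'a \<times> 'b"
  assume "a \<le> b"
  then show "c + a \<le> c + b"
    by (cases a; cases b; cases c) (auto intro: add_left_mono add_strict_left_mono)
qed

text \<open>Exponents carry the lexicographic order, compatible with addition by the instance above;
  such an order is what makes this polynomial ring an integral domain.\<close>

type_synonym mpoly = "mono \<Rightarrow>\<^sub>0 complex"

abbreviation cf :: "mpoly \<Rightarrow> poly3" where "cf \<equiv> Poly_Mapping.lookup"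

lemma is_poly_cf [simp]: "is_poly (cf p)"
  by (simp add: is_poly_def)

lemma is_poly_obtain:
  assumes "is_poly p"
  obtains P where "p = cf P"
  using assms unfolding is_poly_def by (metis lookup_Abs_poly_mapping)

lemma cf_0: "cf 0 = pzero"
  by (simp add: pzero_def fun_eq_iff)

lemma cf_1: "cf 1 = pone"
  by (auto simp: pone_def fun_eq_iff lookup_one when_def zero_prod_def)

lemma cf_add: "cf (p + q) = padd (cf p) (cf q)"
  by (simp add: padd_def fun_eq_iff lookup_add)

lemma cf_mult: "cf (p * q) = pmul (cf p) (cf q)"
proof
  fix m :: mono
  obtain a1 a2 a3 where m: "m = (a1, a2, a3)" by (cases m)
  let ?S = "{((b1,b2,b3),(c1,c2,c3)). b1 + c1 = a1 \<and> b2 + c2 = a2 \<and> b3 + c3 = (a3::nat)}"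
  have fin: "finite ?S"
    by (rule finite_subset[of _ "({..a1} \<times> {..a2} \<times> {..a3}) \<times> ({..a1} \<times> {..a2} \<times> {..a3})"]) auto
  have "cf (p * q) m = prod_fun (cf p) (cf q) m"
    by (simp add: times_poly_mapping.rep_eq)
  also have "\<dots> = (\<Sum>(a, b). cf p a * cf q b when m = a + b)"
    by (rule prod_fun_unfold_prod) auto
  also have "\<dots> = (\<Sum>(a, b)\<in>?S. cf p a * cf q b when m = a + b)"
    by (rule Sum_any.expand_superset[OF fin]) (auto simp: m split: if_splits)
  also have "\<dots> = (\<Sum>(a, b)\<in>?S. cf p a * cf q b)"
    by (rule sum.cong) (auto simp: m)
  also have "\<dots> = pmul (cf p) (cf q) m"
    by (simp add: pmul_def m)
  finally show "cf (p * q) m = pmul (cf p) (cf q) m" .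
qed

lemma mpoly_induct [case_names single add]:
  fixes p :: mpoly
  assumes single: "\<And>m c. P (Poly_Mapping.single m c)"
    and add: "\<And>p q. P p \<Longrightarrow> P q \<Longrightarrow> P (p + q)"
  shows "P p"
proof -
  have eq: "p = (\<Sum>m\<in>Poly_Mapping.keys p. Poly_Mapping.single m (cf p m))"
    by (rule poly_mapping_eqI)
      (auto simp: lookup_sum lookup_single when_def sum.delta' in_keys_iff)
  have "P (\<Sum>m\<in>A. Poly_Mapping.single m (cf p m))" if "finite A" for A
    using that
  proof induction
    case empty
    show ?case using single[of 0 0] by simp
  next
    case (insert x F)
    then show ?case by (simp add: add single)
  qed
  then show ?thesis using eq finite_keys by metis
qed

section \<open>Constants, variables and substitution homomorphisms\<close>

definition Cst :: "complex \<Rightarrow> mpoly" where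
  "Cst c = Poly_Mapping.single 0 c"

lemma Cst_0 [simp]: "Cst 0 = 0" and Cst_1 [simp]: "Cst 1 = 1"
  and Cst_add: "Cst (a + b) = Cst a + Cst b" and Cst_diff: "Cst (a - b) = Cst a - Cst b"
  and Cst_minus: "Cst (- a) = - Cst a" and Cst_mult: "Cst (a * b) = Cst a * Cst b"
  by (simp_all add: Cst_def single_add single_diff single_uminus mult_single)

lemma Cst_eq_0_iff [simp]: "Cst c = 0 \<longleftrightarrow> c = 0"
  unfolding Cst_def by (metis lookup_single_eq lookup_zero single_zero)

lemma Cst_inject [simp]: "Cst a = Cst b \<longleftrightarrow> a = b"
  by (metis Cst_diff Cst_eq_0_iff eq_iff_diff_eq_0)

lemma Cst_sum: "Cst (sum f A) = (\<Sum>x\<in>A. Cst (f x))"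
  by (induction A rule: infinite_finite_induct) (auto simp: Cst_add)

lemma Cst_of_nat: "Cst (of_nat n) = of_nat n"
  by (induction n) (auto simp: Cst_add)

lemma cf_Cst_mult: "cf (Cst c * p) m = c * cf p m"
proof (induction p rule: mpoly_induct)
  case (single k a)
  show ?case by (simp add: Cst_def mult_single lookup_single when_def)
next
  case (add p q)
  then show ?case by (simp add: distrib_left lookup_add)
qed

text \<open>Coordinates and partial derivatives are indexed by 0, 1, 2; every larger index also means z.\<close>
definition unit_mono :: "nat \<Rightarrow> mono" where
  "unit_mono i = (if i = 0 then (1,0,0) else if i = 1 then (0,1,0) else (0,0,1))"

definition Var :: "nat \<Rightarrow> mpoly" where
  "Var i = Poly_Mapping.single (unit_mono i) 1"

lemma single_power: "Poly_Mapping.single m c ^ n =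
    Poly_Mapping.single (((\<lambda>k. m + k) ^^ n) 0) (c ^ n)" for c :: complex and m :: mono
  by (induction n) (auto simp: mult_single)

lemma mono_shift: "(((\<lambda>k. m + k) ^^ n) 0) = (case m of (a,b,c) \<Rightarrow> (n*a, n*b, n*c))" for m :: mono
  by (induction n) (auto simp: zero_prod_def split: prod.splits)

lemma single_eq_vars:
  "Poly_Mapping.single (i,j,l) c = Cst c * (Var 0 ^ i * Var 1 ^ j * Var 2 ^ l)"
  by (simp add: Cst_def Var_def unit_mono_def single_power mono_shift mult_single)

text \<open>The ring endomorphism sending the variables to Y. Endomorphisms that kill given linear
  forms will serve to test membership in the ideal of these forms.\<close>

definition subst :: "(nat \<Rightarrow> mpoly) \<Rightarrow> mpoly \<Rightarrow> mpoly" where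
  "subst Y p = (\<Sum>m\<in>Poly_Mapping.keys p.
     (case m of (i,j,l) \<Rightarrow> Cst (cf p m) * (Y 0 ^ i * Y 1 ^ j * Y 2 ^ l)))"

lemma subst_add: "subst Y (p + q) = subst Y p + subst Y q"
  unfolding subst_def
  by (rule setsum_keys_plus_distrib) (auto simp: Cst_add distrib_right)

lemma subst_single: "subst Y (Poly_Mapping.single (i,j,l) c) = Cst c * (Y 0 ^ i * Y 1 ^ j * Y 2 ^ l)"
  by (auto simp: subst_def)

lemma subst_mult: "subst Y (p * q) = subst Y p * subst Y q"
proof (induction p rule: mpoly_induct)
  case (single m c)
  obtain i j l where m: "m = (i,j,l)" by (cases m)
  show ?case
  proof (induction q rule: mpoly_induct)
    case (single m' c')
    obtain i' j' l' where m': "m' = (i',j',l')" by (cases m')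
    show ?case
      by (simp add: m m' mult_single subst_single Cst_mult power_add algebra_simps)
  next
    case (add p q)
    then show ?case by (simp add: distrib_left subst_add)
  qed
next
  case (add p q)
  then show ?case by (simp add: distrib_right subst_add)
qed

lemma subst_Cst [simp]: "subst Y (Cst c) = Cst c"
  using subst_single[of Y 0 0 0 c] by (simp add: Cst_def zero_prod_def)

lemma subst_Var: "subst Y (Var 0) = Y 0" "subst Y (Var 1) = Y 1" "subst Y (Var 2) = Y 2"
  using subst_single[of Y 1 0 0 1] subst_single[of Y 0 1 0 1] subst_single[of Y 0 0 1 1]
  by (simp_all add: Var_def unit_mono_def)

section \<open>Partial derivatives\<close>

definition pd_raw :: "nat \<Rightarrow> poly3 \<Rightarrow> poly3" where
  "pd_raw i = (if i = 0 then dx else if i = 1 then dy else dz)"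

definition pder :: "nat \<Rightarrow> mpoly \<Rightarrow> mpoly" where
  "pder i p = Abs_poly_mapping (pd_raw i (cf p))"

lemma is_poly_pd_raw:
  assumes "is_poly p"
  shows "is_poly (pd_raw i p)"
proof -
  have fin: "finite {m. p (g m) \<noteq> 0}" if "inj g" for g :: "mono \<Rightarrow> mono"
    using finite_vimageI[OF assms[unfolded is_poly_def] that] by (simp add: vimage_def)
  have "finite {m. dx p m \<noteq> 0}"
    by (rule finite_subset[OF _ fin[of "\<lambda>(i,j,l). (Suc i, j, l)"]])
      (auto simp: dx_def intro!: injI)
  moreover have "finite {m. dy p m \<noteq> 0}"
    by (rule finite_subset[OF _ fin[of "\<lambda>(i,j,l). (i, Suc j, l)"]])
      (auto simp: dy_def intro!: injI)
  moreover have "finite {m. dz p m \<noteq> 0}"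
    by (rule finite_subset[OF _ fin[of "\<lambda>(i,j,l). (i, j, Suc l)"]])
      (auto simp: dz_def intro!: injI)
  ultimately show ?thesis by (simp add: pd_raw_def is_poly_def)
qed

lemma cf_pder: "cf (pder i p) = pd_raw i (cf p)"
  using is_poly_pd_raw[OF is_poly_cf, of i p] unfolding pder_def is_poly_def
  by (rule lookup_Abs_poly_mapping)

lemma pder_add: "pder i (p + q) = pder i p + pder i q"
  by (rule poly_mapping_eqI)
    (auto simp: cf_pder pd_raw_def dx_def dy_def dz_def lookup_add distrib_left)

definition exponent :: "nat \<Rightarrow> mono \<Rightarrow> nat" where
  "exponent i m = (case m of (a,b,c) \<Rightarrow> if i = 0 then a else if i = 1 then b else c)"

text \<open>Subtraction of exponents is truncated. If the variable is absent, the factor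
  \<open>of_nat (exponent i m)\<close> is zero, so the wrong exponent does no harm.\<close>

lemma pder_single: "pder i (Poly_Mapping.single m c) =
    Poly_Mapping.single (m - unit_mono i) (of_nat (exponent i m) * c)"
proof (rule poly_mapping_eqI)
  fix k :: mono
  obtain a b c' where m: "m = (a,b,c')" by (cases m)
  obtain a' b' c'' where k: "k = (a',b',c'')" by (cases k)
  show "cf (pder i (Poly_Mapping.single m c)) k =
    cf (Poly_Mapping.single (m - unit_mono i) (of_nat (exponent i m) * c)) k"
    by (auto simp: m k cf_pder pd_raw_def dx_def dy_def dz_def unit_mono_def exponent_def
        lookup_single when_def)
qed

lemma mono_diff_add:
  "exponent i m \<noteq> 0 \<Longrightarrow> m + m' - unit_mono i = (m - unit_mono i) + m'"
  by (cases m; cases m') (auto simp: exponent_def unit_mono_def split: if_splits)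

lemma exponent_add: "exponent i (m + m') = exponent i m + exponent i m'"
  by (cases m; cases m') (auto simp: exponent_def)

lemma pder_mult: "pder i (p * q) = pder i p * q + p * pder i q"
proof (induction p rule: mpoly_induct)
  case (single m c)
  show ?case
  proof (induction q rule: mpoly_induct)
    case (single m' c')
    have "Poly_Mapping.single (m + m' - unit_mono i) (of_nat (exponent i (m + m')) * (c * c'))
      = Poly_Mapping.single ((m - unit_mono i) + m') (of_nat (exponent i m) * c * c') +
        Poly_Mapping.single (m + (m' - unit_mono i)) (c * (of_nat (exponent i m') * c'))"
      using mono_diff_add[of i m m'] mono_diff_add[of i m' m]
      by (cases "exponent i m = 0"; cases "exponent i m' = 0")
        (auto simp: exponent_add add.commute algebra_simps simp flip: single_add)
    then show ?case by (simp add: pder_single mult_single)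
  next
    case (add p q)
    then show ?case by (simp add: distrib_left pder_add)
  qed
next
  case (add p q)
  then show ?case by (simp add: distrib_right pder_add)
qed

section \<open>Homogeneous polynomials\<close>

abbreviation hom :: "nat \<Rightarrow> mpoly \<Rightarrow> bool" where
  "hom k p \<equiv> homog k (cf p)"

definition mdeg :: "mono \<Rightarrow> nat" where "mdeg m = (case m of (i,j,l) \<Rightarrow> i + j + l)"

lemma mdeg_add: "mdeg (a + b) = mdeg a + mdeg b"
  by (cases a; cases b) (auto simp: mdeg_def)

lemma homog_iff: "homog k p \<longleftrightarrow> (\<forall>m. p m \<noteq> 0 \<longrightarrow> mdeg m = k)"
  by (auto simp: homog_def mdeg_def)

lemma finite_mdeg: "finite {m. mdeg m = k}"
  by (rule finite_subset[of _ "{..k} \<times> {..k} \<times> {..k}"]) (auto simp: mdeg_def)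

lemma homog_is_poly: "homog k p \<Longrightarrow> is_poly p"
  unfolding is_poly_def homog_iff by (rule finite_subset[OF _ finite_mdeg[of k]]) auto

lemma hom_0 [simp]: "hom k 0"
  by (simp add: homog_iff)

lemma hom_add: "hom k p \<Longrightarrow> hom k q \<Longrightarrow> hom k (p + q)"
  unfolding homog_iff lookup_add by (metis add.right_neutral)

lemma hom_diff: "hom k p \<Longrightarrow> hom k q \<Longrightarrow> hom k (p - q)"
  unfolding homog_iff lookup_minus by (metis diff_zero)

lemma hom_sum: "(\<And>x. x \<in> A \<Longrightarrow> hom k (f x)) \<Longrightarrow> hom k (sum f A)"
  by (induction A rule: infinite_finite_induct) (auto intro: hom_add)

lemma hom_mult: "hom a p \<Longrightarrow> hom b q \<Longrightarrow> hom (a + b) (p * q)"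
  unfolding homog_iff using keys_mult[of p q]
  by (smt (verit, ccfv_threshold) in_keys_iff mdeg_add mem_Collect_eq subset_iff)

lemma hom_Cst: "hom 0 (Cst c)"
  by (auto simp: homog_iff Cst_def lookup_single when_def mdeg_def zero_prod_def)

lemma hom_1 [simp]: "hom 0 1"
  using hom_Cst[of 1] by simp

lemma hom_0_iff: "hom 0 p \<longleftrightarrow> p = Cst (cf p 0)"
proof
  assume "hom 0 p"
  then show "p = Cst (cf p 0)"
    by (intro poly_mapping_eqI)
      (force simp: homog_def Cst_def lookup_single when_def zero_prod_def)
qed (metis hom_Cst)

lemma hom_Cst_mult: "hom k p \<Longrightarrow> hom k (Cst c * p)"
  using hom_mult[OF hom_Cst] by fastforce

lemma hom_Var: "hom 1 (Var i)"
  by (auto simp: homog_iff Var_def unit_mono_def mdeg_def lookup_single when_def split: if_splits)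

lemma hom_pder: "hom (Suc k) p \<Longrightarrow> hom k (pder i p)"
  by (force simp: homog_def cf_pder pd_raw_def dx_def dy_def dz_def)

text \<open>Multiplying the derivative by a variable restores the degree, so the statement also
  covers k = 0, where the derivative vanishes and no degree k - 1 exists.\<close>

lemma hom_Var_pder:
  assumes "hom k p"
  shows "hom k (Var j * pder i p)"
proof (cases k)
  case 0
  then have "pder i p = 0"
    using assms
    by (intro poly_mapping_eqI) (force simp: homog_def cf_pder pd_raw_def dx_def dy_def dz_def)
  then show ?thesis by simp
next
  case (Suc k')
  then show ?thesis using hom_mult[OF hom_Var hom_pder] assms by fastforce
qed

definition hpart :: "nat \<Rightarrow> mpoly \<Rightarrow> mpoly" where
  "hpart k p = Abs_poly_mapping (\<lambda>m. if mdeg m = k then cf p m else 0)"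

lemma cf_hpart: "cf (hpart k p) m = (if mdeg m = k then cf p m else 0)"
proof -
  have "finite {m. (if mdeg m = k then cf p m else 0) \<noteq> 0}"
    by (rule finite_subset[OF _ finite_mdeg[of k]]) auto
  then show ?thesis by (simp add: hpart_def)
qed

lemma hom_hpart [simp]: "hom k (hpart k p)"
  by (simp add: homog_iff cf_hpart)

lemma hpart_hom: "hom r p \<Longrightarrow> hpart k p = (if k = r then p else 0)"
  by (rule poly_mapping_eqI) (auto simp: homog_iff cf_hpart)

lemma hpart_add: "hpart k (p + q) = hpart k p + hpart k q"
  by (rule poly_mapping_eqI) (auto simp: cf_hpart lookup_add)

lemma hpart_0 [simp]: "hpart k 0 = 0"
  by (rule poly_mapping_eqI) (auto simp: cf_hpart)

lemma hpart_sum: "hpart k (sum f A) = (\<Sum>x\<in>A. hpart k (f x))"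
  by (induction A rule: infinite_finite_induct) (auto simp: hpart_add)

text \<open>This allows arbitrary coefficients in a combination of homogeneous generators to be
  replaced by homogeneous ones of the complementary degree.\<close>

lemma hpart_mult:
  assumes "hom r g"
  shows "hpart k (h * g) = (if r \<le> k then hpart (k - r) h * g else 0)"
proof (induction h rule: mpoly_induct)
  case (single m c)
  have s: "hom (mdeg m) (Poly_Mapping.single m c)"
    by (auto simp: homog_iff lookup_single when_def)
  show ?case
    using hpart_hom[OF hom_mult[OF s assms]] by (auto simp: hpart_hom[OF s])
next
  case (add p q)
  then show ?case by (simp add: distrib_right hpart_add)
qed

section \<open>Regular families and their syzygies\<close>

text \<open>\<open>nzd1 u p\<close> says that u is a nonzerodivisor modulo (p), and
  \<open>nzd2 u p q\<close> the same modulo (p, q). They take the place of coprimality and of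
  regular sequences of length three.\<close>

definition nzd1 :: "'a::comm_ring_1 \<Rightarrow> 'a \<Rightarrow> bool" where
  "nzd1 u p \<longleftrightarrow> (\<forall>h. p dvd u * h \<longrightarrow> p dvd h)"

definition in_ideal2 :: "'a::comm_ring_1 \<Rightarrow> 'a \<Rightarrow> 'a \<Rightarrow> bool" where
  "in_ideal2 p q h \<longleftrightarrow> (\<exists>a b. h = a * p + b * q)"

definition nzd2 :: "'a::comm_ring_1 \<Rightarrow> 'a \<Rightarrow> 'a \<Rightarrow> bool" where
  "nzd2 u p q \<longleftrightarrow> (\<forall>h. in_ideal2 p q (u * h) \<longrightarrow> in_ideal2 p q h)"

lemma nzd1D: "nzd1 u p \<Longrightarrow> p dvd u * h \<Longrightarrow> p dvd h"
  unfolding nzd1_def by blast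

lemma nzd1_1: "nzd1 1 p" and nzd1_mult_left: "nzd1 u p \<Longrightarrow> nzd1 v p \<Longrightarrow> nzd1 (u * v) p"
  unfolding nzd1_def by (metis mult_1, metis mult.assoc)

lemma nzd1_prod_left: "(\<And>i. i \<in> S \<Longrightarrow> nzd1 (f i) p) \<Longrightarrow> nzd1 (prod f S) p"
  by (induction S rule: infinite_finite_induct) (auto intro: nzd1_1 nzd1_mult_left)

lemma nzd1_mult_right:
  fixes u :: "'a::idom"
  assumes "p \<noteq> 0" "nzd1 u p" "nzd1 u q"
  shows "nzd1 u (p * q)"
  unfolding nzd1_def
proof (intro allI impI)
  fix h assume d: "p * q dvd u * h"
  then have "p dvd h" using assms(2) by (meson dvd_mult_left nzd1D)
  then obtain h' where h: "h = p * h'" by blast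
  have "q dvd u * h'" using d assms(1) by (simp add: h mult.left_commute)
  then have "q dvd h'" by (rule nzd1D[OF assms(3)])
  then show "p * q dvd h" unfolding h by (rule mult_dvd_mono[OF dvd_refl])
qed

lemma nzd1_prod:
  fixes f :: "'b \<Rightarrow> 'a::idom"
  assumes fin: "finite S" "finite T"
    and nz: "\<And>t. t \<in> T \<Longrightarrow> f t \<noteq> 0"
    and n: "\<And>s t. s \<in> S \<Longrightarrow> t \<in> T \<Longrightarrow> nzd1 (f s) (f t)"
  shows "nzd1 (prod f S) (prod f T)"
  using fin(2) nz n
proof (induction T)
  case empty
  show ?case unfolding nzd1_def by simp
next
  case (insert t T)
  then show ?case
    by (simp add: nzd1_mult_right nzd1_prod_left)
qed

text \<open>Factors are split off one at a time; the product already removed is a nonzerodivisor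
  modulo the next factor, which therefore divides the cofactor.\<close>

lemma prod_dvd_if_pairwise_nzd1:
  fixes f :: "'b \<Rightarrow> 'a::idom"
  assumes "finite S" "\<And>s t. s \<in> S \<Longrightarrow> t \<in> S \<Longrightarrow> s \<noteq> t \<Longrightarrow> nzd1 (f s) (f t)"
    and "\<And>s. s \<in> S \<Longrightarrow> f s dvd z"
  shows "prod f S dvd z"
  using assms
proof (induction S)
  case (insert s S)
  then obtain z' where z: "z = prod f S * z'" by (metis dvdE insertCI)
  have "nzd1 (prod f S) (f s)"
    using insert by (intro nzd1_prod_left) auto
  then have "f s dvd z'"
    using insert.prems(2)[of s] z by (auto dest: nzd1D)
  then show ?case using insert z by (simp add: mult.commute mult_dvd_mono)
qed simp

lemma nzd2_commute: "nzd2 u p q \<longleftrightarrow> nzd2 u q p"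
  unfolding nzd2_def in_ideal2_def by (metis add.commute)

lemma nzd2_1_middle: "nzd2 u 1 q"
  unfolding nzd2_def in_ideal2_def by (metis add_0_right mult.right_neutral mult_zero_left)

lemma nzd2_1_left: "nzd2 1 p q"
  and nzd2_mult_left: "nzd2 u p q \<Longrightarrow> nzd2 v p q \<Longrightarrow> nzd2 (u * v) p q"
  unfolding nzd2_def by (metis mult_1, metis mult.assoc)

lemma nzd2_prod_left: "(\<And>i. i \<in> S \<Longrightarrow> nzd2 (f i) p q) \<Longrightarrow> nzd2 (prod f S) p q"
  by (induction S rule: infinite_finite_induct) (auto intro: nzd2_1_left nzd2_mult_left)

text \<open>Since p is a nonzerodivisor modulo r, the quotient (p, r)/(pq, r) is a copy of the ring
  modulo (q, r), generated by p. Hence u is regular modulo (pq, r) once it is regular modulo (p, r)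
  and modulo (q, r).\<close>

lemma nzd2_mult_middle:
  fixes u p q r :: "'a::comm_ring_1"
  assumes "nzd2 u p r" "nzd2 u q r" "nzd1 p r"
  shows "nzd2 u (p * q) r"
  unfolding nzd2_def
proof (intro allI impI)
  fix h assume "in_ideal2 (p * q) r (u * h)"
  then obtain a b where ab: "u * h = a * (p * q) + b * r" by (auto simp: in_ideal2_def)
  then have "in_ideal2 p r (u * h)"
    unfolding in_ideal2_def by (intro exI[of _ "a * q"] exI[of _ b]) (simp add: algebra_simps)
  then have "in_ideal2 p r h" using assms(1) unfolding nzd2_def by blast
  then obtain c e where h: "h = c * p + e * r" by (auto simp: in_ideal2_def)
  have "p * (u * c - a * q) = r * (b - u * e)"
    using ab unfolding h by (simp add: algebra_simps)
  then have "r dvd p * (u * c - a * q)" by simp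
  then have "r dvd u * c - a * q" using assms(3) by (rule nzd1D[rotated])
  then obtain g where "u * c - a * q = r * g" by blast
  then have "in_ideal2 q r (u * c)"
    unfolding in_ideal2_def by (intro exI[of _ a] exI[of _ g]) (simp add: algebra_simps)
  then have "in_ideal2 q r c" using assms(2) unfolding nzd2_def by blast
  then obtain a' b' where "c = a' * q + b' * r" by (auto simp: in_ideal2_def)
  then show "in_ideal2 (p * q) r h"
    unfolding in_ideal2_def h
    by (intro exI[of _ a'] exI[of _ "b' * p + e"]) (simp add: algebra_simps)
qed

lemma nzd2_prod:
  fixes f :: "'b \<Rightarrow> 'a::idom"
  assumes fin: "finite S" "finite T" "finite U"
    and nz: "\<And>t. t \<in> T \<union> U \<Longrightarrow> f t \<noteq> 0"
    and n1: "\<And>s t. s \<in> T \<Longrightarrow> t \<in> U \<Longrightarrow> nzd1 (f s) (f t) \<and> nzd1 (f t) (f s)"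
    and n2: "\<And>s t u. s \<in> S \<Longrightarrow> t \<in> T \<Longrightarrow> u \<in> U \<Longrightarrow> nzd2 (f s) (f t) (f u)"
  shows "nzd2 (prod f S) (prod f T) (prod f U)"
proof -
  \<comment> \<open>The modulus is built up first in its third entry and then in its second. The two
    passes multiply in opposite slots, so they use the two directions of the pairwise
    hypothesis.\<close>
  have 1: "nzd2 (prod f S) (f t) (prod f U)" if t: "t \<in> T" for t
    using fin(3) n1[OF t] n2[OF _ t]
  proof (induction U)
    case empty
    show ?case by (metis nzd2_1_middle nzd2_commute prod.empty)
  next
    case (insert u U)
    then have "nzd2 (prod f S) (f u * prod f U) (f t)"
      by (intro nzd2_mult_middle) (auto simp: nzd2_commute[of _ _ "f t"] intro!: nzd2_prod_left)
    then show ?case using insert by (simp add: nzd2_commute)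
  qed
  have sub: "T' \<subseteq> T \<Longrightarrow> nzd2 (prod f S) (prod f T') (prod f U)" if "finite T'" for T'
    using that
  proof (induction T')
    case empty
    show ?case using nzd2_1_middle by simp
  next
    case (insert t T')
    have "nzd1 (f t) (prod f U)"
      using nzd1_prod[of "{t}" U f] insert.prems fin nz n1 by auto
    then show ?case using insert 1 by (auto intro!: nzd2_mult_middle)
  qed
  show ?thesis using sub[OF fin(2)] by simp
qed

text \<open>Any two of the vectors (x i, y i) form a basis of the free module of rank two.
  Regularity is expressed without requiring proper ideals, so some q i may be units; a point of L on
  no line of the arrangement gives q i = 1.\<close>

locale regular_family =
  fixes q x y :: "nat \<Rightarrow> 'a::idom" and N :: nat
  assumes q_nz: "i < N \<Longrightarrow> q i \<noteq> 0"
    and q_nzd1: "i < N \<Longrightarrow> j < N \<Longrightarrow> i \<noteq> j \<Longrightarrow> nzd1 (q i) (q j)"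
    and q_nzd2: "i < N \<Longrightarrow> j < N \<Longrightarrow> k < N \<Longrightarrow> i \<noteq> j \<Longrightarrow> i \<noteq> k \<Longrightarrow> j \<noteq> k \<Longrightarrow>
      nzd2 (q i) (q j) (q k)"
    and xy_unit: "i < N \<Longrightarrow> j < N \<Longrightarrow> i \<noteq> j \<Longrightarrow> x i * y j - x j * y i dvd 1"
begin

text \<open>The argument n is the number of members considered so far, over which
  \<open>generation\<close> inducts.\<close>

definition cof :: "nat \<Rightarrow> nat \<Rightarrow> 'a" where
  "cof n i = (\<Prod>j\<in>{..<n} - {i}. q j)"

lemma cof_mult: "i < n \<Longrightarrow> q i * cof n i = (\<Prod>j<n. q j)"
  unfolding cof_def by (rule prod.remove[symmetric]) auto

lemma cof_Suc: "i < n \<Longrightarrow> cof (Suc n) i = q n * cof n i"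
proof -
  assume i: "i < n"
  have "{..<Suc n} - {i} = insert n ({..<n} - {i})" using i by auto
  then show ?thesis by (simp add: cof_def)
qed

lemma cof_last: "cof (Suc n) n = (\<Prod>j<n. q j)"
proof -
  have "{..<Suc n} - {n} = {..<n}" by auto
  then show ?thesis by (simp add: cof_def)
qed

lemma dvd_cof: "i < n \<Longrightarrow> j \<noteq> i \<Longrightarrow> q i dvd cof n j"
  unfolding cof_def by (rule dvd_prodI) auto

lemma prod_q_nz: "n \<le> N \<Longrightarrow> (\<Prod>j<n. q j) \<noteq> 0"
  using q_nz by auto

lemma nzd1_cof: "n \<le> N \<Longrightarrow> i < n \<Longrightarrow> nzd1 (cof n i) (q i)"
  unfolding cof_def by (rule nzd1_prod_left) (auto intro: q_nzd1)

text \<open>The second vector serves only to make (x i, y i) unimodular: the determinant combines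
  the two hypotheses into divisibility of h times a unit.\<close>

lemma dvd_both_imp_dvd:
  assumes "i < N" "j < N" "i \<noteq> j" "p dvd h * x i" "p dvd h * y i"
  shows "p dvd h"
proof -
  have "p dvd h * x i * y j - h * y i * x j" using assms(4,5) by (auto intro: dvd_diff dvd_mult2)
  then have "p dvd h * (x i * y j - x j * y i)" by (simp add: algebra_simps)
  moreover obtain v where "1 = (x i * y j - x j * y i) * v" using xy_unit[OF assms(1-3)] by blast
  ultimately show ?thesis by (metis dvd_mult2 mult.assoc mult.right_neutral)
qed

text \<open>Modulo q j every summand except the j-th vanishes, so q j divides
  \<open>h j * cof N j\<close> times both coordinates; unimodularity and regularity of the cofactor
  give q j dividing h j. After writing h j = q j c j, every summand contains the product of all q j,
  which cancels.\<close>

lemma syzygy: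
  assumes N: "2 \<le> N"
    and sx: "(\<Sum>i<N. h i * cof N i * x i) = 0" and sy: "(\<Sum>i<N. h i * cof N i * y i) = 0"
  shows "\<exists>c. (\<forall>i<N. h i = q i * c i) \<and> (\<Sum>i<N. c i * x i) = 0 \<and> (\<Sum>i<N. c i * y i) = 0"
proof -
  have dv: "q j dvd h j" if j: "j < N" for j
  proof -
    have *: "q j dvd h j * cof N j * z j" if s: "(\<Sum>i<N. h i * cof N i * z i) = 0" for z :: "nat \<Rightarrow> 'a"
    proof -
      have "(\<Sum>i<N. h i * cof N i * z i) = h j * cof N j * z j + (\<Sum>i\<in>{..<N} - {j}. h i * cof N i * z i)"
        using j by (intro sum.remove) auto
      then have "h j * cof N j * z j = - (\<Sum>i\<in>{..<N} - {j}. h i * cof N i * z i)"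
        using s by (simp add: add_eq_0_iff2)
      moreover have "q j dvd (\<Sum>i\<in>{..<N} - {j}. h i * cof N i * z i)"
        using j by (intro dvd_sum dvd_mult2 dvd_mult dvd_cof) auto
      ultimately show ?thesis by simp
    qed
    obtain i where i: "i < N" "j \<noteq> i" using N j by (metis One_nat_def Suc_1 Suc_le_lessD less_trans lessI zero_neq_one less_2_cases not_less_eq)
    have "q j dvd h j * cof N j"
      using dvd_both_imp_dvd[OF j i] *[OF sx] *[OF sy] by blast
    then show ?thesis using nzd1_cof[OF order.refl j] nzd1D by (metis mult.commute)
  qed
  define c where "c i = (SOME c. h i = q i * c)" for i
  have c: "h i = q i * c i" if "i < N" for i
    using dv[OF that] unfolding c_def by (metis (mono_tags, lifting) dvdE someI_ex)
  have "(\<Sum>i<N. c i * z i) = 0" if "(\<Sum>i<N. h i * cof N i * z i) = 0" for z :: "nat \<Rightarrow> 'a"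
  proof -
    have "(\<Sum>i<N. h i * cof N i * z i) = (\<Sum>i<N. (\<Prod>j<N. q j) * (c i * z i))"
      by (rule sum.cong) (auto simp: c cof_mult[symmetric] algebra_simps)
    also have "\<dots> = (\<Prod>j<N. q j) * (\<Sum>i<N. c i * z i)" by (simp add: sum_distrib_left)
    finally show ?thesis using that prod_q_nz[OF order.refl] by auto
  qed
  then show ?thesis using c sx sy by blast
qed

lemma syzygy_conv:
  assumes "\<And>i. i < N \<Longrightarrow> h i = q i * c i" "(\<Sum>i<N. c i * z i) = 0"
  shows "(\<Sum>i<N. h i * cof N i * z i) = 0"
proof -
  have "(\<Sum>i<N. h i * cof N i * z i) = (\<Sum>i<N. (\<Prod>j<N. q j) * (c i * z i))"
    by (rule sum.cong) (auto simp: assms cof_mult[symmetric] algebra_simps)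
  also have "\<dots> = 0" using assms(2) by (simp flip: sum_distrib_left)
  finally show ?thesis .
qed

text \<open>Induction on the number of members: a combination of the first n generators that also
  satisfies the divisibility condition of q n is, modulo (q n), a syzygy of the cofactors,
  and by regularity these syzygies are the trivial ones.\<close>
lemma generation:
  assumes "2 \<le> n" "n \<le> N" "\<And>i. i < n \<Longrightarrow> q i dvd y i * a - x i * b"
  shows "\<exists>h. a = (\<Sum>i<n. h i * cof n i * x i) \<and> b = (\<Sum>i<n. h i * cof n i * y i)"
  using assms
proof (induction n rule: dec_induct)
  case base
  have N: "0 < N" "1 < N" using base by auto
  obtain v where v: "(x 0 * y 1 - x 1 * y 0) * v = 1" using xy_unit[OF N] by (metis dvdE zero_neq_one)
  obtain s where s: "y 0 * a - x 0 * b = q 0 * s" using base(2)[of 0] by auto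
  obtain t where t: "y 1 * a - x 1 * b = q 1 * t" using base(2)[of 1] by auto
  have c: "cof 2 0 = q 1" "cof 2 (Suc 0) = q 0"
    using cof_Suc[of 0 1] cof_last[of 1] by (simp_all add: cof_def numeral_2_eq_2 lessThan_Suc)
  \<comment> \<open>Cramer's rule: two divisibility conditions on (a, b) along independent vectors
    determine it.\<close>
  have "(x 0 * y 1 - x 1 * y 0) * v * a = (q 1 * t) * v * x 0 - (q 0 * s) * v * x 1"
    unfolding s[symmetric] t[symmetric] by (simp add: algebra_simps)
  moreover have "(x 0 * y 1 - x 1 * y 0) * v * b = (q 1 * t) * v * y 0 - (q 0 * s) * v * y 1"
    unfolding s[symmetric] t[symmetric] by (simp add: algebra_simps)
  ultimately show ?case unfolding v
    by (intro exI[of _ "\<lambda>i. if i = 0 then t * v else - s * v"])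
      (simp add: numeral_2_eq_2 c[unfolded numeral_2_eq_2] algebra_simps)
next
  case (step n)
  have nN: "n < N" and n2: "0 < n" using step by auto
  obtain h where ha: "a = (\<Sum>i<n. h i * cof n i * x i)" and hb: "b = (\<Sum>i<n. h i * cof n i * y i)"
    using step by fastforce
  \<comment> \<open>The determinant of vector i against the new vector n, a unit with inverse w i.
    Pairing the combination for (a, b) with vector n turns the new condition into a scalar relation
    with coefficients h i * u i.\<close>
  define u where "u i = x i * y n - x n * y i" for i
  define P where "P = (\<Prod>j<n. q j)"
  have "\<exists>v. u i * v = 1" if "i < n" for i
    unfolding u_def using xy_unit[of i n] that nN by (metis dvdE less_trans less_irrefl_nat)
  then obtain w where w: "\<And>i. i < n \<Longrightarrow> u i * w i = 1" by metis
  have "y n * a - x n * b = (\<Sum>i<n. h i * u i * cof n i)"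
    unfolding ha hb u_def by (simp add: sum_distrib_left sum_subtractf[symmetric] algebra_simps)
  then obtain t where t: "(\<Sum>i<n. h i * u i * cof n i) = q n * t"
    using step.prems(2)[of n] by auto
  \<comment> \<open>Modulo (q j, q n) only the j-th summand remains, and its cofactor is a product
    of other members, each regular modulo this ideal.\<close>
  have "\<exists>c g. h j * u j = c * q j + g * q n" if j: "j < n" for j
  proof -
    have "(\<Sum>i<n. h i * u i * cof n i) = h j * u j * cof n j + (\<Sum>i\<in>{..<n} - {j}. h i * u i * cof n i)"
      using j by (intro sum.remove) auto
    moreover have "q j dvd (\<Sum>i\<in>{..<n} - {j}. h i * u i * cof n i)"
      using j by (intro dvd_sum dvd_mult dvd_cof) auto
    then obtain r where "(\<Sum>i\<in>{..<n} - {j}. h i * u i * cof n i) = q j * r" by blast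
    ultimately have "cof n j * (h j * u j) = (- r) * q j + t * q n"
      using t by (simp add: algebra_simps)
    then have "in_ideal2 (q j) (q n) (cof n j * (h j * u j))"
      unfolding in_ideal2_def by blast
    moreover have "nzd2 (cof n j) (q j) (q n)"
      unfolding cof_def using j nN by (intro nzd2_prod_left q_nzd2) auto
    ultimately have "in_ideal2 (q j) (q n) (h j * u j)" unfolding nzd2_def by blast
    then show ?thesis by (simp add: in_ideal2_def)
  qed
  then obtain c g where cg: "\<And>j. j < n \<Longrightarrow> h j * u j = c j * q j + g j * q n" by metis
  \<comment> \<open>After substitution, P times the sum of the c i is the only part not visibly
    divisible by q n; regularity of P modulo q n then makes that sum divisible.\<close>
  have "q n * t = (\<Sum>i<n. (c i * q i + g i * q n) * cof n i)"
    unfolding t[symmetric] by (rule sum.cong) (auto simp: cg)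
  also have "\<dots> = (\<Sum>i<n. P * c i + q n * (g i * cof n i))"
    by (rule sum.cong) (auto simp: P_def cof_mult[symmetric] algebra_simps)
  also have "\<dots> = P * (\<Sum>i<n. c i) + q n * (\<Sum>i<n. g i * cof n i)"
    by (simp add: sum.distrib sum_distrib_left)
  finally have "P * (\<Sum>i<n. c i) = q n * (t - (\<Sum>i<n. g i * cof n i))"
    by (simp add: algebra_simps)
  then have "q n dvd P * (\<Sum>i<n. c i)" by simp
  moreover have "nzd1 P (q n)" unfolding P_def using nN by (intro nzd1_prod_left q_nzd1) auto
  ultimately obtain e where e: "(\<Sum>i<n. c i) = q n * e" by (meson dvdE nzd1D)
  \<comment> \<open>The part of (a, b) not yet divisible by q n is P times the vector V = (Vx, Vy).
    Its determinant against vector n is the sum of the c i, hence q n * e, so Cramer's rule in the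
    basis of vectors 0 and n gives V a component along vector 0 that is divisible by q n.\<close>
  define Vx where "Vx = (\<Sum>i<n. w i * c i * x i)"
  define Vy where "Vy = (\<Sum>i<n. w i * c i * y i)"
  have hw: "h i = w i * (c i * q i + g i * q n)" if "i < n" for i
    using cg[OF that] w[OF that] by (metis mult.assoc mult.commute mult.right_neutral)
  have sumz: "(\<Sum>i<n. h i * cof n i * z i) =
      P * (\<Sum>i<n. w i * c i * z i) + (\<Sum>i<n. w i * g i * (q n * cof n i) * z i)" for z
  proof -
    have "(\<Sum>i<n. h i * cof n i * z i) =
        (\<Sum>i<n. P * (w i * c i * z i) + w i * g i * (q n * cof n i) * z i)"
      by (rule sum.cong) (auto simp: hw P_def cof_mult[symmetric] algebra_simps)
    then show ?thesis by (simp add: sum.distrib sum_distrib_left)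
  qed
  have V: "y n * Vx - x n * Vy = q n * e"
  proof -
    have "y n * Vx - x n * Vy = (\<Sum>i<n. c i * (u i * w i))"
      unfolding Vx_def Vy_def u_def
      by (simp add: sum_distrib_left sum_subtractf[symmetric] algebra_simps)
    also have "\<dots> = (\<Sum>i<n. c i)" by (rule sum.cong) (auto simp: w)
    finally show ?thesis using e by simp
  qed
  define r where "r = (x 0 * Vy - y 0 * Vx) * w 0"
  have u0: "(x 0 * y n - x n * y 0) * w 0 = 1" using w[OF n2] by (simp add: u_def)
  have "Vx = ((x 0 * y n - x n * y 0) * w 0) * Vx" by (simp add: u0)
  also have "\<dots> = (y n * Vx - x n * Vy) * w 0 * x 0 + r * x n"
    by (simp add: r_def algebra_simps)
  finally have Vx: "Vx = q n * e * w 0 * x 0 + r * x n" unfolding V .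
  have "Vy = ((x 0 * y n - x n * y 0) * w 0) * Vy" by (simp add: u0)
  also have "\<dots> = (y n * Vx - x n * Vy) * w 0 * y 0 + r * y n"
    by (simp add: r_def algebra_simps)
  finally have Vy: "Vy = q n * e * w 0 * y 0 + r * y n" unfolding V .
  \<comment> \<open>P is the cofactor of the new index, so the component of V along vector n has
    coefficient r. The component along vector 0 is absorbed by cofactor 0, since P * q n = q 0 * cof
    (n+1) 0.\<close>
  define h' where "h' i = (if i = n then r else w i * g i + (if i = 0 then e * w 0 * q 0 else 0))" for i
  have fin: "(\<Sum>i<Suc n. h' i * cof (Suc n) i * z i) =
      P * (q n * e * w 0 * z 0 + r * z n) + (\<Sum>i<n. w i * g i * (q n * cof n i) * z i)" for z
  proof -
    have "(\<Sum>i<n. h' i * cof (Suc n) i * z i) =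
      (\<Sum>i<n. w i * g i * (q n * cof n i) * z i + (if i = 0 then e * w 0 * q 0 * (q n * cof n 0) * z 0 else 0))"
      by (rule sum.cong) (auto simp: h'_def cof_Suc algebra_simps)
    also have "\<dots> = (\<Sum>i<n. w i * g i * (q n * cof n i) * z i) + e * w 0 * q 0 * (q n * cof n 0) * z 0"
      using n2 by (simp add: sum.distrib sum.delta)
    also have "e * w 0 * q 0 * (q n * cof n 0) * z 0 = P * (q n * e * w 0 * z 0)"
      by (simp add: P_def cof_mult[OF n2, symmetric] algebra_simps)
    finally show ?thesis
      by (simp add: h'_def cof_last P_def algebra_simps)
  qed
  show ?case
    using fin[of x] fin[of y] sumz[of x] sumz[of y] ha hb Vx Vy
    unfolding Vx_def Vy_def by (intro exI[of _ h']) simp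
qed

end

section \<open>Linear forms\<close>

definition vc :: "vec3 \<Rightarrow> nat \<Rightarrow> complex" where
  "vc v i = (case v of (a,b,c) \<Rightarrow> if i = 0 then a else if i = 1 then b else c)"

definition dot :: "vec3 \<Rightarrow> vec3 \<Rightarrow> complex" where
  "dot u v = (case u of (a,b,c) \<Rightarrow> case v of (x,y,z) \<Rightarrow> a*x + b*y + c*z)"

definition cross :: "vec3 \<Rightarrow> vec3 \<Rightarrow> vec3" where
  "cross u v = (case u of (a,b,c) \<Rightarrow> case v of (x,y,z) \<Rightarrow> (b*z - c*y, c*x - a*z, a*y - b*x))"

lemma on_line_iff: "on_line l v \<longleftrightarrow> dot l v = 0"
  by (simp add: on_line_def dot_def split: prod.splits)

lemma prop_eq_sym: "prop_eq u v \<Longrightarrow> prop_eq v u"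
proof -
  assume "prop_eq u v"
  then obtain c where "c \<noteq> 0" "u = smul3 c v" by (auto simp: prop_eq_def)
  then show "prop_eq v u"
    unfolding prop_eq_def by (intro exI[of _ "1/c"]) (auto simp: smul3_def split: prod.splits)
qed

lemma prop_eq_refl: "prop_eq u u"
  unfolding prop_eq_def by (intro exI[of _ 1]) (auto simp: smul3_def split: prod.splits)

lemma prop_eq_iff_cross:
  assumes "u \<noteq> (0,0,0)" "v \<noteq> (0,0,0)"
  shows "prop_eq u v \<longleftrightarrow> cross u v = (0,0,0)"
proof
  assume "prop_eq u v"
  then show "cross u v = (0,0,0)"
    by (auto simp: prop_eq_def smul3_def cross_def split: prod.splits)
next
  obtain a b c where u: "u = (a,b,c)" by (cases u)
  obtain x y z where v: "v = (x,y,z)" by (cases v)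
  assume "cross u v = (0,0,0)"
  then have e: "b*z = c*y" "c*x = a*z" "a*y = b*x" by (auto simp: cross_def u v)
  consider "x \<noteq> 0" | "y \<noteq> 0" | "z \<noteq> 0" using assms(2) v by auto
  then obtain k where k: "a = k * x" "b = k * y" "c = k * z"
  proof cases
    case 1 then show ?thesis using e by (intro that[of "a/x"]) (auto simp: field_simps)
  next
    case 2 then show ?thesis using e by (intro that[of "b/y"]) (auto simp: field_simps)
  next
    case 3 then show ?thesis using e by (intro that[of "c/z"]) (auto simp: field_simps)
  qed
  have "k \<noteq> 0" using k assms(1) u by auto
  then show "prop_eq u v" using k by (auto simp: prop_eq_def smul3_def u v)
qed

lemma dot_cross: "dot u (cross u v) = 0" "dot v (cross u v) = 0"
  by (cases u; cases v; simp add: dot_def cross_def algebra_simps)+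

lemma dot_commute: "dot u v = dot v u"
  by (cases u; cases v) (simp add: dot_def mult.commute)

lemma dot_0 [simp]: "dot (0,0,0) w = 0"
  by (simp add: dot_def split: prod.splits)

text \<open>Two independent linear conditions leave a line of solutions. By duality this covers both
  the common point of two lines and the line through two points.\<close>

lemma cross_nonzero_prop:
  assumes "dot w u = 0" "dot w v = 0" "w \<noteq> (0,0,0)" "cross u v \<noteq> (0,0,0)"
  shows "prop_eq w (cross u v)"
proof -
  obtain a b c where u: "u = (a,b,c)" by (cases u)
  obtain x y z where v: "v = (x,y,z)" by (cases v)
  obtain r s t where w: "w = (r,s,t)" by (cases w)
  have "r*a + s*b + t*c = 0" "r*x + s*y + t*z = 0"
    using assms(1,2) by (auto simp: dot_def u v w)
  then have "s * (a*y - b*x) - t * (c*x - a*z) = 0" "t * (b*z - c*y) - r * (a*y - b*x) = 0"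
    "r * (c*x - a*z) - s * (b*z - c*y) = 0"
    by algebra+
  then have "cross w (cross u v) = (0,0,0)" by (simp add: cross_def u v w)
  then show ?thesis using assms prop_eq_iff_cross by blast
qed

lemma dot_smul3: "dot (smul3 c u) v = c * dot u v" "dot u (smul3 c v) = c * dot u v"
  by (auto simp: dot_def smul3_def algebra_simps split: prod.splits)

lemma dot_eq_1: "l \<noteq> (0,0,0) \<Longrightarrow> \<exists>w. dot l w = 1"
proof -
  assume "l \<noteq> (0,0,0)"
  then obtain a b c where l: "l = (a,b,c)" "a \<noteq> 0 \<or> b \<noteq> 0 \<or> c \<noteq> 0" by (cases l) auto
  then have "dot l (1/a,0,0) = 1 \<or> dot l (0,1/b,0) = 1 \<or> dot l (0,0,1/c) = 1"
    by (auto simp: dot_def)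
  then show ?thesis by blast
qed

definition LF :: "vec3 \<Rightarrow> mpoly" where
  "LF l = (\<Sum>i<3. Cst (vc l i) * Var i)"

lemma sum_lessThan_3: "(\<Sum>i<3. f i) = f 0 + f 1 + f (2::nat)"
  by (simp add: numeral_3_eq_3 numeral_2_eq_2)

lemma cf_LF: "cf (LF l) = lin_form l"
proof
  fix m :: mono
  show "cf (LF l) m = lin_form l m"
    by (cases m; cases l)
      (auto simp: LF_def sum_lessThan_3 vc_def lookup_add cf_Cst_mult Var_def unit_mono_def
        lookup_single when_def lin_form_def)
qed

lemma hom_LF: "hom 1 (LF l)"
  unfolding LF_def by (intro hom_sum hom_Cst_mult hom_Var)

lemma LF_eq_0_iff [simp]: "LF l = 0 \<longleftrightarrow> l = (0,0,0)"
proof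
  assume "LF l = 0"
  then have *: "lin_form l m = 0" for m using cf_LF[of l] by (metis lookup_zero)
  show "l = (0,0,0)"
    using *[of "(1,0,0)"] *[of "(0,1,0)"] *[of "(0,0,1)"] by (cases l) (simp add: lin_form_def)
qed (auto simp: LF_def vc_def sum_lessThan_3)

lemma LF_0 [simp]: "LF (0,0,0) = 0"
  by simp

text \<open>With \<open>LF_eq_0_iff\<close> this turns a linear relation between forms into a
  relation between coefficient vectors.\<close>

lemma LF_diff_comb:
  "LF (vc l 0 - s * vc l' 0 - t * vc l'' 0, vc l 1 - s * vc l' 1 - t * vc l'' 1,
    vc l 2 - s * vc l' 2 - t * vc l'' 2) = LF l - Cst s * LF l' - Cst t * LF l''"
  by (cases l; cases l'; cases l'')
    (simp add: LF_def sum_lessThan_3 vc_def Cst_diff Cst_add Cst_mult algebra_simps)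

section \<open>Ideals generated by two linear forms\<close>

lemma in_ideal2_add: "in_ideal2 p q g \<Longrightarrow> in_ideal2 p q h \<Longrightarrow> in_ideal2 p q (g + h)"
proof -
  assume "in_ideal2 p q g" "in_ideal2 p q h"
  then obtain a b c d where "g = a * p + b * q" "h = c * p + d * q" by (auto simp: in_ideal2_def)
  then have "g + h = (a + c) * p + (b + d) * q" by (simp add: algebra_simps)
  then show ?thesis unfolding in_ideal2_def by blast
qed

lemma in_ideal2_mult: "in_ideal2 p q g \<Longrightarrow> in_ideal2 p q (h * g)"
  unfolding in_ideal2_def by (metis (no_types, opaque_lifting) distrib_left mult.assoc)

lemma in_ideal2_0 [simp]: "in_ideal2 p q 0"
  unfolding in_ideal2_def by (metis add_0 mult_zero_left)

lemma in_ideal2_zero_iff: "in_ideal2 p 0 h \<longleftrightarrow> p dvd h"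
  unfolding in_ideal2_def by (auto simp: dvd_def mult.commute)

lemma in_ideal2_diff_mult:
  assumes "in_ideal2 p q (g - g')" "in_ideal2 p q (h - h')"
  shows "in_ideal2 p q (g * h - g' * h')"
proof -
  have "g * h - g' * h' = g * (h - h') + h' * (g - g')" by (simp add: algebra_simps)
  then show ?thesis using assms by (simp only: in_ideal2_add in_ideal2_mult)
qed

lemma in_ideal2_diff_power:
  assumes "in_ideal2 p q (g - g')"
  shows "in_ideal2 p q (g ^ k - g' ^ k)"
  using assms by (induction k) (auto intro: in_ideal2_diff_mult)

text \<open>Congruent arguments give congruent values. Consequently a polynomial killed by a
  substitution that is the identity modulo (p, q) lies in (p, q).\<close>

lemma in_ideal2_subst:
  assumes Y: "\<And>i. in_ideal2 p q (Var i - Y i)"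
  shows "in_ideal2 p q (h - subst Y h)"
proof (induction h rule: mpoly_induct)
  case (single m c)
  obtain i j l where m: "m = (i,j,l)" by (cases m)
  have "in_ideal2 p q (Var 0 ^ i * Var 1 ^ j * Var 2 ^ l - Y 0 ^ i * Y 1 ^ j * Y 2 ^ l)"
    by (intro in_ideal2_diff_mult in_ideal2_diff_power Y)
  then have "in_ideal2 p q (Cst c * (Var 0 ^ i * Var 1 ^ j * Var 2 ^ l - Y 0 ^ i * Y 1 ^ j * Y 2 ^ l))"
    by (rule in_ideal2_mult)
  then show ?case
    unfolding m subst_single unfolding single_eq_vars by (simp add: algebra_simps)
next
  case (add g h)
  have "g + h - subst Y (g + h) = (g - subst Y g) + (h - subst Y h)"
    by (simp add: subst_add)
  then show ?case using add by (simp only: in_ideal2_add)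
qed

lemma subst_LF: "subst Y (LF l) = Cst (vc l 0) * Y 0 + Cst (vc l 1) * Y 1 + Cst (vc l 2) * Y 2"
  by (simp add: LF_def sum_lessThan_3 subst_add subst_mult subst_Var flip: One_nat_def)

text \<open>The linear projection along w1, w2 onto the common zeros of two forms induces a
  substitution that kills both forms and is the identity modulo them.\<close>
lemma subst_LF_proj:
  "subst (\<lambda>i. Var i - Cst (vc w1 i) * LF l' - Cst (vc w2 i) * LF l'') (LF l) =
    LF l - Cst (dot l w1) * LF l' - Cst (dot l w2) * LF l''"
proof -
  obtain a b c where l: "l = (a,b,c)" by (cases l)
  obtain x y z where w1: "w1 = (x,y,z)" by (cases w1)
  obtain x' y' z' where w2: "w2 = (x',y',z')" by (cases w2)
  have LFl: "LF l = Cst a * Var 0 + Cst b * Var 1 + Cst c * Var 2"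
    by (simp add: LF_def sum_lessThan_3 vc_def l)
  show ?thesis unfolding subst_LF unfolding LFl
    by (simp add: dot_def vc_def l w1 w2 Cst_add Cst_mult algebra_simps)
qed

text \<open>The projection kills the two forms and is the identity modulo them, so its kernel is
  exactly their ideal; its values lie in a domain, so that ideal is prime, and it suffices that the
  image of the first form is nonzero. Allowing l'' = 0 covers the principal ideal needed for
  \<open>nzd1\<close>.\<close>

lemma nzd_via_projection:
  assumes "l \<noteq> (0,0,0)"
    and 1: "dot l' w1 = 1" "dot l' w2 = 0" and 2: "l'' = (0,0,0) \<or> dot l'' w1 = 0 \<and> dot l'' w2 = 1"
    and ne: "LF l \<noteq> Cst (dot l w1) * LF l' + Cst (dot l w2) * LF l''"
  shows "nzd2 (LF l) (LF l') (LF l'')"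
  unfolding nzd2_def
proof (intro allI impI)
  define Y where "Y i = Var i - Cst (vc w1 i) * LF l' - Cst (vc w2 i) * LF l''" for i
  fix h assume "in_ideal2 (LF l') (LF l'') (LF l * h)"
  then obtain a b where ab: "LF l * h = a * LF l' + b * LF l''" by (auto simp: in_ideal2_def)
  have s: "subst Y (LF l') = 0" "subst Y (LF l'') = 0"
    "subst Y (LF l) = LF l - Cst (dot l w1) * LF l' - Cst (dot l w2) * LF l''"
    unfolding Y_def subst_LF_proj using 1 2 by auto
  have "subst Y (LF l) * subst Y h = 0"
    using arg_cong[OF ab, of "subst Y"] by (simp add: subst_mult subst_add s(1,2))
  moreover have "subst Y (LF l) \<noteq> 0" using ne unfolding s(3) by (auto simp: algebra_simps)
  ultimately have h: "subst Y h = 0" by simp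
  have "in_ideal2 (LF l') (LF l'') (Var i - Y i)" for i
    unfolding Y_def in_ideal2_def by (intro exI[of _ "Cst (vc w1 i)"] exI[of _ "Cst (vc w2 i)"]) (simp add: algebra_simps)
  from in_ideal2_subst[OF this, of h] show "in_ideal2 (LF l') (LF l'') h" by (simp add: h)
qed

lemma nzd1_LF:
  assumes l: "l \<noteq> (0,0,0)" "l' \<noteq> (0,0,0)" "\<not> prop_eq l l'"
  shows "nzd1 (LF l) (LF l')"
proof -
  obtain w where w: "dot l' w = 1" using dot_eq_1[OF l(2)] by blast
  have "LF l \<noteq> Cst (dot l w) * LF l'"
  proof
    assume "LF l = Cst (dot l w) * LF l'"
    then have "LF (vc l 0 - dot l w * vc l' 0 - 0, vc l 1 - dot l w * vc l' 1 - 0, vc l 2 - dot l w * vc l' 2 - 0) = 0"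
      using LF_diff_comb[of l "dot l w" l' 0 "(0,0,0)"] by simp
    then have c: "vc l 0 = dot l w * vc l' 0" "vc l 1 = dot l w * vc l' 1" "vc l 2 = dot l w * vc l' 2"
      by simp_all
    define t where "t = dot l w"
    have e: "l = smul3 (dot l w) l'" using c unfolding t_def[symmetric]
      by (cases l; cases l') (simp add: smul3_def vc_def)
    have "dot l w \<noteq> 0"
    proof
      assume "dot l w = 0"
      then show False using l(1) c by (cases l) (simp add: vc_def)
    qed
    then show False using e l(3) by (auto simp: prop_eq_def)
  qed
  then have "nzd2 (LF l) (LF l') (LF (0,0,0))"
    using l w by (intro nzd_via_projection[of _ _ w "(0,0,0)"]) (auto simp: dot_def)
  then show ?thesis unfolding nzd1_def nzd2_def LF_0 in_ideal2_zero_iff .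
qed

lemma dual_pair:
  assumes "cross l l' \<noteq> (0,0,0)"
  shows "\<exists>w1 w2. dot l w1 = 1 \<and> dot l' w1 = 0 \<and> dot l w2 = 0 \<and> dot l' w2 = 1"
proof -
  \<comment> \<open>The dual vectors are cross products with w; their pairings with l and l' are
    scalar triple products, normalised to 1 by the choice of w.\<close>
  obtain w where w: "dot (cross l l') w = 1" using dot_eq_1[OF assms] by blast
  have "dot l (cross l' w) = dot (cross l l') w" "dot l' (cross w l) = dot (cross l l') w"
    by (cases l; cases l'; cases w; simp add: dot_def cross_def algebra_simps)+
  then have "dot l (cross l' w) = 1" "dot l' (cross l' w) = 0" "dot l (cross w l) = 0" "dot l' (cross w l) = 1"
    using w dot_cross by auto
  then show ?thesis by blast
qed

text \<open>If l were a combination of l' and l'', it would vanish at their meeting point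
  \<open>cross l' l''\<close>, a common zero of all three.\<close>

lemma nzd2_LF:
  assumes l: "l \<noteq> (0,0,0)" "l' \<noteq> (0,0,0)" "l'' \<noteq> (0,0,0)" "\<not> prop_eq l' l''"
    and ncz: "\<And>v. v \<noteq> (0,0,0) \<Longrightarrow> dot l v = 0 \<Longrightarrow> dot l' v = 0 \<Longrightarrow> dot l'' v = 0 \<Longrightarrow> False"
  shows "nzd2 (LF l) (LF l') (LF l'')"
proof -
  have p: "cross l' l'' \<noteq> (0,0,0)" using l prop_eq_iff_cross by blast
  obtain w1 w2 where w: "dot l' w1 = 1" "dot l'' w1 = 0" "dot l' w2 = 0" "dot l'' w2 = 1"
    using dual_pair[OF p] by blast
  have "LF l \<noteq> Cst (dot l w1) * LF l' + Cst (dot l w2) * LF l''"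
  proof
    assume "LF l = Cst (dot l w1) * LF l' + Cst (dot l w2) * LF l''"
    then have "LF (vc l 0 - dot l w1 * vc l' 0 - dot l w2 * vc l'' 0,
        vc l 1 - dot l w1 * vc l' 1 - dot l w2 * vc l'' 1,
        vc l 2 - dot l w1 * vc l' 2 - dot l w2 * vc l'' 2) = 0"
      unfolding LF_diff_comb by simp
    then have "vc l i = dot l w1 * vc l' i + dot l w2 * vc l'' i" if "i = 0 \<or> i = 1 \<or> i = 2" for i
      using that by (auto simp: algebra_simps)
    then have e: "vc l 0 = dot l w1 * vc l' 0 + dot l w2 * vc l'' 0"
      "vc l 1 = dot l w1 * vc l' 1 + dot l w2 * vc l'' 1"
      "vc l 2 = dot l w1 * vc l' 2 + dot l w2 * vc l'' 2" by blast+
    have dv: "dot u v = vc u 0 * vc v 0 + vc u 1 * vc v 1 + vc u 2 * vc v 2" for u v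
      by (auto simp: dot_def vc_def split: prod.splits)
    let ?p = "cross l' l''"
    have "dot l ?p = dot l w1 * dot l' ?p + dot l w2 * dot l'' ?p"
      unfolding dv[of _ ?p] e by (simp add: algebra_simps)
    then have "dot l ?p = 0" by (simp add: dot_cross)
    then show False using ncz[OF p] dot_cross by blast
  qed
  then show ?thesis using l w by (intro nzd_via_projection[of _ _ w1 w2]) auto
qed

lemma cf_prod_list_LF: "cf (prod_list (map LF ls)) = arr_poly ls"
  by (induction ls) (auto simp: arr_poly_def cf_1 cf_mult cf_LF)

section \<open>Derivations\<close>

definition der :: "(nat \<Rightarrow> mpoly) \<Rightarrow> mpoly \<Rightarrow> mpoly" where
  "der \<theta> p = (\<Sum>i<3. \<theta> i * pder i p)"

text \<open>The value of the derivation on the linear form l. Divisibility by \<open>LF l\<close> is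
  tangency to the line; vanishing means that the vector lies in the plane l = 0.\<close>

definition pair :: "(nat \<Rightarrow> mpoly) \<Rightarrow> vec3 \<Rightarrow> mpoly" where
  "pair \<theta> l = (\<Sum>i<3. \<theta> i * Cst (vc l i))"

abbreviation cv :: "vec3 \<Rightarrow> nat \<Rightarrow> mpoly" where "cv v \<equiv> \<lambda>i. Cst (vc v i)"

lemma der_mult: "der \<theta> (p * q) = der \<theta> p * q + p * der \<theta> q"
  by (simp add: der_def sum_lessThan_3 pder_mult algebra_simps)

lemma pder_Cst: "pder i (Cst c) = 0"
  by (simp add: Cst_def pder_single exponent_def zero_prod_def)

lemma pder_Var: "i < 3 \<Longrightarrow> j < 3 \<Longrightarrow> pder i (Var j) = (if i = j then 1 else 0)"
  by (auto simp: Var_def pder_single unit_mono_def exponent_def zero_prod_def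
      simp flip: single_one)

lemma pder_LF: "i < 3 \<Longrightarrow> pder i (LF l) = Cst (vc l i)"
proof -
  assume "i < 3"
  then have "i = 0 \<or> i = 1 \<or> i = 2" by auto
  then show ?thesis
    by (auto simp: LF_def sum_lessThan_3 pder_add pder_mult pder_Cst pder_Var)
qed

lemma der_LF: "der \<theta> (LF l) = pair \<theta> l"
  by (simp add: der_def pair_def pder_LF)

lemma der_1: "der \<theta> 1 = 0"
  using pder_Cst[of _ 1] by (simp add: der_def)

lemma pair_Var: "pair Var l = LF l"
  by (simp add: pair_def LF_def mult.commute)

lemma pair_cv: "pair (cv v) l = Cst (dot l v)"
  by (cases v; cases l) (simp add: pair_def sum_lessThan_3 vc_def dot_def Cst_add Cst_mult mult.commute)

lemma pair_add: "pair (\<lambda>j. \<theta> j + \<eta> j) l = pair \<theta> l + pair \<eta> l"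
  and pair_diff: "pair (\<lambda>j. \<theta> j - \<eta> j) l = pair \<theta> l - pair \<eta> l"
  and pair_scale: "pair (\<lambda>j. h * \<theta> j) l = h * pair \<theta> l"
  by (simp_all add: pair_def sum_lessThan_3 algebra_simps)

lemma der_add: "der (\<lambda>j. \<theta> j + \<eta> j) p = der \<theta> p + der \<eta> p"
  and der_diff: "der (\<lambda>j. \<theta> j - \<eta> j) p = der \<theta> p - der \<eta> p"
  and der_scale: "der (\<lambda>j. h * \<theta> j) p = h * der \<theta> p"
  by (simp_all add: der_def sum_lessThan_3 algebra_simps)

lemma der_sum: "der (\<lambda>j. \<Sum>i\<in>I. \<theta> i j) p = (\<Sum>i\<in>I. der (\<theta> i) p)"
  by (simp add: der_def sum_lessThan_3 sum_distrib_right sum.distrib)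

lemma pair_sum: "pair (\<lambda>j. \<Sum>i\<in>I. \<theta> i j) l = (\<Sum>i\<in>I. pair (\<theta> i) l)"
  by (simp add: pair_def sum_lessThan_3 sum_distrib_right sum.distrib)

lemma der_cong: "(\<And>j. j < 3 \<Longrightarrow> \<theta> j = \<eta> j) \<Longrightarrow> der \<theta> p = der \<eta> p"
  and pair_cong: "(\<And>j. j < 3 \<Longrightarrow> \<theta> j = \<eta> j) \<Longrightarrow> pair \<theta> l = pair \<eta> l"
  by (simp_all add: der_def pair_def)

lemma euler_prod_LF:
  "finite S \<Longrightarrow> der Var (\<Prod>l\<in>S. LF l) = of_nat (card S) * (\<Prod>l\<in>S. LF l)"
  by (induction S rule: finite_induct) (auto simp: der_1 der_mult der_LF pair_Var algebra_simps)

text \<open>A constant vector field along v kills each form vanishing at v. It will apply to q i at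
  the point v i.\<close>

lemma der_cv_prod_LF_zero:
  "(\<And>l. l \<in> S \<Longrightarrow> dot l v = 0) \<Longrightarrow> der (cv v) (\<Prod>l\<in>S. LF l) = 0"
  by (induction S rule: infinite_finite_induct) (auto simp: der_1 der_mult der_LF pair_cv)

lemma hom_prod_LF: "finite S \<Longrightarrow> hom (card S) (\<Prod>l\<in>S. LF l)"
  by (induction S rule: finite_induct) (use hom_mult[OF hom_LF] in auto)

text \<open>With G the product of the other forms, the Leibniz rule writes G times the value on l as
  a multiple of \<open>LF l\<close>, and G is a nonzerodivisor modulo \<open>LF l\<close>.\<close>

lemma LF_dvd_pair:
  assumes "finite S" "l \<in> S" "der \<theta> (\<Prod>l\<in>S. LF l) = 0"
    and "\<And>l. l \<in> S \<Longrightarrow> l \<noteq> (0,0,0)" "\<And>l l'. l \<in> S \<Longrightarrow> l' \<in> S \<Longrightarrow> l \<noteq> l' \<Longrightarrow> \<not> prop_eq l l'"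
  shows "LF l dvd pair \<theta> l"
proof -
  define G where "G = (\<Prod>l\<in>S - {l}. LF l)"
  have "(\<Prod>l\<in>S. LF l) = LF l * G" unfolding G_def using assms by (simp add: prod.remove)
  then have "G * pair \<theta> l = LF l * - der \<theta> G"
    using assms(3) by (simp add: der_mult der_LF algebra_simps add_eq_0_iff2)
  then have "LF l dvd G * pair \<theta> l" by simp
  moreover have "nzd1 G (LF l)"
    unfolding G_def using assms by (intro nzd1_prod_left nzd1_LF) auto
  ultimately show ?thesis by (rule nzd1D[rotated])
qed

section \<open>Logarithmic derivations of a nodal arrangement with an added line\<close>

lemma prop_eq_trans:
  assumes "prop_eq u v" "prop_eq v w"
  shows "prop_eq u w"
proof -
  obtain r s where rs: "r \<noteq> 0" "s \<noteq> 0" "u = smul3 r v" "v = smul3 s w"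
    using assms unfolding prop_eq_def by blast
  have "u = smul3 (r * s) w" unfolding rs(3,4) by (cases w) (simp add: smul3_def)
  then show ?thesis unfolding prop_eq_def using rs(1,2) by (intro exI[of _ "r * s"]) simp
qed

text \<open>The identity matrix is resolved along the basis v0, v1, w. The dual basis consists of
  the cross products divided by the determinant; its third member is a multiple of L because v0 and
  v1 lie on L, and w with value 1 on L normalises it to L itself.\<close>

lemma dual_basis:
  assumes L: "L \<noteq> (0,0,0)" and v: "v0 \<noteq> (0,0,0)" "v1 \<noteq> (0,0,0)" "\<not> prop_eq v0 v1"
    and d: "dot L v0 = 0" "dot L v1 = 0"
  shows "\<exists>m0 m1 w. \<forall>i<3. \<forall>j<3.
    vc v0 i * vc m0 j + vc v1 i * vc m1 j + vc w i * vc L j = (if i = j then 1 else 0)"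
proof -
  have c: "cross v0 v1 \<noteq> (0,0,0)" using v prop_eq_iff_cross by blast
  have "prop_eq (cross v0 v1) L"
    using cross_nonzero_prop[OF d L c] prop_eq_sym by blast
  then obtain k where k: "k \<noteq> 0" "cross v0 v1 = smul3 k L" by (auto simp: prop_eq_def)
  obtain w where w: "dot L w = 1" using dot_eq_1[OF L] by blast
  have *: "vc v0 i * vc (cross v1 w) j + vc v1 i * vc (cross w v0) j + vc w i * vc (cross v0 v1) j
    = (if i = j then dot (cross v0 v1) w else 0)" if "i < 3" "j < 3" for i j
  proof -
    have "i = 0 \<or> i = 1 \<or> i = 2" "j = 0 \<or> j = 1 \<or> j = 2" using that by auto
    then show ?thesis
      by (elim disjE; cases v0; cases v1; cases w; simp add: vc_def cross_def dot_def algebra_simps)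
  qed
  have vs: "vc (smul3 r u) i = r * vc u i" for r u i
    by (cases u) (simp add: vc_def smul3_def)
  have "vc v0 i * vc (smul3 (1/k) (cross v1 w)) j + vc v1 i * vc (smul3 (1/k) (cross w v0)) j
      + vc w i * vc L j = (if i = j then 1 else 0)" if "i < 3" "j < 3" for i j
  proof -
    have "k * (vc v0 i * vc (smul3 (1/k) (cross v1 w)) j + vc v1 i * vc (smul3 (1/k) (cross w v0)) j
      + vc w i * vc L j) = k * (if i = j then 1 else 0)"
      using *[OF that] w k by (simp add: vs dot_smul3 field_simps)
    then show ?thesis using k(1) mult_left_cancel by blast
  qed
  then show ?thesis by blast
qed

text \<open>Every line of A passes through some v i, but a v i may lie on no line of A; then q i =
  1. This freedom makes it possible to have two points even when A meets L in a single one.\<close>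

locale pencil_arrangement =
  fixes A :: "vec3 set" and L :: vec3 and v :: "nat \<Rightarrow> vec3" and n :: nat
  assumes fin: "finite A" and n2: "2 \<le> n" and L0: "L \<noteq> (0,0,0)"
    and A0: "l \<in> A \<Longrightarrow> l \<noteq> (0,0,0)"
    and A_prop: "l \<in> A \<Longrightarrow> l' \<in> A \<Longrightarrow> l \<noteq> l' \<Longrightarrow> \<not> prop_eq l l'"
    and L_prop: "l \<in> A \<Longrightarrow> \<not> prop_eq L l"
    and v0: "i < n \<Longrightarrow> v i \<noteq> (0,0,0)"
    and Lv: "i < n \<Longrightarrow> dot L (v i) = 0"
    and v_prop: "i < n \<Longrightarrow> j < n \<Longrightarrow> i \<noteq> j \<Longrightarrow> \<not> prop_eq (v i) (v j)"
    and A_v: "l \<in> A \<Longrightarrow> \<exists>i<n. dot l (v i) = 0"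
    and A_nodal: "l \<in> A \<Longrightarrow> l' \<in> A \<Longrightarrow> l'' \<in> A \<Longrightarrow> l \<noteq> l' \<Longrightarrow> l \<noteq> l'' \<Longrightarrow> l' \<noteq> l'' \<Longrightarrow>
      p \<noteq> (0,0,0) \<Longrightarrow> dot l p = 0 \<Longrightarrow> dot l' p = 0 \<Longrightarrow> dot l'' p = 0 \<Longrightarrow> False"
begin

definition lines :: "nat \<Rightarrow> vec3 set" where "lines i = {l \<in> A. dot l (v i) = 0}"

definition q :: "nat \<Rightarrow> mpoly" where "q i = (\<Prod>l\<in>lines i. LF l)"

definition Q :: "nat \<Rightarrow> mpoly" where "Q i = (\<Prod>l\<in>A - lines i. LF l)"

definition F :: mpoly where "F = (\<Prod>l\<in>insert L A. LF l)"

lemma fin_lines [simp]: "finite (lines i)" using fin by (simp add: lines_def)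

lemma lines_sub: "lines i \<subseteq> A" by (auto simp: lines_def)

text \<open>A line through two distinct points of L is L itself. Hence the sets
  \<open>lines i\<close> partition A.\<close>

lemma not_both:
  assumes "i < n" "j < n" "i \<noteq> j" "l \<in> A" "dot l (v i) = 0" "dot l (v j) = 0"
  shows False
proof -
  have c: "cross (v i) (v j) \<noteq> (0,0,0)" using prop_eq_iff_cross v0 v_prop assms by blast
  have "prop_eq L (cross (v i) (v j))" "prop_eq l (cross (v i) (v j))"
    using cross_nonzero_prop[OF _ _ L0 c] cross_nonzero_prop[OF _ _ A0 c] Lv assms by auto
  then have "prop_eq L l" using prop_eq_sym prop_eq_trans by blast
  then show False using L_prop assms by blast
qed

lemma lines_disjoint: "i < n \<Longrightarrow> j < n \<Longrightarrow> i \<noteq> j \<Longrightarrow> lines i \<inter> lines j = {}"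
  using not_both by (auto simp: lines_def)

lemma lines_cover: "A = (\<Union>i<n. lines i)"
  using A_v unfolding lines_def by fast

lemma lines_cover': "i < n \<Longrightarrow> A - lines i = (\<Union>j\<in>{..<n} - {i}. lines j)"
  using A_v not_both by (fastforce simp: lines_def)

lemma card_A: "card A = (\<Sum>i<n. card (lines i))"
  by (subst lines_cover, rule card_UN_disjoint) (use lines_disjoint in auto)

text \<open>m0 and m1 restrict to the basis dual to v 0, v 1 on the plane L = 0.\<close>
definition m0 where "m0 = fst (SOME m. \<exists>w. \<forall>i<3. \<forall>j<3.
    vc (v 0) i * vc (fst m) j + vc (v 1) i * vc (snd m) j + vc w i * vc L j = (if i = j then 1 else 0))"
definition m1 where "m1 = snd (SOME m. \<exists>w. \<forall>i<3. \<forall>j<3.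
    vc (v 0) i * vc (fst m) j + vc (v 1) i * vc (snd m) j + vc w i * vc L j = (if i = j then 1 else 0))"

lemma m01: "\<exists>w. \<forall>i<3. \<forall>j<3.
    vc (v 0) i * vc m0 j + vc (v 1) i * vc m1 j + vc w i * vc L j = (if i = j then 1 else 0)"
proof -
  have "0 < n" "1 < n" using n2 by auto
  then have "\<exists>m0 m1 w. \<forall>i<3. \<forall>j<3.
    vc (v 0) i * vc m0 j + vc (v 1) i * vc m1 j + vc w i * vc L j = (if i = j then 1 else 0)"
    by (intro dual_basis L0 v0 v_prop Lv) auto
  then have "\<exists>m w. \<forall>i<3. \<forall>j<3. vc (v 0) i * vc (fst m) j + vc (v 1) i * vc (snd m) j
    + vc w i * vc L j = (if i = j then 1 else 0)" by (metis fst_conv snd_conv)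
  from someI_ex[OF this] show ?thesis unfolding m0_def m1_def .
qed

definition xc :: "nat \<Rightarrow> complex" where "xc i = dot m0 (v i)"
definition yc :: "nat \<Rightarrow> complex" where "yc i = dot m1 (v i)"

text \<open>The resolved identity matrix of \<open>m01\<close> is applied to \<theta>; the component
  along w has the factor \<open>pair \<theta> L\<close> and drops out.\<close>

lemma pair_coords:
  assumes "pair \<theta> L = 0" "j < 3"
  shows "\<theta> j = pair \<theta> m0 * Cst (vc (v 0) j) + pair \<theta> m1 * Cst (vc (v 1) j)"
proof -
  obtain w where w: "\<And>i j. i < 3 \<Longrightarrow> j < 3 \<Longrightarrow>
    vc (v 0) i * vc m0 j + vc (v 1) i * vc m1 j + vc w i * vc L j = (if i = j then 1 else 0)"
    using m01 by blast
  have "pair \<theta> m0 * Cst (vc (v 0) j) + pair \<theta> m1 * Cst (vc (v 1) j) =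
    pair \<theta> m0 * Cst (vc (v 0) j) + pair \<theta> m1 * Cst (vc (v 1) j) + pair \<theta> L * Cst (vc w j)"
    using assms by simp
  also have "\<dots> = (\<Sum>i<3. \<theta> i * Cst (vc (v 0) j * vc m0 i + vc (v 1) j * vc m1 i + vc w j * vc L i))"
    by (simp add: pair_def sum_lessThan_3 Cst_add Cst_mult algebra_simps)
  also have "\<dots> = (\<Sum>i<3. \<theta> i * Cst (if j = i then 1 else 0))"
    by (rule sum.cong) (simp_all only: w[OF assms(2)] lessThan_iff)
  also have "\<dots> = (\<Sum>i<3. if j = i then \<theta> i else 0)"
    by (rule sum.cong) auto
  also have "\<dots> = \<theta> j" using assms(2) by (simp add: sum.delta')
  finally show ?thesis by simp
qed

lemma v_coords: "i < n \<Longrightarrow> j < 3 \<Longrightarrow> vc (v i) j = xc i * vc (v 0) j + yc i * vc (v 1) j"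
proof -
  assume "i < n" "j < 3"
  then have "Cst (vc (v i) j) = Cst (xc i * vc (v 0) j + yc i * vc (v 1) j)"
    using pair_coords[of "cv (v i)" j] Lv by (simp add: pair_cv xc_def yc_def Cst_add Cst_mult)
  then show ?thesis by (simp only: Cst_inject)
qed

lemma v_coords_Cst: "i < n \<Longrightarrow> j < 3 \<Longrightarrow>
    Cst (xc i) * Cst (vc (v 0) j) + Cst (yc i) * Cst (vc (v 1) j) = Cst (vc (v i) j)"
  by (subst (3) v_coords) (simp_all only: Cst_add Cst_mult)

lemma xy_det: "i < n \<Longrightarrow> j < n \<Longrightarrow> i \<noteq> j \<Longrightarrow> xc i * yc j - xc j * yc i \<noteq> 0"
proof
  assume ij: "i < n" "j < n" "i \<noteq> j" and z: "xc i * yc j - xc j * yc i = 0"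
  have vv: "u = (vc u 0, vc u 1, vc u 2)" for u by (cases u) (simp add: vc_def)
  have c: "cross (x, y, z) (x', y', z') = (y*z' - z*y', z*x' - x*z', x*y' - y*x')" for x y z x' y' z'
    by (simp add: cross_def)
  define a0 where "a0 = vc (v 0) 0" define a1 where "a1 = vc (v 0) 1" define a2 where "a2 = vc (v 0) 2"
  define b0 where "b0 = vc (v 1) 0" define b1 where "b1 = vc (v 1) 1" define b2 where "b2 = vc (v 1) 2"
  note defs = a0_def a1_def a2_def b0_def b1_def b2_def
  have vi: "v k = (xc k * a0 + yc k * b0, xc k * a1 + yc k * b1, xc k * a2 + yc k * b2)" if "k < n" for k
    using v_coords[OF that, of 0] v_coords[OF that, of 1] v_coords[OF that, of 2] vv[of "v k"]
    unfolding defs[symmetric] by simp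
  have e: "xc i * yc j = xc j * yc i" using z by simp
  have "cross (v i) (v j) = (0,0,0)"
    unfolding vi[OF ij(1)] vi[OF ij(2)] c
    using e by (simp, algebra)
  then show False using prop_eq_iff_cross v0 v_prop ij by blast
qed

text \<open>The conditions are checked on single lines and multiplied out. Lines with different
  indices are distinct, so nodality forbids a common point of three lines taken from three different
  indices.\<close>

sublocale regular_family q "\<lambda>i. Cst (xc i)" "\<lambda>i. Cst (yc i)" n
proof
  fix i assume "i < n"
  show "q i \<noteq> 0" using A0 lines_sub[of i] unfolding q_def by (subst prod_zero_iff) auto
next
  fix i j assume ij: "i < n" "j < n" "i \<noteq> j"
  have n1: "nzd1 (LF s) (LF t)" if "s \<in> lines i" "t \<in> lines j" for s t
    using that lines_disjoint[OF ij] lines_sub A0 A_prop by (intro nzd1_LF) blast+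
  show "nzd1 (q i) (q j)"
    unfolding q_def using n1 A0 lines_sub[of j] by (intro nzd1_prod) (simp_all, blast)
  have "xc i * yc j - xc j * yc i \<noteq> 0" using xy_det[OF ij] .
  then have "(Cst (xc i) * Cst (yc j) - Cst (xc j) * Cst (yc i)) * Cst (1 / (xc i * yc j - xc j * yc i)) = 1"
    by (simp flip: Cst_mult Cst_diff Cst_1)
  then show "Cst (xc i) * Cst (yc j) - Cst (xc j) * Cst (yc i) dvd 1" by (metis dvd_triv_left)
next
  fix i j k assume ij: "i < n" "j < n" "k < n" "i \<noteq> j" "i \<noteq> k" "j \<noteq> k"
  have dis: "lines i \<inter> lines j = {}" "lines i \<inter> lines k = {}" "lines j \<inter> lines k = {}"
    using lines_disjoint ij by auto
  have n1: "nzd1 (LF s) (LF t)" if "s \<in> A" "t \<in> A" "s \<noteq> t" for s t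
    using that A0 A_prop by (intro nzd1_LF) blast+
  have n2: "nzd2 (LF s) (LF t) (LF u)" if "s \<in> A" "t \<in> A" "u \<in> A" "s \<noteq> t" "s \<noteq> u" "t \<noteq> u" for s t u
    using that A0 A_prop A_nodal by (intro nzd2_LF) blast+
  show "nzd2 (q i) (q j) (q k)"
    unfolding q_def
  proof (rule nzd2_prod)
    show "LF t \<noteq> 0" if "t \<in> lines j \<union> lines k" for t using that A0[of t] lines_sub[of j] lines_sub[of k] by auto
    show "nzd1 (LF s) (LF t) \<and> nzd1 (LF t) (LF s)" if "s \<in> lines j" "t \<in> lines k" for s t
    proof -
      have "s \<in> A" "t \<in> A" using that lines_sub by blast+
      moreover have "s \<noteq> t" using that dis(3) by blast
      ultimately show ?thesis using n1 by metis
    qed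
    show "nzd2 (LF s) (LF t) (LF u)" if "s \<in> lines i" "t \<in> lines j" "u \<in> lines k" for s t u
    proof (rule n2)
      show "s \<in> A" "t \<in> A" "u \<in> A" using that lines_sub by blast+
      show "s \<noteq> t" using that dis(1) by blast
      show "s \<noteq> u" using that dis(2) by blast
      show "t \<noteq> u" using that dis(3) by blast
    qed
  qed auto
qed

section \<open>Generators and relations for the derivations killing F\<close>

lemma cof_eq_Q: "i < n \<Longrightarrow> cof n i = Q i"
  unfolding cof_def Q_def q_def lines_cover'
  by (rule prod.UNION_disjoint[symmetric]) (use lines_disjoint in auto)

lemma F_eq: "F = LF L * (q i * Q i)"
proof -
  have "L \<notin> A" using L_prop prop_eq_refl by blast
  then have "F = LF L * (\<Prod>l\<in>A. LF l)" using fin by (simp add: F_def)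
  also have "(\<Prod>l\<in>A. LF l) = Q i * q i"
    unfolding q_def Q_def by (rule prod.subset_diff[OF lines_sub fin])
  finally show ?thesis by (simp add: mult.commute)
qed

lemma F_nz: "F \<noteq> 0"
  unfolding F_def using fin L0 A0 by auto

definition nlines :: complex where "nlines = of_nat (card (insert L A))"

lemma nlines_nz: "nlines \<noteq> 0"
  unfolding nlines_def using fin by simp

lemma euler_F: "der Var F = Cst nlines * F"
  unfolding F_def nlines_def Cst_of_nat using fin by (intro euler_prod_LF) simp

text \<open>The multiple of the Euler derivation is chosen to make the derivation Q i v i kill F.\<close>
definition gen :: "nat \<Rightarrow> nat \<Rightarrow> mpoly" where
  "gen i j = Q i * Cst (vc (v i) j) - Cst (1/nlines) * der (cv (v i)) (Q i) * Var j"

text \<open>The constant field along v i kills \<open>LF L\<close> and q i, so only the derivative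
  of Q i contributes to F: the field Q i v i multiplies F by \<open>der (cv (v i)) (Q i)\<close>.
  The Euler derivation divided by the degree and scaled by this factor does the same.\<close>

lemma der_gen: "i < n \<Longrightarrow> der (gen i) F = 0"
proof -
  assume i: "i < n"
  have q0: "der (cv (v i)) (q i) = 0"
    unfolding q_def by (rule der_cv_prod_LF_zero) (auto simp: lines_def)
  have "der (cv (v i)) F = der (cv (v i)) (Q i) * (LF L * q i)"
    using Lv[OF i] by (simp add: F_eq[of i] der_mult der_LF pair_cv q0 algebra_simps)
  then have "Q i * der (cv (v i)) F = der (cv (v i)) (Q i) * F"
    by (simp add: F_eq[of i] algebra_simps)
  moreover have "Cst (1/nlines) * der (cv (v i)) (Q i) * der Var F = der (cv (v i)) (Q i) * F"
  proof -
    have "Cst (1/nlines) * Cst nlines = 1" using nlines_nz by (simp flip: Cst_mult)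
    then show ?thesis unfolding euler_F by algebra
  qed
  ultimately show ?thesis
    unfolding gen_def by (simp only: der_diff der_scale) simp
qed

lemma hom_gen: "i < n \<Longrightarrow> hom (card A - card (lines i)) (gen i j)"
proof -
  assume i: "i < n"
  have Q: "hom (card A - card (lines i)) (Q i)"
    unfolding Q_def using hom_prod_LF[of "A - lines i"] fin lines_sub by (simp add: card_Diff_subset)
  have "der (cv (v i)) (Q i) * Var j = (\<Sum>k<3. Cst (vc (v i) k) * (Var j * pder k (Q i)))"
    by (simp add: der_def sum_lessThan_3 algebra_simps)
  then have "hom (card A - card (lines i)) (der (cv (v i)) (Q i) * Var j)"
    using Q by (auto intro!: hom_sum hom_Cst_mult hom_Var_pder)
  moreover have "hom (card A - card (lines i)) (Q i * Cst (vc (v i) j))"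
    using hom_Cst_mult[OF Q, of "vc (v i) j"] by (subst mult.commute)
  ultimately show ?thesis
    unfolding gen_def by (auto intro!: hom_diff hom_Cst_mult simp: mult.assoc)
qed

text \<open>On vectors tangent to L, every line of A through v i is a scalar multiple of y i * a - x i * b,
  so being tangent to all of them is a single divisibility by q i.\<close>
lemma tangent_generation:
  assumes "pair \<theta> L = 0" "\<And>l. l \<in> A \<Longrightarrow> LF l dvd pair \<theta> l"
  shows "\<exists>h. \<forall>j<3. \<theta> j = (\<Sum>i<n. h i * Q i * Cst (vc (v i) j))"
proof -
  define a where "a = pair \<theta> m0"
  define b where "b = pair \<theta> m1"
  have \<theta>: "\<theta> j = a * Cst (vc (v 0) j) + b * Cst (vc (v 1) j)" if "j < 3" for j
    unfolding a_def b_def using pair_coords[OF assms(1) that] .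
  have qd: "q i dvd Cst (yc i) * a - Cst (xc i) * b" if i: "i < n" for i
    unfolding q_def
  proof (rule prod_dvd_if_pairwise_nzd1)
    show "nzd1 (LF s) (LF t)" if "s \<in> lines i" "t \<in> lines i" "s \<noteq> t" for s t
      using that A0 A_prop lines_sub by (intro nzd1_LF) blast+
    fix l assume l: "l \<in> lines i"
    then have lA: "l \<in> A" and lv: "dot l (v i) = 0" by (auto simp: lines_def)
    define \<alpha> where "\<alpha> = dot l (v 0)"
    define \<beta> where "\<beta> = dot l (v 1)"
    have "pair \<theta> l = pair (\<lambda>j. a * Cst (vc (v 0) j) + b * Cst (vc (v 1) j)) l"
      by (rule pair_cong) (rule \<theta>)
    also have "\<dots> = a * Cst \<alpha> + b * Cst \<beta>"
      unfolding pair_add pair_scale pair_cv \<alpha>_def \<beta>_def ..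
    finally have p: "pair \<theta> l = a * Cst \<alpha> + b * Cst \<beta>" .
    have "Cst (dot l (v i)) = pair (\<lambda>j. Cst (xc i) * Cst (vc (v 0) j) + Cst (yc i) * Cst (vc (v 1) j)) l"
      unfolding pair_cv[symmetric] by (rule pair_cong) (simp add: v_coords_Cst[OF i] del: One_nat_def)
    also have "\<dots> = Cst (xc i * \<alpha> + yc i * \<beta>)"
      unfolding pair_add pair_scale pair_cv \<alpha>_def \<beta>_def by (simp add: Cst_add Cst_mult)
    finally have rel: "xc i * \<alpha> + yc i * \<beta> = 0" using lv by (simp only: Cst_inject)
    have rel1: "Cst (xc i) * Cst \<alpha> = - (Cst (yc i) * Cst \<beta>)"
      using rel by (simp only: Cst_mult[symmetric] Cst_minus[symmetric] Cst_inject) (simp add: add_eq_0_iff2)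
    have e: "Cst \<alpha> * (Cst (yc i) * a - Cst (xc i) * b) = Cst (yc i) * pair \<theta> l"
      "Cst \<beta> * (Cst (yc i) * a - Cst (xc i) * b) = - Cst (xc i) * pair \<theta> l"
      unfolding p using rel1 by algebra+
    \<comment> \<open>Otherwise l would contain both v 0 and v 1 and coincide with L.\<close>
    have "\<alpha> \<noteq> 0 \<or> \<beta> \<noteq> 0"
      using not_both[of 0 1 l] n2 lA by (auto simp: \<alpha>_def \<beta>_def)
    moreover have inv: "z dvd u" if "z dvd Cst c * u" "c \<noteq> 0" for z u c
    proof -
      have "u = Cst (1/c) * (Cst c * u)" using that(2) by (simp flip: Cst_mult mult.assoc)
      then show ?thesis using that(1) dvd_mult by metis
    qed
    moreover have "LF l dvd Cst \<alpha> * (Cst (yc i) * a - Cst (xc i) * b)"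
      "LF l dvd Cst \<beta> * (Cst (yc i) * a - Cst (xc i) * b)"
      unfolding e using assms(2)[OF lA] by auto
    ultimately show "LF l dvd Cst (yc i) * a - Cst (xc i) * b" by blast
  qed simp
  obtain h where h: "a = (\<Sum>i<n. h i * cof n i * Cst (xc i))" "b = (\<Sum>i<n. h i * cof n i * Cst (yc i))"
    using generation[OF n2 order.refl qd] by blast
  have "\<theta> j = (\<Sum>i<n. h i * Q i * Cst (vc (v i) j))" if j: "j < 3" for j
  proof -
    have "\<theta> j = (\<Sum>i<n. h i * cof n i * (Cst (xc i) * Cst (vc (v 0) j) + Cst (yc i) * Cst (vc (v 1) j)))"
      unfolding \<theta>[OF j] h
      by (simp only: sum_distrib_right sum.distrib distrib_left mult.assoc)
    also have "\<dots> = (\<Sum>i<n. h i * Q i * Cst (vc (v i) j))"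
      by (rule sum.cong) (simp_all add: cof_eq_Q v_coords_Cst[OF _ j] del: One_nat_def)
    finally show ?thesis .
  qed
  then show ?thesis by blast
qed

text \<open>Euler multiplies F by its degree, which is invertible, so no nonzero multiple of it
  kills F. This removes every unwanted Euler term below.\<close>

lemma log_derivation_multiple_of_euler:
  assumes "\<And>j. j < 3 \<Longrightarrow> \<theta> j = k * Var j" "der \<theta> F = 0"
  shows "k = 0"
proof -
  have "der \<theta> F = k * (Cst nlines * F)"
    using der_cong[of \<theta> "\<lambda>j. k * Var j" F] assms(1) by (simp add: der_scale euler_F)
  then show ?thesis using assms(2) nlines_nz F_nz by simp
qed

lemma der_comb_gen: "der (\<lambda>j. \<Sum>i<n. h i * gen i j) F = 0"
  using der_gen by (simp add: der_sum der_scale)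

lemma gen_split:
  "(\<Sum>i<n. h i * gen i j) = (\<Sum>i<n. h i * Q i * Cst (vc (v i) j)) -
    (\<Sum>i<n. h i * (Cst (1/nlines) * der (cv (v i)) (Q i))) * Var j"
  by (simp only: gen_def sum_distrib_right sum_subtractf[symmetric] right_diff_distrib mult.assoc)

text \<open>Subtracting g times Euler makes the value on L zero and permits
  \<open>tangent_generation\<close>. Reinserting the Euler parts of the generators leaves an error k
  times Euler that kills F, so k = 0.\<close>

theorem derivations_generated:
  "der \<theta> F = 0 \<longleftrightarrow> (\<exists>h. \<forall>j<3. \<theta> j = (\<Sum>i<n. h i * gen i j))"
proof
  assume 0: "der \<theta> F = 0"
  have pr: "LF l dvd pair \<theta> l" if "l \<in> insert L A" for l
    using that 0 fin L0 A0 A_prop L_prop prop_eq_sym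
    unfolding F_def by (intro LF_dvd_pair[of "insert L A"]) (simp, blast+)
  then obtain g where g: "pair \<theta> L = LF L * g" by (meson dvdE insertI1)
  define \<eta> where "\<eta> j = \<theta> j - g * Var j" for j
  have pe: "pair \<eta> l = pair \<theta> l - g * LF l" for l
    unfolding \<eta>_def by (simp add: pair_diff pair_scale pair_Var)
  have "pair \<eta> L = 0" by (simp add: pe g)
  moreover have "LF l dvd pair \<eta> l" if "l \<in> A" for l
    using pr that by (simp add: pe)
  ultimately obtain h where h: "\<And>j. j < 3 \<Longrightarrow> \<eta> j = (\<Sum>i<n. h i * Q i * Cst (vc (v i) j))"
    using tangent_generation by blast
  define k where "k = g + (\<Sum>i<n. h i * (Cst (1/nlines) * der (cv (v i)) (Q i)))"
  have e: "\<theta> j - (\<Sum>i<n. h i * gen i j) = k * Var j" if "j < 3" for j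
    using h[OF that] unfolding gen_split \<eta>_def k_def by (simp add: algebra_simps)
  have "der (\<lambda>j. \<theta> j - (\<Sum>i<n. h i * gen i j)) F = 0"
    unfolding der_diff der_comb_gen using 0 by simp
  then have "k = 0" using log_derivation_multiple_of_euler[OF e] by blast
  then show "\<exists>h. \<forall>j<3. \<theta> j = (\<Sum>i<n. h i * gen i j)" using e by (intro exI[of _ h]) simp
next
  assume "\<exists>h. \<forall>j<3. \<theta> j = (\<Sum>i<n. h i * gen i j)"
  then obtain h where "\<And>j. j < 3 \<Longrightarrow> \<theta> j = (\<Sum>i<n. h i * gen i j)" by blast
  then show "der \<theta> F = 0"
    using der_cong[of \<theta> "\<lambda>j. \<Sum>i<n. h i * gen i j" F] der_comb_gen[of h] by simp
qed

text \<open>In a relation the vectors Q i v i combine to some multiple k of Euler; pairing with L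
  gives k * LF L = 0, so the relation is one of the Q i v i alone. Conversely such a relation leaves
  only an Euler multiple, which kills F and hence vanishes.\<close>

theorem gen_syzygies:
  "(\<forall>j<3. (\<Sum>i<n. h i * gen i j) = 0) \<longleftrightarrow>
    (\<exists>c. (\<forall>i<n. h i = q i * c i) \<and> (\<Sum>i<n. c i * Cst (xc i)) = 0 \<and> (\<Sum>i<n. c i * Cst (yc i)) = 0)"
proof
  assume z: "\<forall>j<3. (\<Sum>i<n. h i * gen i j) = 0"
  define k where "k = (\<Sum>i<n. h i * (Cst (1/nlines) * der (cv (v i)) (Q i)))"
  define \<eta> where "\<eta> j = (\<Sum>i<n. h i * Q i * Cst (vc (v i) j))" for j
  have e: "\<eta> j = k * Var j" if "j < 3" for j
    using z that unfolding gen_split k_def \<eta>_def by simp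
  have pv: "pair \<eta> l = (\<Sum>i<n. h i * Q i * Cst (dot l (v i)))" for l
    unfolding \<eta>_def by (simp add: pair_sum pair_scale pair_cv)
  have "k * LF L = pair \<eta> L"
    using pair_cong[of \<eta> "\<lambda>j. k * Var j" L] e by (simp add: pair_scale pair_Var)
  also have "\<dots> = 0" unfolding pv using Lv by simp
  finally have "k = 0" using L0 by simp
  then have "pair \<eta> l = 0" for l using pair_cong[of \<eta> "\<lambda>j. 0" l] e by (simp add: pair_def)
  then have "(\<Sum>i<n. h i * cof n i * Cst (xc i)) = 0" "(\<Sum>i<n. h i * cof n i * Cst (yc i)) = 0"
    using pv[of m0] pv[of m1] by (simp_all add: cof_eq_Q xc_def yc_def)
  then show "\<exists>c. (\<forall>i<n. h i = q i * c i) \<and> (\<Sum>i<n. c i * Cst (xc i)) = 0 \<and> (\<Sum>i<n. c i * Cst (yc i)) = 0"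
    using syzygy[OF n2] by blast
next
  assume "\<exists>c. (\<forall>i<n. h i = q i * c i) \<and> (\<Sum>i<n. c i * Cst (xc i)) = 0 \<and> (\<Sum>i<n. c i * Cst (yc i)) = 0"
  then obtain c where c: "\<And>i. i < n \<Longrightarrow> h i = q i * c i"
    "(\<Sum>i<n. c i * Cst (xc i)) = 0" "(\<Sum>i<n. c i * Cst (yc i)) = 0" by blast
  have "(\<Sum>i<n. h i * Q i * Cst (vc (v i) j)) = 0" if j: "j < 3" for j
  proof -
    have "(\<Sum>i<n. h i * Q i * Cst (vc (v i) j)) =
      (\<Sum>i<n. h i * cof n i * Cst (xc i)) * Cst (vc (v 0) j) + (\<Sum>i<n. h i * cof n i * Cst (yc i)) * Cst (vc (v 1) j)"
      unfolding sum_distrib_right sum.distrib[symmetric]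
    proof (rule sum.cong[OF refl])
      fix i assume "i \<in> {..<n}"
      then have i: "i < n" by simp
      show "h i * Q i * Cst (vc (v i) j) = h i * cof n i * Cst (xc i) * Cst (vc (v 0) j) +
          h i * cof n i * Cst (yc i) * Cst (vc (v 1) j)"
        unfolding v_coords_Cst[OF i j, symmetric] cof_eq_Q[OF i] by (simp only: distrib_left mult.assoc)
    qed
    then show ?thesis using syzygy_conv[OF c(1)] c(2,3) by simp
  qed
  then have e: "(\<Sum>i<n. h i * gen i j) = - (\<Sum>i<n. h i * (Cst (1/nlines) * der (cv (v i)) (Q i))) * Var j"
    if "j < 3" for j using that unfolding gen_split by simp
  from log_derivation_multiple_of_euler[OF e der_comb_gen]
  show "\<forall>j<3. (\<Sum>i<n. h i * gen i j) = 0" using e by simp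
qed

end

section \<open>Dimensions of graded pieces\<close>

lemma (in vector_space) span_Int_independent:
  assumes "independent B" "finite B" "K \<subseteq> B" "x \<in> span K" "x \<in> span (B - K)"
  shows "x = 0"
proof -
  have fin: "finite K" "finite (B - K)" using assms finite_subset by auto
  obtain a where a: "x = (\<Sum>b\<in>K. a b *s b)"
    using assms(4) span_finite[OF fin(1)] by auto
  obtain c where c: "x = (\<Sum>b\<in>B - K. c b *s b)"
    using assms(5) span_finite[OF fin(2)] by auto
  define u where "u b = (if b \<in> K then a b else - c b)" for b
  have "(\<Sum>b\<in>B. u b *s b) = (\<Sum>b\<in>B - K. u b *s b) + (\<Sum>b\<in>K. u b *s b)"
    using assms(2,3) by (rule sum.subset_diff[rotated])
  also have "(\<Sum>b\<in>K. u b *s b) = x" unfolding a by (rule sum.cong) (auto simp: u_def)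
  also have "(\<Sum>b\<in>B - K. u b *s b) = - x"
    unfolding c sum_negf[symmetric] by (rule sum.cong) (auto simp: u_def)
  finally have "(\<Sum>b\<in>B. u b *s b) = 0" by simp
  then have u0: "u b = 0" if "b \<in> B" for b
    using independentD[OF assms(1,2) order.refl] that by blast
  have "x = (\<Sum>b\<in>K. 0)" unfolding a
  proof (rule sum.cong[OF refl])
    fix b assume "b \<in> K"
    then have "a b = 0" using u0[of b] assms(3) by (auto simp: u_def)
    then show "a b *s b = 0" by simp
  qed
  then show ?thesis by simp
qed

text \<open>The ambient polynomial spaces are infinite-dimensional, so finiteness is imposed only on
  V, through a finite spanning set.\<close>

lemma (in vector_space_pair) rank_nullity:
  assumes f: "Vector_Spaces.linear s1 s2 f" and V: "vs1.subspace V" and sp: "V \<subseteq> vs1.span S" "finite S"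
  shows "vs1.dim V = vs1.dim {x \<in> V. f x = 0} + vs2.dim (f ` V)"
proof -
  interpret f: Vector_Spaces.linear s1 s2 f by fact
  let ?K = "{x \<in> V. f x = 0}"
  obtain K where K: "K \<subseteq> ?K" "vs1.independent K" "?K \<subseteq> vs1.span K" "card K = vs1.dim ?K"
    using vs1.basis_exists by blast
  obtain B where B: "K \<subseteq> B" "B \<subseteq> V" "vs1.independent B" "V \<subseteq> vs1.span B"
    using vs1.maximal_independent_subset_extend[of K V] K by auto
  have finB: "finite B"
    using vs1.independent_span_bound[OF sp(2) B(3)] B(2) sp(1) by blast
  define C where "C = B - K"
  have indC: "vs1.independent C"
    using B(3) vs1.independent_mono unfolding C_def by blast
  have spC: "vs1.span C \<subseteq> V" unfolding C_def using B V by (intro vs1.span_minimal) auto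
  have inj: "inj_on f (vs1.span C)"
  proof (subst f.inj_on_iff_eq_0[OF vs1.subspace_span], intro ballI impI)
    fix x assume x: "x \<in> vs1.span C" "f x = 0"
    then have "x \<in> vs1.span K" using K(3) spC by blast
    then show "x = 0" using vs1.span_Int_independent[OF B(3) finB B(1)] x unfolding C_def by blast
  qed
  have ind: "vs2.independent (f ` C)" using f.independent_injective_image[OF indC inj] .
  have "f ` V \<subseteq> vs2.span (f ` B)" using f.spans_image[OF B(4)] .
  also have "\<dots> \<subseteq> vs2.span (f ` C)"
  proof (rule vs2.span_minimal)
    show "f ` B \<subseteq> vs2.span (f ` C)"
    proof
      fix y assume "y \<in> f ` B"
      then obtain x where x: "x \<in> B" "y = f x" by blast
      show "y \<in> vs2.span (f ` C)"
      proof (cases "x \<in> K")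
        case True
        then show ?thesis using K(1) x vs2.span_zero by auto
      next
        case False
        then show ?thesis using x by (auto simp: C_def intro: vs2.span_base)
      qed
    qed
  qed simp
  finally have sp2: "f ` V \<subseteq> vs2.span (f ` C)" .
  have "f ` C \<subseteq> f ` V" using B(2) by (auto simp: C_def)
  then have "card (f ` C) = vs2.dim (f ` V)" using vs2.basis_card_eq_dim[OF _ sp2 ind] by blast
  moreover have "card (f ` C) = card C"
    using inj by (intro card_image inj_on_subset[OF inj vs1.span_superset])
  moreover have "card B = vs1.dim V" using vs1.basis_card_eq_dim[OF B(2,4,3)] .
  moreover have "card B = card K + card C"
    using B(1) finB unfolding C_def by (metis card_Diff_subset card_mono finite_subset le_add_diff_inverse)
  ultimately show ?thesis using K(4) by simp
qed

section \<open>Graded pieces and their direct sums as vector spaces\<close>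

interpretation vsP: vector_space "\<lambda>c p. Cst c * p"
  by standard (simp_all add: algebra_simps Cst_add Cst_mult)

interpretation vsT: vector_space "\<lambda>c (h :: nat \<Rightarrow> mpoly) i. Cst c * h i"
  by standard (simp_all add: fun_eq_iff plus_fun_def algebra_simps Cst_add Cst_mult)

interpretation vsTP: vector_space_pair "\<lambda>c (h :: nat \<Rightarrow> mpoly) i. Cst c * h i" "\<lambda>c p. Cst c * p"
  by standard

interpretation vsTT: vector_space_pair "\<lambda>c (h :: nat \<Rightarrow> mpoly) i. Cst c * h i"
    "\<lambda>c (h :: nat \<Rightarrow> mpoly) i. Cst c * h i"
  by standard

interpretation vsPT: vector_space_pair "\<lambda>c p. Cst c * p" "\<lambda>c (h :: nat \<Rightarrow> mpoly) i. Cst c * h i"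
  by standard

definition Sp :: "nat \<Rightarrow> mpoly set" where "Sp k = {p. hom k p}"

lemma subspace_Sp: "vsP.subspace (Sp k)"
  by (rule vsP.subspaceI) (auto simp: Sp_def hom_add hom_Cst_mult)

lemma card_mdeg: "card {m. mdeg m = k} = (k + 2) choose 2"
proof -
  have "bij_betw (\<lambda>(i,j). (i, j, k - i - j)) (SIGMA i:{..k}. {..k - i}) {m. mdeg m = k}"
    by (rule bij_betw_byWitness[where f' = "\<lambda>(i,j,l). (i,j)"]) (auto simp: mdeg_def)
  then have "card {m. mdeg m = k} = card (SIGMA i:{..k}. {..k - i})"
    by (rule bij_betw_same_card[symmetric])
  also have "\<dots> = (\<Sum>i\<le>k. Suc (k - i))" by simp
  also have "\<dots> = (\<Sum>i\<le>k. Suc i)" by (rule sum.nat_diff_reindex[of "\<lambda>i. Suc i" "Suc k", unfolded lessThan_Suc_atMost, simplified])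
  also have "\<dots> = (k + 2) choose 2"
    by (induction k) (auto simp: numeral_2_eq_2)
  finally show ?thesis .
qed

lemma Sp_spanned: "Sp k \<subseteq> vsP.span ((\<lambda>m. Poly_Mapping.single m 1) ` {m. mdeg m = k})"
proof
  fix p assume "p \<in> Sp k"
  then have "p = (\<Sum>m\<in>{m. mdeg m = k}. Cst (cf p m) * Poly_Mapping.single m 1)"
    by (intro poly_mapping_eqI)
      (auto simp: Sp_def homog_iff lookup_sum cf_Cst_mult lookup_single when_def finite_mdeg
        if_distrib[of "\<lambda>x. _ * x"] cong: if_cong)
  then show "p \<in> vsP.span ((\<lambda>m. Poly_Mapping.single m 1) ` {m. mdeg m = k})"
    by (metis (no_types, lifting) imageI vsP.span_base vsP.span_scale vsP.span_sum)
qed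

lemma dim_Sp: "vsP.dim (Sp k) = (k + 2) choose 2"
proof -
  let ?M = "{m. mdeg m = k}"
  let ?s = "\<lambda>m :: mono. Poly_Mapping.single m (1 :: complex)"
  have inj: "inj_on ?s ?M" by (rule inj_onI) (metis lookup_single_eq lookup_single_not_eq zero_neq_one)
  have "vsP.independent (?s ` ?M)"
  proof (rule vsP.independent_if_scalars_zero)
    show "finite (?s ` ?M)" using finite_mdeg by blast
    fix f and x :: mpoly assume z: "(\<Sum>x\<in>?s ` ?M. Cst (f x) * x) = 0" and "x \<in> ?s ` ?M"
    then obtain m where m: "m \<in> ?M" "x = ?s m" by blast
    have "0 = cf (\<Sum>m\<in>?M. Cst (f (?s m)) * ?s m) m"
      using z by (simp add: sum.reindex[OF inj])
    also have "\<dots> = f x"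
      using m finite_mdeg by (simp add: lookup_sum cf_Cst_mult lookup_single when_def
        if_distrib[of "\<lambda>x. _ * x"] cong: if_cong)
    finally show "f x = 0" by simp
  qed
  moreover have "?s ` ?M \<subseteq> Sp k" by (auto simp: Sp_def homog_iff lookup_single when_def split: if_splits)
  ultimately show ?thesis
    using vsP.basis_card_eq_dim[OF _ Sp_spanned] card_image[OF inj] card_mdeg by metis
qed

text \<open>The direct sum of the W i. Padding with zeros from index n on places tuples of all
  lengths in one vector space.\<close>

definition tuples :: "nat \<Rightarrow> (nat \<Rightarrow> mpoly set) \<Rightarrow> (nat \<Rightarrow> mpoly) set" where
  "tuples n W = {h. (\<forall>i<n. h i \<in> W i) \<and> (\<forall>i\<ge>n. h i = 0)}"

lemma subspace_tuples: "(\<And>i. i < n \<Longrightarrow> vsP.subspace (W i)) \<Longrightarrow> vsT.subspace (tuples n W)"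
  by (rule vsT.subspaceI)
    (auto simp: tuples_def zero_fun_def plus_fun_def vsP.subspace_0 vsP.subspace_add vsP.subspace_scale)

lemma linear_eval: "Vector_Spaces.linear (\<lambda>c (h :: nat \<Rightarrow> mpoly) i. Cst c * h i) (\<lambda>c p. Cst c * p) (\<lambda>h. h n)"
  unfolding Vector_Spaces.linear_iff using vsT.vector_space_axioms vsP.vector_space_axioms
  by (auto simp: plus_fun_def)

text \<open>Rank-nullity for evaluation at the last index: the kernel is the space of shorter
  tuples, the image is the last summand.\<close>

lemma tuples_dim:
  assumes "\<And>i. i < n \<Longrightarrow> vsP.subspace (W i)" "\<And>i. i < n \<Longrightarrow> \<exists>S. finite S \<and> W i \<subseteq> vsP.span S"
  shows "(\<exists>S. finite S \<and> tuples n W \<subseteq> vsT.span S) \<and> vsT.dim (tuples n W) = (\<Sum>i<n. vsP.dim (W i))"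
  using assms
proof (induction n)
  case 0
  have "tuples 0 W = {0}" by (auto simp: tuples_def fun_eq_iff)
  moreover have "vsT.dim {0} = 0"
    using vsT.dim_le_card[of "{0}" "{}"] by simp
  moreover have "\<exists>S. finite S \<and> {0} \<subseteq> vsT.span S" by (rule exI[of _ "{}"]) simp
  ultimately show ?case by simp
next
  case (Suc n)
  obtain S where S: "finite S" "tuples n W \<subseteq> vsT.span S" and
    dm: "vsT.dim (tuples n W) = (\<Sum>i<n. vsP.dim (W i))"
    using Suc by (metis less_Suc_eq)
  obtain T where T: "finite T" "W n \<subseteq> vsP.span T" using Suc.prems(2)[of n] by auto
  define emb :: "mpoly \<Rightarrow> nat \<Rightarrow> mpoly" where "emb p = (\<lambda>i. if i = n then p else 0)" for p
  have lin: "Vector_Spaces.linear (\<lambda>c p. Cst c * p) (\<lambda>c (h :: nat \<Rightarrow> mpoly) i. Cst c * h i) emb"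
    unfolding Vector_Spaces.linear_iff using vsT.vector_space_axioms vsP.vector_space_axioms
    by (auto simp: emb_def fun_eq_iff plus_fun_def)
  have sp: "tuples (Suc n) W \<subseteq> vsT.span (S \<union> emb ` T)"
  proof
    fix h assume h: "h \<in> tuples (Suc n) W"
    have "h(n := 0) \<in> tuples n W" using h by (auto simp: tuples_def)
    then have "h(n := 0) \<in> vsT.span (S \<union> emb ` T)"
      using S(2) vsT.span_mono[of S "S \<union> emb ` T"] by blast
    moreover have "emb (h n) \<in> vsT.span (emb ` T)"
      using vsPT.linear_spans_image[OF lin T(2)] h by (auto simp: tuples_def)
    then have "emb (h n) \<in> vsT.span (S \<union> emb ` T)"
      using vsT.span_mono[of "emb ` T" "S \<union> emb ` T"] by blast
    ultimately have "h(n := 0) + emb (h n) \<in> vsT.span (S \<union> emb ` T)" by (rule vsT.span_add)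
    moreover have "h(n := 0) + emb (h n) = h" by (auto simp: fun_eq_iff plus_fun_def emb_def)
    ultimately show "h \<in> vsT.span (S \<union> emb ` T)" by simp
  qed
  have fin: "finite (S \<union> emb ` T)" using S T by simp
  have ker: "{h \<in> tuples (Suc n) W. h n = 0} = tuples n W"
  proof (rule set_eqI)
    fix h
    have "h \<in> tuples n W" if "h \<in> tuples (Suc n) W" "h n = 0"
      unfolding tuples_def
    proof safe
      fix i
      show "i < n \<Longrightarrow> h i \<in> W i" using that(1) by (simp add: tuples_def)
      show "n \<le> i \<Longrightarrow> h i = 0" using that by (cases "i = n") (simp_all add: tuples_def)
    qed
    moreover have "h \<in> tuples (Suc n) W \<and> h n = 0" if "h \<in> tuples n W"
      using that vsP.subspace_0[OF Suc.prems(1)[of n]] by (auto simp: tuples_def less_Suc_eq)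
    ultimately show "h \<in> {h \<in> tuples (Suc n) W. h n = 0} \<longleftrightarrow> h \<in> tuples n W" by blast
  qed
  have im: "(\<lambda>h. h n) ` tuples (Suc n) W = W n"
  proof
    show "(\<lambda>h. h n) ` tuples (Suc n) W \<subseteq> W n" by (auto simp: tuples_def)
    show "W n \<subseteq> (\<lambda>h. h n) ` tuples (Suc n) W"
    proof
      fix p assume "p \<in> W n"
      then have "emb p \<in> tuples (Suc n) W"
        using vsP.subspace_0[OF Suc.prems(1)] by (auto simp: tuples_def emb_def)
      then show "p \<in> (\<lambda>h. h n) ` tuples (Suc n) W"
        by (rule rev_image_eqI) (simp add: emb_def)
    qed
  qed
  have "vsT.dim (tuples (Suc n) W) = vsT.dim (tuples n W) + vsP.dim (W n)"
    using vsTP.rank_nullity[OF linear_eval subspace_tuples sp fin, of n] Suc.prems(1)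
    unfolding ker im by blast
  then show ?case using sp fin dm by auto
qed

lemma tuples_Sp:
  "(\<exists>S. finite S \<and> tuples n (\<lambda>i. Sp (k i)) \<subseteq> vsT.span S) \<and>
    vsT.dim (tuples n (\<lambda>i. Sp (k i))) = (\<Sum>i<n. (k i + 2) choose 2)"
  using tuples_dim[of n "\<lambda>i. Sp (k i)"] subspace_Sp dim_Sp finite_imageI[OF finite_mdeg] Sp_spanned
  by (metis (no_types, lifting) sum.cong)

lemma cspan_cf: "cspan (map cf bs) = cf ` vsP.span (set bs)"
proof -
  have *: "(\<lambda>m. \<Sum>i<length (map cf bs). c i * (map cf bs ! i) m) = cf (\<Sum>i<length bs. Cst (c i) * bs ! i)" for c
    by (auto simp: fun_eq_iff lookup_sum cf_Cst_mult intro!: sum.cong)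
  have "{\<Sum>i<length bs. Cst (c i) * bs ! i | c. True} = vsP.span (set bs)" (is "?A = _")
  proof
    show "?A \<subseteq> vsP.span (set bs)"
    proof safe
      fix c
      show "(\<Sum>i<length bs. Cst (c i) * bs ! i) \<in> vsP.span (set bs)"
        by (rule vsP.span_sum) (use vsP.span_scale vsP.span_base nth_mem in blast)
    qed
    show "vsP.span (set bs) \<subseteq> ?A"
    proof (rule vsP.span_minimal)
      show "set bs \<subseteq> ?A"
      proof
        fix x assume "x \<in> set bs"
        then obtain i where i: "i < length bs" "x = bs ! i" by (metis in_set_conv_nth)
        have "(\<Sum>j<length bs. Cst (if j = i then 1 else 0) * bs ! j) = (\<Sum>j<length bs. if j = i then bs ! j else 0)"
          by (rule sum.cong) auto
        then have "x = (\<Sum>j<length bs. Cst (if j = i then 1 else 0) * bs ! j)"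
          using i by (simp add: sum.delta)
        then show "x \<in> ?A" by (intro CollectI exI[of _ "\<lambda>j. if j = i then 1 else 0"]) simp
      qed
      show "vsP.subspace ?A"
      proof (rule vsP.subspaceI)
        show "0 \<in> ?A" by (intro CollectI exI[of _ "\<lambda>_. 0"]) simp
      next
        fix x y assume "x \<in> ?A" "y \<in> ?A"
        then obtain a b where "x = (\<Sum>i<length bs. Cst (a i) * bs ! i)" "y = (\<Sum>i<length bs. Cst (b i) * bs ! i)"
          by (elim CollectE exE conjE) (rule that)
        then have "x + y = (\<Sum>i<length bs. Cst (a i + b i) * bs ! i)"
          by (simp add: Cst_add distrib_right sum.distrib)
        then show "x + y \<in> ?A" by (intro CollectI exI[of _ "\<lambda>i. a i + b i"]) simp
      next
        fix c :: complex and x :: mpoly assume "x \<in> ?A"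
        then obtain a where "x = (\<Sum>i<length bs. Cst (a i) * bs ! i)" by blast
        then have "Cst c * x = (\<Sum>i<length bs. Cst (c * a i) * bs ! i)"
          by (simp only: Cst_mult sum_distrib_left mult.assoc)
        then show "Cst c * x \<in> ?A" by (intro CollectI exI[of _ "\<lambda>i. c * a i"]) simp
      qed
    qed
  qed
  from this[symmetric] show ?thesis unfolding cspan_def *
    by (simp add: full_SetCompr_eq image_image)
qed

text \<open>A finite basis, listed without repetition, attains the minimum; conversely a spanning
  list has at least as many entries as the dimension.\<close>

lemma cdim_cf:
  assumes V: "vsP.subspace V" and sp: "V \<subseteq> vsP.span S" "finite S"
  shows "cdim (cf ` V) = vsP.dim V"
  unfolding cdim_def
proof (rule Least_equality)
  obtain B where B: "B \<subseteq> V" "vsP.independent B" "V \<subseteq> vsP.span B" "card B = vsP.dim V"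
    using vsP.basis_exists by blast
  have "finite B" using vsP.independent_span_bound[OF sp(2) B(2)] B(1) sp(1) by blast
  then obtain bs where bs: "set bs = B" "distinct bs" using finite_distinct_list by blast
  have "vsP.span B = V" using B vsP.span_minimal[OF B(1) V] by blast
  then have "cf ` V = cspan (map cf bs)" using cspan_cf[of bs] bs by simp
  moreover have "length (map cf bs) = vsP.dim V" using bs B(4) distinct_card by fastforce
  moreover have "set (map cf bs) \<subseteq> cf ` V" using bs B(1) by auto
  ultimately show "\<exists>B. length B = vsP.dim V \<and> set B \<subseteq> cf ` V \<and> cf ` V = cspan B" by blast
next
  fix k assume "\<exists>B. length B = k \<and> set B \<subseteq> cf ` V \<and> cf ` V = cspan B"
  then obtain B where B: "length B = k" "set B \<subseteq> cf ` V" "cf ` V = cspan B" by blast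
  obtain bs where bs: "B = map cf bs"
    using B(2) by (metis (no_types, lifting) ex_map_conv imageE subset_iff)
  have "cf ` V = cf ` vsP.span (set bs)" using B(3) unfolding bs cspan_cf .
  then have "V = vsP.span (set bs)"
    by (metis (no_types, lifting) inj_image_eq_iff injI lookup_inject)
  then have "vsP.dim V \<le> card (set bs)" using vsP.dim_le_card by blast
  also have "\<dots> \<le> k" using B(1) bs card_length by fastforce
  finally show "vsP.dim V \<le> k" .
qed

lemma Sk_eq: "Sk k = cf ` Sp k"
  unfolding Sk_def Sp_def using homog_is_poly is_poly_obtain by (auto simp: image_iff) metis

lemma cdim_Sk: "cdim (Sk k) = (k + 2) choose 2"
  unfolding Sk_eq using cdim_cf[OF subspace_Sp Sp_spanned finite_imageI[OF finite_mdeg]] dim_Sp by simp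

lemma real_choose_2: "real ((m + 2) choose 2) = (real m + 2) * (real m + 1) / 2"
  by (induction m) (auto simp: numeral_2_eq_2 field_simps)

section \<open>The Hilbert function of the Milnor algebra\<close>

lemma cf_grad: "dx (cf p) = cf (pder 0 p)" "dy (cf p) = cf (pder 1 p)" "dz (cf p) = cf (pder 2 p)"
  by (simp_all add: cf_pder pd_raw_def)

lemma hpart_mult_add: "hom r g \<Longrightarrow> hpart (k + r) (h * g) = hpart k h * g"
  by (simp add: hpart_mult)

lemma hom_eq_hpart: "hom k p \<Longrightarrow> hpart k p = p"
  by (simp add: hpart_hom)

lemma linear_der: "Vector_Spaces.linear (\<lambda>c (h :: nat \<Rightarrow> mpoly) i. Cst c * h i) (\<lambda>c p. Cst c * p) (\<lambda>\<theta>. der \<theta> p)"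
  unfolding Vector_Spaces.linear_iff using vsT.vector_space_axioms vsP.vector_space_axioms
  by (auto simp: plus_fun_def der_add der_scale)

context pencil_arrangement
begin

lemma L_notin: "L \<notin> A"
  using L_prop prop_eq_refl by blast

lemma hom_F: "hom (Suc (card A)) F"
  unfolding F_def using hom_prod_LF[of "insert L A"] fin L_notin by simp

lemma hom_pder_F: "hom (card A) (pder i F)"
  using hom_pder[OF hom_F] .

text \<open>The partial derivatives of F have degree \<open>card A\<close>, so only the degree-e
  parts of the coefficients contribute in degree e + card A.\<close>

lemma Jk_F: "Jk (cf F) (e + card A) = cf ` (\<lambda>\<theta>. der \<theta> F) ` tuples 3 (\<lambda>_. Sp e)"
proof
  show "Jk (cf F) (e + card A) \<subseteq> cf ` (\<lambda>\<theta>. der \<theta> F) ` tuples 3 (\<lambda>_. Sp e)"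
  proof
    fix g assume "g \<in> Jk (cf F) (e + card A)"
    then obtain a b c where g: "g = padd (padd (pmul a (dx (cf F))) (pmul b (dy (cf F)))) (pmul c (dz (cf F)))"
      and p: "is_poly a" "is_poly b" "is_poly c" and h: "homog (e + card A) g"
      unfolding Jk_def Jideal_def by blast
    obtain a' b' c' where abc: "a = cf a'" "b = cf b'" "c = cf c'"
      using p is_poly_obtain by metis
    define \<theta> where "\<theta> i = (if i = 0 then hpart e a' else if i = 1 then hpart e b' else if i = 2 then hpart e c' else 0)" for i :: nat
    define G where "G = a' * pder 0 F + b' * pder 1 F + c' * pder 2 F"
    have gG: "g = cf G" unfolding g abc cf_grad G_def by (simp only: cf_mult cf_add)
    have "der \<theta> F = hpart (e + card A) G"
      unfolding G_def by (simp add: der_def sum_lessThan_3 \<theta>_def hpart_add hpart_mult_add hom_pder_F)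
    also have "\<dots> = G" using h unfolding gG by (rule hom_eq_hpart)
    finally have "g = cf (der \<theta> F)" using gG by simp
    moreover have "\<theta> \<in> tuples 3 (\<lambda>_. Sp e)" by (auto simp: tuples_def \<theta>_def Sp_def)
    ultimately show "g \<in> cf ` (\<lambda>\<theta>. der \<theta> F) ` tuples 3 (\<lambda>_. Sp e)" by blast
  qed
  show "cf ` (\<lambda>\<theta>. der \<theta> F) ` tuples 3 (\<lambda>_. Sp e) \<subseteq> Jk (cf F) (e + card A)"
  proof safe
    fix \<theta> assume t: "\<theta> \<in> tuples 3 (\<lambda>_. Sp e)"
    have "cf (der \<theta> F) = padd (padd (pmul (cf (\<theta> 0)) (dx (cf F))) (pmul (cf (\<theta> 1)) (dy (cf F)))) (pmul (cf (\<theta> 2)) (dz (cf F)))"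
      unfolding cf_grad by (simp add: der_def sum_lessThan_3 cf_mult cf_add)
    then have "cf (der \<theta> F) \<in> Jideal (cf F)"
      unfolding Jideal_def using is_poly_cf by blast
    moreover have "hom (e + card A) (der \<theta> F)"
      unfolding der_def using t hom_pder_F by (auto simp: tuples_def Sp_def intro!: hom_sum hom_mult)
    ultimately show "cf (der \<theta> F) \<in> Jk (cf F) (e + card A)" by (simp add: Jk_def)
  qed
qed

definition Dk :: "nat \<Rightarrow> (nat \<Rightarrow> mpoly) set" where
  "Dk e = {\<theta> \<in> tuples 3 (\<lambda>_. Sp e). der \<theta> F = 0}"

text \<open>Rank-nullity for the map from triples of forms of degree e to their values on F, whose
  kernel \<open>Dk e\<close> is the degree-e piece of D_0.\<close>

lemma cdim_Jk: "cdim (Jk (cf F) (e + card A)) + vsT.dim (Dk e) = 3 * ((e + 2) choose 2)"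
proof -
  let ?T = "tuples 3 (\<lambda>_. Sp e)"
  let ?f = "\<lambda>\<theta>. der \<theta> F"
  have sub: "vsT.subspace ?T" by (rule subspace_tuples) (rule subspace_Sp)
  obtain S where S: "finite S" "?T \<subseteq> vsT.span S" using tuples_Sp[of 3 "\<lambda>_. e"] by blast
  have "cdim (cf ` ?f ` ?T) = vsP.dim (?f ` ?T)"
    by (rule cdim_cf[OF vsTP.linear_subspace_image[OF linear_der sub]
      vsTP.linear_spans_image[OF linear_der S(2)] finite_imageI[OF S(1)]])
  moreover have "vsT.dim ?T = vsT.dim (Dk e) + vsP.dim (?f ` ?T)"
    unfolding Dk_def by (rule vsTP.rank_nullity[OF linear_der sub S(2,1)])
  moreover have "vsT.dim ?T = 3 * ((e + 2) choose 2)"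
    using tuples_Sp[of 3 "\<lambda>_. e"] by simp
  ultimately show ?thesis unfolding Jk_F by simp
qed

section \<open>The graded exact sequence of generators and relations\<close>

definition gdeg :: "nat \<Rightarrow> nat" where "gdeg i = card A - card (lines i)"

lemma card_lines_le: "card (lines i) \<le> card A"
  using card_mono[OF fin lines_sub] .

definition comb :: "(nat \<Rightarrow> mpoly) \<Rightarrow> nat \<Rightarrow> mpoly" where
  "comb h = (\<lambda>j. if j < 3 then \<Sum>i<n. h i * gen i j else 0)"

lemma linear_comb: "Vector_Spaces.linear (\<lambda>c (h :: nat \<Rightarrow> mpoly) i. Cst c * h i) (\<lambda>c (h :: nat \<Rightarrow> mpoly) i. Cst c * h i) comb"
  unfolding Vector_Spaces.linear_iff using vsT.vector_space_axioms
  by (auto simp: plus_fun_def comb_def fun_eq_iff distrib_right sum.distrib sum_distrib_left mult.assoc)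

text \<open>\<open>gdeg i\<close> is the degree of \<open>gen i\<close>; the bound on e keeps the
  truncated differences \<open>e - gdeg i\<close> exact. Coefficients may be taken homogeneous
  because the generators are.\<close>

lemma comb_image:
  assumes e: "card A \<le> e"
  shows "comb ` tuples n (\<lambda>i. Sp (e - gdeg i)) = Dk e"
proof
  have le: "gdeg i \<le> e" for i unfolding gdeg_def using e by simp
  show "comb ` tuples n (\<lambda>i. Sp (e - gdeg i)) \<subseteq> Dk e"
  proof
    fix \<theta> assume "\<theta> \<in> comb ` tuples n (\<lambda>i. Sp (e - gdeg i))"
    then obtain h where h: "h \<in> tuples n (\<lambda>i. Sp (e - gdeg i))" "\<theta> = comb h" by blast
    have "hom e (h i * gen i j)" if "i < n" for i j
    proof -
      have "hom (e - gdeg i) (h i)" using h(1) that by (auto simp: tuples_def Sp_def)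
      from hom_mult[OF this hom_gen[OF that, of j]] show ?thesis using le[of i] by (simp add: gdeg_def)
    qed
    then have "\<theta> \<in> tuples 3 (\<lambda>_. Sp e)"
      by (auto simp: h(2) comb_def tuples_def Sp_def intro!: hom_sum)
    moreover have "der \<theta> F = 0"
      unfolding derivations_generated by (auto simp: h(2) comb_def)
    ultimately show "\<theta> \<in> Dk e" by (simp add: Dk_def)
  qed
  show "Dk e \<subseteq> comb ` tuples n (\<lambda>i. Sp (e - gdeg i))"
  proof
    fix \<theta> assume "\<theta> \<in> Dk e"
    then have t: "\<theta> \<in> tuples 3 (\<lambda>_. Sp e)" and "der \<theta> F = 0" by (auto simp: Dk_def)
    then obtain h where h: "\<And>j. j < 3 \<Longrightarrow> \<theta> j = (\<Sum>i<n. h i * gen i j)"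
      unfolding derivations_generated by blast
    define h' where "h' i = (if i < n then hpart (e - gdeg i) (h i) else 0)" for i
    have "comb h' j = \<theta> j" for j
    proof (cases "j < 3")
      case True
      have "\<theta> j = hpart e (\<theta> j)" using t True by (simp add: tuples_def Sp_def hom_eq_hpart)
      also have "\<dots> = (\<Sum>i<n. hpart (e - gdeg i) (h i) * gen i j)"
        unfolding h[OF True] hpart_sum
        by (rule sum.cong) (use le in \<open>simp_all add: hpart_mult[OF hom_gen] gdeg_def\<close>)
      finally show ?thesis using True by (simp add: comb_def h'_def)
    next
      case False
      then show ?thesis using t by (simp add: comb_def tuples_def)
    qed
    then have "\<theta> = comb h'" by (simp add: fun_eq_iff)
    moreover have "h' \<in> tuples n (\<lambda>i. Sp (e - gdeg i))" by (auto simp: tuples_def h'_def Sp_def)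
    ultimately show "\<theta> \<in> comb ` tuples n (\<lambda>i. Sp (e - gdeg i))" by blast
  qed
qed

text \<open>The relations among the generators in a given degree are the kernel of
  \<open>rel\<close>, embedded by \<open>qmul\<close>; with \<open>comb\<close> this makes the
  degree-e piece of D_0 a cokernel.\<close>

definition rel :: "(nat \<Rightarrow> mpoly) \<Rightarrow> nat \<Rightarrow> mpoly" where
  "rel c = (\<lambda>j. if j = 0 then \<Sum>i<n. c i * Cst (xc i) else if j = 1 then \<Sum>i<n. c i * Cst (yc i) else 0)"

definition qmul :: "(nat \<Rightarrow> mpoly) \<Rightarrow> nat \<Rightarrow> mpoly" where
  "qmul c = (\<lambda>i. if i < n then q i * c i else 0)"

lemma linear_rel: "Vector_Spaces.linear (\<lambda>c (h :: nat \<Rightarrow> mpoly) i. Cst c * h i) (\<lambda>c (h :: nat \<Rightarrow> mpoly) i. Cst c * h i) rel"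
  unfolding Vector_Spaces.linear_iff using vsT.vector_space_axioms
  by (auto simp: plus_fun_def rel_def fun_eq_iff distrib_right sum.distrib sum_distrib_left mult.assoc)

lemma linear_qmul: "Vector_Spaces.linear (\<lambda>c (h :: nat \<Rightarrow> mpoly) i. Cst c * h i) (\<lambda>c (h :: nat \<Rightarrow> mpoly) i. Cst c * h i) qmul"
  unfolding Vector_Spaces.linear_iff using vsT.vector_space_axioms
  by (auto simp: plus_fun_def qmul_def fun_eq_iff algebra_simps)

lemma hom_q: "hom (card (lines i)) (q i)"
  unfolding q_def by (rule hom_prod_LF) simp

lemma rel_eq_0: "rel c = 0 \<longleftrightarrow> (\<Sum>i<n. c i * Cst (xc i)) = 0 \<and> (\<Sum>i<n. c i * Cst (yc i)) = 0"
  by (auto simp: rel_def fun_eq_iff zero_fun_def)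

text \<open>A coefficient h i = q i * c i of degree \<open>e - gdeg i\<close> has c i of degree
  \<open>e - card A\<close>, the same for every i. This is why all c i can satisfy common linear
  relations with constant coefficients.\<close>

lemma comb_kernel:
  assumes e: "card A \<le> e"
  shows "{h \<in> tuples n (\<lambda>i. Sp (e - gdeg i)). comb h = 0} =
    qmul ` {c \<in> tuples n (\<lambda>_. Sp (e - card A)). rel c = 0}"
proof
  have dg: "e - gdeg i = (e - card A) + card (lines i)" for i
    unfolding gdeg_def using e card_lines_le[of i] by simp
  have c0: "comb h = 0 \<longleftrightarrow> (\<forall>j<3. (\<Sum>i<n. h i * gen i j) = 0)" for h
    by (auto simp: comb_def fun_eq_iff zero_fun_def)
  show "{h \<in> tuples n (\<lambda>i. Sp (e - gdeg i)). comb h = 0} \<subseteq>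
    qmul ` {c \<in> tuples n (\<lambda>_. Sp (e - card A)). rel c = 0}"
  proof safe
    fix h assume h: "h \<in> tuples n (\<lambda>i. Sp (e - gdeg i))" "comb h = 0"
    then obtain c where c: "\<And>i. i < n \<Longrightarrow> h i = q i * c i"
      "(\<Sum>i<n. c i * Cst (xc i)) = 0" "(\<Sum>i<n. c i * Cst (yc i)) = 0"
      unfolding c0 gen_syzygies by blast
    define c' where "c' i = (if i < n then hpart (e - card A) (c i) else 0)" for i
    have "h = qmul c'"
    proof
      fix i
      show "h i = qmul c' i"
      proof (cases "i < n")
        case True
        have "h i = hpart (e - gdeg i) (h i)" using h True by (simp add: tuples_def Sp_def hom_eq_hpart)
        also have "\<dots> = hpart (e - card A) (c i) * q i"
          unfolding dg using c(1)[OF True] hpart_mult_add[OF hom_q] by (metis mult.commute)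
        finally show ?thesis using True by (simp add: qmul_def c'_def mult.commute)
      next
        case False
        then show ?thesis using h by (simp add: tuples_def qmul_def)
      qed
    qed
    moreover have "c' \<in> tuples n (\<lambda>_. Sp (e - card A))" by (auto simp: tuples_def c'_def Sp_def)
    moreover have "(\<Sum>i<n. c' i * Cst (z i)) = 0" if z: "(\<Sum>i<n. c i * Cst (z i)) = 0" for z
    proof -
      have "(\<Sum>i<n. c' i * Cst (z i)) = hpart (e - card A) (\<Sum>i<n. c i * Cst (z i))"
        unfolding hpart_sum
        by (rule sum.cong) (use hpart_mult_add[OF hom_Cst, of "e - card A"] in \<open>auto simp: c'_def\<close>)
      then show ?thesis using z by simp
    qed
    then have "rel c' = 0" unfolding rel_eq_0 using c by blast
    ultimately show "h \<in> qmul ` {c \<in> tuples n (\<lambda>_. Sp (e - card A)). rel c = 0}" by blast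
  qed
  show "qmul ` {c \<in> tuples n (\<lambda>_. Sp (e - card A)). rel c = 0} \<subseteq>
    {h \<in> tuples n (\<lambda>i. Sp (e - gdeg i)). comb h = 0}"
  proof safe
    fix c assume c: "c \<in> tuples n (\<lambda>_. Sp (e - card A))" "rel c = 0"
    show "qmul c \<in> tuples n (\<lambda>i. Sp (e - gdeg i))"
      using c hom_mult[OF hom_q] by (auto simp: tuples_def qmul_def Sp_def dg add.commute)
    show "comb (qmul c) = 0"
      unfolding c0 gen_syzygies using c(2) unfolding rel_eq_0
      by (intro exI[of _ c]) (simp add: qmul_def)
  qed
qed

lemma rel_image: "rel ` tuples n (\<lambda>_. Sp t) = tuples 2 (\<lambda>_. Sp t)"
proof
  show "rel ` tuples n (\<lambda>_. Sp t) \<subseteq> tuples 2 (\<lambda>_. Sp t)"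
    using hom_mult[OF _ hom_Cst]
    by (fastforce simp: rel_def tuples_def Sp_def intro!: hom_sum)
  show "tuples 2 (\<lambda>_. Sp t) \<subseteq> rel ` tuples n (\<lambda>_. Sp t)"
  proof
    fix a assume a: "a \<in> tuples 2 (\<lambda>_. Sp t)"
    have n: "0 < n" "1 < n" using n2 by auto
    define D where "D = xc 0 * yc 1 - xc 1 * yc 0"
    have D: "D \<noteq> 0" unfolding D_def using xy_det[OF n] by simp
    \<comment> \<open>A preimage supported on indices 0 and 1, obtained by Cramer's rule.\<close>
    define c where "c i = (if i = 0 then Cst (yc 1 / D) * a 0 - Cst (xc 1 / D) * a 1 else
      if i = 1 then Cst (xc 0 / D) * a 1 - Cst (yc 0 / D) * a 0 else 0)" for i :: nat
    have s: "(\<Sum>i<n. c i * Cst (z i)) = c 0 * Cst (z 0) + c 1 * Cst (z 1)" for z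
    proof -
      have "(\<Sum>i<n. c i * Cst (z i)) = (\<Sum>i\<in>{0,1}. c i * Cst (z i))"
        using n by (intro sum.mono_neutral_right) (auto simp: c_def)
      then show ?thesis by simp
    qed
    have c01: "c 0 = Cst (yc 1 / D) * a 0 - Cst (xc 1 / D) * a 1"
      "c 1 = Cst (xc 0 / D) * a 1 - Cst (yc 0 / D) * a 0" by (simp_all add: c_def)
    have rc: "rel c 0 = c 0 * Cst (xc 0) + c 1 * Cst (xc 1)" "rel c 1 = c 0 * Cst (yc 0) + c 1 * Cst (yc 1)"
      unfolding rel_def s by simp_all
    have D1: "yc 1 / D * xc 0 - yc 0 / D * xc 1 = 1" "yc 1 / D * yc 0 = yc 0 / D * yc 1"
      "xc 1 / D * xc 0 = xc 0 / D * xc 1" "xc 0 / D * yc 1 - xc 1 / D * yc 0 = 1"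
    proof -
      have "yc 1 / D * xc 0 - yc 0 / D * xc 1 = (xc 0 * yc 1 - xc 1 * yc 0) / D"
        "xc 0 / D * yc 1 - xc 1 / D * yc 0 = (xc 0 * yc 1 - xc 1 * yc 0) / D"
        by (simp_all add: diff_divide_distrib mult.commute)
      then show "yc 1 / D * xc 0 - yc 0 / D * xc 1 = 1" "xc 0 / D * yc 1 - xc 1 / D * yc 0 = 1"
        unfolding D_def[symmetric] using D by simp_all
    qed simp_all
    have r0: "rel c 0 = a 0"
    proof -
      have "rel c 0 = Cst (yc 1 / D * xc 0 - yc 0 / D * xc 1) * a 0 - Cst (xc 1 / D * xc 0) * a 1 + Cst (xc 0 / D * xc 1) * a 1"
        unfolding Cst_diff Cst_mult rc c01 by (simp add: algebra_simps)
      then show ?thesis unfolding D1 by simp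
    qed
    have r1: "rel c 1 = a 1"
    proof -
      have "rel c 1 = Cst (yc 1 / D * yc 0) * a 0 - Cst (yc 0 / D * yc 1) * a 0 + Cst (xc 0 / D * yc 1 - xc 1 / D * yc 0) * a 1"
        unfolding Cst_diff Cst_mult rc c01 by (simp add: algebra_simps)
      then show ?thesis unfolding D1 by simp
    qed
    have "rel c = a"
    proof
      fix j
      show "rel c j = a j"
        using r0 r1 a by (cases "j = 0"; cases "j = 1") (auto simp: rel_def tuples_def)
    qed
    moreover have "c \<in> tuples n (\<lambda>_. Sp t)"
      using a n by (auto simp: tuples_def c_def Sp_def intro!: hom_diff hom_Cst_mult)
    ultimately show "a \<in> rel ` tuples n (\<lambda>_. Sp t)" by blast
  qed
qed

text \<open>Three applications of rank-nullity: \<open>rel\<close> is onto pairs,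
  \<open>qmul\<close> is injective, and \<open>comb\<close> has the image of the relations as
  kernel. The identity is kept additive to avoid truncated subtraction.\<close>

lemma dim_Dk:
  assumes e: "card A \<le> e"
  shows "vsT.dim (Dk e) + n * ((e - card A + 2) choose 2) =
    (\<Sum>i<n. (e - gdeg i + 2) choose 2) + 2 * ((e - card A + 2) choose 2)"
proof -
  define t where "t = e - card A"
  let ?C = "{c \<in> tuples n (\<lambda>_. Sp t). rel c = 0}"
  let ?T = "tuples n (\<lambda>_. Sp t)"
  have subT: "vsT.subspace ?T" by (rule subspace_tuples) (rule subspace_Sp)
  obtain S where S: "finite S" "?T \<subseteq> vsT.span S" using tuples_Sp[of n "\<lambda>_. t"] by blast
  have "vsT.dim ?T = vsT.dim ?C + vsT.dim (rel ` ?T)"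
    by (rule vsTT.rank_nullity[OF linear_rel subT S(2,1)])
  then have 1: "n * ((t + 2) choose 2) = vsT.dim ?C + 2 * ((t + 2) choose 2)"
    unfolding rel_image using tuples_Sp[of n "\<lambda>_. t"] tuples_Sp[of 2 "\<lambda>_. t"] by simp
  have subC: "vsT.subspace ?C"
  proof -
    have "?C = ?T \<inter> {c. rel c = 0}" by auto
    then show ?thesis
      using vsT.subspace_inter[OF subT vsTT.linear_subspace_kernel[OF linear_rel]] by simp
  qed
  have "vsT.dim ?C = vsT.dim {c \<in> ?C. qmul c = 0} + vsT.dim (qmul ` ?C)"
    by (rule vsTT.rank_nullity[OF linear_qmul subC _ S(1)]) (use S(2) in blast)
  moreover have "{c \<in> ?C. qmul c = 0} = {0}"
  proof -
    have "c = 0" if "c \<in> ?T" "qmul c = 0" for c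
    proof
      fix i
      show "c i = 0 i"
        using that q_nz[of i] by (cases "i < n") (auto simp: tuples_def qmul_def fun_eq_iff zero_fun_def split: if_splits)
    qed
    moreover have "0 \<in> ?C" using vsT.subspace_0[OF subC] .
    moreover have "qmul 0 = 0" by (simp add: qmul_def fun_eq_iff zero_fun_def)
    ultimately show ?thesis by blast
  qed
  moreover have "vsT.dim {0} = 0" using vsT.dim_le_card[of "{0}" "{}"] by simp
  ultimately have 2: "vsT.dim ?C = vsT.dim (qmul ` ?C)" by simp
  let ?H = "tuples n (\<lambda>i. Sp (e - gdeg i))"
  have subH: "vsT.subspace ?H" by (rule subspace_tuples) (rule subspace_Sp)
  obtain S' where S': "finite S'" "?H \<subseteq> vsT.span S'" using tuples_Sp[of n "\<lambda>i. e - gdeg i"] by blast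
  have "vsT.dim ?H = vsT.dim {h \<in> ?H. comb h = 0} + vsT.dim (comb ` ?H)"
    by (rule vsTT.rank_nullity[OF linear_comb subH S'(2,1)])
  then have "(\<Sum>i<n. (e - gdeg i + 2) choose 2) = vsT.dim (qmul ` ?C) + vsT.dim (Dk e)"
    unfolding comb_kernel[OF e] comb_image[OF e] t_def using tuples_Sp[of n "\<lambda>i. e - gdeg i"] by simp
  then show ?thesis using 1 2 unfolding t_def by simp
qed

text \<open>For k at least 2 * card A the coefficients have degree e = k - card A at least card A,
  the range covered by \<open>dim_Dk\<close>. All dependence on t then cancels.\<close>

lemma hilbM_F:
  assumes \<delta>: "\<And>i. i < n \<Longrightarrow> card (lines i) \<le> 2" and k: "2 * card A \<le> k"
  shows "hilbM (cf F) k = (Suc (card A) choose 2) + card {i. i < n \<and> card (lines i) = 2}"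
proof -
  define e where "e = k - card A"
  define t where "t = e - card A"
  have ke: "k = e + card A" and e: "card A \<le> e" and et: "e = t + card A"
    using k by (auto simp: e_def t_def)
  let ?s = "card {i. i < n \<and> card (lines i) = 2}"
  have s: "real ?s = (\<Sum>i<n. if card (lines i) = 2 then 1 else 0)"
  proof -
    have "{i. i < n \<and> card (lines i) = 2} = {i \<in> {..<n}. card (lines i) = 2}" by auto
    then show ?thesis by (simp add: sum.inter_filter[symmetric])
  qed
  \<comment> \<open>Relative to (t + 2 choose 2), a linear q i adds t + 2 and a quadratic one adds
    (t + 2) + (t + 3); the conditional term records the surplus 1.\<close>
  have summand: "real ((e - gdeg i + 2) choose 2) = real ((t + 2) choose 2) +
      real (card (lines i)) * (real t + 2) + (if card (lines i) = 2 then 1 else 0)" if i: "i < n" for i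
  proof -
    have eq: "e - gdeg i = t + card (lines i)" unfolding gdeg_def et using card_lines_le[of i] by simp
    have "card (lines i) = 0 \<or> card (lines i) = 1 \<or> card (lines i) = 2" using \<delta>[OF i] by linarith
    then show ?thesis unfolding real_choose_2 eq by (elim disjE) (simp_all add: field_simps)
  qed
  have "real (\<Sum>i<n. (e - gdeg i + 2) choose 2) = (\<Sum>i<n. real ((t + 2) choose 2) +
      real (card (lines i)) * (real t + 2) + (if card (lines i) = 2 then 1 else 0))"
    unfolding of_nat_sum by (rule sum.cong) (use summand in auto)
  also have "\<dots> = real n * real ((t + 2) choose 2) + real (card A) * (real t + 2) + real ?s"
    unfolding s card_A by (simp add: sum.distrib sum_distrib_right)
  finally have sum: "real (\<Sum>i<n. (e - gdeg i + 2) choose 2) = \<dots>" .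
  have "real (vsT.dim (Dk e)) + real n * real ((t + 2) choose 2) =
      real (\<Sum>i<n. (e - gdeg i + 2) choose 2) + 2 * real ((t + 2) choose 2)"
    using arg_cong[OF dim_Dk[OF e], of real] unfolding t_def by simp
  then have D: "real (vsT.dim (Dk e)) = 2 * real ((t + 2) choose 2) + real (card A) * (real t + 2) + real ?s"
    unfolding sum by simp
  have J: "real (cdim (Jk (cf F) k)) + real (vsT.dim (Dk e)) = 3 * real ((e + 2) choose 2)"
    using arg_cong[OF cdim_Jk[of e], of real] unfolding ke by simp
  have S: "real (cdim (Sk k)) = real ((k + 2) choose 2)" by (simp add: cdim_Sk)
  have c: "real (Suc m choose 2) = real m * (real m + 1) / 2" for m
    by (induction m) (auto simp: numeral_2_eq_2 field_simps)
  have "real (cdim (Sk k)) = real (cdim (Jk (cf F) k)) + real ((Suc (card A) choose 2) + ?s)"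
    using J D S unfolding real_choose_2 of_nat_add c ke et
    by (simp add: field_simps)
  then have "cdim (Sk k) = cdim (Jk (cf F) k) + ((Suc (card A) choose 2) + ?s)"
    by (simp only: of_nat_add[symmetric] of_nat_eq_iff)
  then show ?thesis unfolding hilbM_def by simp
qed

theorem tjurina_F:
  assumes "\<And>i. i < n \<Longrightarrow> card (lines i) \<le> 2"
  shows "tjurina (cf F) = (Suc (card A) choose 2) + card {i. i < n \<and> card (lines i) = 2}"
  unfolding tjurina_def
proof (rule the_equality)
  show "\<exists>k0. \<forall>k\<ge>k0. hilbM (cf F) k = (Suc (card A) choose 2) + card {i. i < n \<and> card (lines i) = 2}"
    using hilbM_F[OF assms] by blast
next
  fix t assume "\<exists>k0. \<forall>k\<ge>k0. hilbM (cf F) k = t"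
  then obtain k0 where "\<forall>k\<ge>k0. hilbM (cf F) k = t" by blast
  \<comment> \<open>Both eventual values are read off in one degree beyond both thresholds.\<close>
  then have "hilbM (cf F) (max k0 (2 * card A)) = t" by simp
  moreover have "hilbM (cf F) (max k0 (2 * card A)) =
      (Suc (card A) choose 2) + card {i. i < n \<and> card (lines i) = 2}"
    by (rule hilbM_F[OF assms]) simp_all
  ultimately show "t = (Suc (card A) choose 2) + card {i. i < n \<and> card (lines i) = 2}" by simp
qed

end

section \<open>Submodules given by lists of generators\<close>

text \<open>Vectors and matrices are given by lists of coefficient functions, the algebra above by
  indexed families of polynomials; \<open>tov\<close> and \<open>tol\<close> pass from the latter to
  the former.\<close>

definition tov :: "nat \<Rightarrow> (nat \<Rightarrow> mpoly) \<Rightarrow> poly3 list" where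
  "tov n \<theta> = map (\<lambda>i. cf (\<theta> i)) [0..<n]"

definition tol :: "nat \<Rightarrow> nat \<Rightarrow> (nat \<Rightarrow> nat \<Rightarrow> mpoly) \<Rightarrow> poly3 list list" where
  "tol m n g = map (\<lambda>j. tov n (g j)) [0..<m]"

lemma length_tov [simp]: "length (tov n \<theta>) = n"
  and length_tol [simp]: "length (tol m n g) = m"
  and nth_tov [simp]: "i < n \<Longrightarrow> tov n \<theta> ! i = cf (\<theta> i)"
  and nth_tol [simp]: "j < m \<Longrightarrow> tol m n g ! j = tov n (g j)"
  by (simp_all add: tov_def tol_def)

lemma tov_eq_iff: "tov n \<theta> = tov n \<eta> \<longleftrightarrow> (\<forall>i<n. \<theta> i = \<eta> i)"
  by (auto simp: tov_def list_eq_iff_nth_eq)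

text \<open>A list of length n determines the underlying family only below n, so P has to be
  insensitive to the values beyond.\<close>

lemma tov_mem_iff:
  assumes "\<And>\<eta>. (\<And>i. i < n \<Longrightarrow> \<eta> i = \<theta> i) \<Longrightarrow> P \<eta> \<Longrightarrow> P \<theta>"
  shows "tov n \<theta> \<in> {tov n \<eta> | \<eta>. P \<eta>} \<longleftrightarrow> P \<theta>"
proof
  assume "tov n \<theta> \<in> {tov n \<eta> | \<eta>. P \<eta>}"
  then obtain \<eta> where "tov n \<eta> = tov n \<theta>" "P \<eta>" by auto
  then show "P \<theta>" using assms[of \<eta>] unfolding tov_eq_iff by blast
qed blast

lemma tov_replicate: "replicate n pzero = tov n (\<lambda>_. 0)"
  by (simp add: list_eq_iff_nth_eq cf_0)

lemma is_poly_list: "(\<forall>h\<in>set hs. is_poly h) \<longleftrightarrow> (\<exists>h. hs = tov (length hs) h)"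
proof
  assume "\<forall>h\<in>set hs. is_poly h"
  then have "\<forall>i<length hs. \<exists>p. hs ! i = cf p" using is_poly_obtain by (metis nth_mem)
  then obtain p where "\<And>i. i < length hs \<Longrightarrow> hs ! i = cf (p i)" by metis
  then have "hs = tov (length hs) p" by (simp add: list_eq_iff_nth_eq)
  then show "\<exists>h. hs = tov (length hs) h" by blast
next
  assume "\<exists>h. hs = tov (length hs) h"
  then obtain h where "hs = tov (length hs) h" by blast
  then have "set hs \<subseteq> range cf" by (metis (no_types, lifting) in_set_conv_nth length_tov nth_tov rangeI subsetI)
  then show "\<forall>h\<in>set hs. is_poly h" by auto
qed

lemma length_ex_tov: "(length hs = m \<and> (\<exists>h. hs = tov (length hs) h)) \<longleftrightarrow> (\<exists>h. hs = tov m h)"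
  by auto

lemma vcomb_tol: "vcomb n (tov m h) (tol m n g) = tov n (\<lambda>i. \<Sum>j<m. h j * g j i)"
  by (auto simp: vcomb_def tov_def tol_def list_eq_iff_nth_eq fun_eq_iff lookup_sum cf_mult intro!: sum.cong)

lemma submod_tol: "submod n (tol m n g) = {tov n \<theta> | \<theta>. \<exists>h. \<forall>i<n. \<theta> i = (\<Sum>j<m. h j * g j i)}"
proof -
  have "submod n (tol m n g) = {vcomb n (tov m h) (tol m n g) | h. True}"
    unfolding submod_def length_tol is_poly_list length_ex_tov by auto
  also have "\<dots> = {tov n \<theta> | \<theta>. \<exists>h. \<forall>i<n. \<theta> i = (\<Sum>j<m. h j * g j i)}"
    unfolding vcomb_tol by (auto simp: tov_eq_iff)
  finally show ?thesis .
qed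

text \<open>The increasing enumeration of the indices other than j, which describes a list with its
  j-th entry deleted.\<close>

definition skip :: "nat \<Rightarrow> nat \<Rightarrow> nat" where "skip j i = (if i < j then i else Suc i)"

lemma bij_skip: "j < m \<Longrightarrow> bij_betw (skip j) {..<m - 1} ({..<m} - {j})"
  by (rule bij_betw_byWitness[where f' = "\<lambda>i. if i < j then i else i - 1"])
    (auto simp: skip_def)

lemma tol_remove: "j < m \<Longrightarrow> take j (tol m n g) @ drop (Suc j) (tol m n g) = tol (m - 1) n (\<lambda>i. g (skip j i))"
  by (auto simp: list_eq_iff_nth_eq nth_append skip_def)

lemma submod_remove:
  assumes j: "j < m"
  shows "tov n \<theta> \<in> submod n (take j (tol m n g) @ drop (Suc j) (tol m n g)) \<longleftrightarrow>
    (\<exists>h. \<forall>i<n. \<theta> i = (\<Sum>l\<in>{..<m} - {j}. h l * g l i))"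
proof -
  have *: "(\<Sum>l\<in>{..<m} - {j}. h l * g l i) = (\<Sum>l<m - 1. h (skip j l) * g (skip j l) i)" for h i
    by (rule sum.reindex_bij_betw[OF bij_skip[OF j], symmetric])
  have mem: "tov n \<theta> \<in> {tov n \<theta> |\<theta>. \<exists>h. \<forall>i<n. \<theta> i = (\<Sum>l<m - 1. h l * g (skip j l) i)} \<longleftrightarrow>
      (\<exists>h. \<forall>i<n. \<theta> i = (\<Sum>l<m - 1. h l * g (skip j l) i))"
    by (rule tov_mem_iff) simp
  show ?thesis
    unfolding tol_remove[OF j] submod_tol mem *
  proof
    assume "\<exists>h. \<forall>i<n. \<theta> i = (\<Sum>l<m - 1. h l * g (skip j l) i)"
    then obtain h where h: "\<forall>i<n. \<theta> i = (\<Sum>l<m - 1. h l * g (skip j l) i)" by blast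
    define h' where "h' i = h (if i < j then i else i - 1)" for i
    have "h' (skip j l) = h l" for l by (simp add: h'_def skip_def)
    with h have "\<forall>i<n. \<theta> i = (\<Sum>l<m - 1. h' (skip j l) * g (skip j l) i)" by simp
    then show "\<exists>h. \<forall>i<n. \<theta> i = (\<Sum>l<m - 1. h (skip j l) * g (skip j l) i)"
      by (intro exI[of _ h'])
  next
    assume "\<exists>h. \<forall>i<n. \<theta> i = (\<Sum>l<m - 1. h (skip j l) * g (skip j l) i)"
    then obtain h where h: "\<forall>i<n. \<theta> i = (\<Sum>l<m - 1. h (skip j l) * g (skip j l) i)" by blast
    show "\<exists>h. \<forall>i<n. \<theta> i = (\<Sum>l<m - 1. h l * g (skip j l) i)"
      by (rule exI[of _ "\<lambda>l. h (skip j l)"]) (rule h)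
  qed
qed

lemma vhomog_tov: "vhomog t (tov n \<theta>) \<longleftrightarrow> (\<forall>i<n. hom t (\<theta> i))"
  by (auto simp: vhomog_def tov_def)

lemma min_gen_by_tol:
  "min_gen_by n M (tol m n g) t \<longleftrightarrow>
    M = {tov n \<theta> | \<theta>. \<exists>h. \<forall>i<n. \<theta> i = (\<Sum>j<m. h j * g j i)} \<and>
    (\<forall>j<m. \<forall>i<n. hom t (g j i)) \<and>
    (\<forall>j<m. \<not> (\<exists>h. \<forall>i<n. g j i = (\<Sum>l\<in>{..<m} - {j}. h l * g l i)))"
proof -
  have 1: "(\<forall>x\<in>set (tol m n g). length x = n \<and> vhomog t x) \<longleftrightarrow> (\<forall>j<m. \<forall>i<n. hom t (g j i))"
    by (auto simp: tol_def vhomog_tov)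
  have 2: "(\<forall>j<length (tol m n g). tol m n g ! j \<notin> submod n (take j (tol m n g) @ drop (Suc j) (tol m n g)))
    \<longleftrightarrow> (\<forall>j<m. \<not> (\<exists>h. \<forall>i<n. g j i = (\<Sum>l\<in>{..<m} - {j}. h l * g l i)))"
    by (simp add: submod_remove)
  show ?thesis unfolding min_gen_by_def 1 2 submod_tol ..
qed

text \<open>Homogeneity forces finite support, so even a list that is merely assumed to be a minimal
  generating system comes from a family of polynomials.\<close>

lemma min_gen_by_imp_tol:
  assumes "min_gen_by n M G t"
  obtains g where "G = tol (length G) n g"
proof -
  have "\<forall>j<length G. \<exists>\<theta>. G ! j = tov n \<theta>"
    using assms homog_is_poly unfolding min_gen_by_def vhomog_def by (metis is_poly_list nth_mem)
  then obtain g where "\<And>j. j < length G \<Longrightarrow> G ! j = tov n (g j)" by metis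
  then have "G = tol (length G) n g" by (simp add: list_eq_iff_nth_eq[of G])
  then show ?thesis by (rule that)
qed

lemma Syz_tol: "Syz (tol m 3 g) = {tov m h | h. \<forall>i<3. (\<Sum>j<m. h j * g j i) = 0}"
proof -
  have "Syz (tol m 3 g) = {tov m h | h. vcomb 3 (tov m h) (tol m 3 g) = replicate 3 pzero}"
    unfolding Syz_def length_tol is_poly_list conj_assoc[symmetric] length_ex_tov by blast
  then show ?thesis unfolding vcomb_tol tov_replicate tov_eq_iff .
qed

lemma D0_cf: "D0 (cf F) = {tov 3 \<theta> | \<theta>. der \<theta> F = 0}"
proof -
  have *: "padd (padd (pmul (cf a) (dx (cf F))) (pmul (cf b) (dy (cf F)))) (pmul (cf c) (dz (cf F))) = pzero
    \<longleftrightarrow> a * pder 0 F + b * pder 1 F + c * pder 2 F = 0" for a b c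
    unfolding cf_grad cf_mult[symmetric] cf_add[symmetric] cf_0[symmetric] by simp
  have t: "tov 3 \<theta> = [cf (\<theta> 0), cf (\<theta> 1), cf (\<theta> 2)]" for \<theta>
    by (simp add: tov_def upt_rec numeral_2_eq_2)
  show ?thesis
  proof
    show "D0 (cf F) \<subseteq> {tov 3 \<theta> | \<theta>. der \<theta> F = 0}"
    proof
      fix w assume "w \<in> D0 (cf F)"
      then obtain a b c where w: "w = [a, b, c]" and p: "is_poly a" "is_poly b" "is_poly c"
        and z: "padd (padd (pmul a (dx (cf F))) (pmul b (dy (cf F)))) (pmul c (dz (cf F))) = pzero"
        unfolding D0_def by blast
      obtain a' b' c' where abc: "a = cf a'" "b = cf b'" "c = cf c'"
        using p is_poly_obtain by metis
      define \<theta> where "\<theta> i = (if i = 0 then a' else if i = 1 then b' else c')" for i :: nat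
      have "w = tov 3 \<theta>" unfolding t w abc by (simp add: \<theta>_def)
      moreover have "der \<theta> F = 0"
        using z unfolding abc * by (simp add: der_def sum_lessThan_3 \<theta>_def)
      ultimately show "w \<in> {tov 3 \<theta> | \<theta>. der \<theta> F = 0}" by blast
    qed
    show "{tov 3 \<theta> | \<theta>. der \<theta> F = 0} \<subseteq> D0 (cf F)"
    proof safe
      fix \<theta> assume "der \<theta> F = 0"
      then have "\<theta> 0 * pder 0 F + \<theta> 1 * pder 1 F + \<theta> 2 * pder 2 F = 0"
        by (simp add: der_def sum_lessThan_3)
      then show "tov 3 \<theta> \<in> D0 (cf F)"
        unfolding t D0_def using * is_poly_cf by blast
    qed
  qed
qed

lemma mdr_cf: "mdr (cf F) = (LEAST r. \<exists>\<theta>. der \<theta> F = 0 \<and> (\<forall>i<3. hom r (\<theta> i)) \<and> (\<exists>i<3. \<theta> i \<noteq> 0))"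
  unfolding mdr_def D0_cf tov_replicate
  by (rule arg_cong[of _ _ Least]) (auto simp: fun_eq_iff tov_eq_iff vhomog_tov)

section \<open>Minimal generators and relations\<close>

context pencil_arrangement
begin

text \<open>Behind every minimality argument: a coefficient occurring in a relation lies in (q i),
  so it cannot be a nonzero constant when q i is a quadric.\<close>

lemma gen_independent:
  assumes "\<And>j. j < 3 \<Longrightarrow> (\<Sum>i<n. h i * gen i j) = 0" "i < n"
  shows "q i dvd h i"
  using gen_syzygies[of h] assms by auto

lemma hpart_gen_comb:
  assumes "\<And>j. j < 3 \<Longrightarrow> \<theta> j = (\<Sum>i<n. h i * gen i j)" "\<And>j. j < 3 \<Longrightarrow> hom r (\<theta> j)" "j < 3"
  shows "\<theta> j = (\<Sum>i<n. if gdeg i \<le> r then hpart (r - gdeg i) (h i) * gen i j else 0)"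
proof -
  have "\<theta> j = hpart r (\<Sum>i<n. h i * gen i j)" using assms by (metis hom_eq_hpart)
  also have "\<dots> = (\<Sum>i<n. if gdeg i \<le> r then hpart (r - gdeg i) (h i) * gen i j else 0)"
    unfolding hpart_sum gdeg_def by (rule sum.cong) (simp_all add: hpart_mult[OF hom_gen])
  finally show ?thesis .
qed

lemma const_multiple_q:
  assumes "q i dvd Cst c" "card (lines i) = 2"
  shows "c = 0"
proof -
  obtain p where "Cst c = p * q i" using assms(1) by (metis dvdE mult.commute)
  then have "hpart 0 (Cst c) = hpart 0 (p * q i)" by simp
  also have "\<dots> = 0" using hpart_mult[OF hom_q] assms(2) by simp
  finally show ?thesis by (simp add: hom_eq_hpart[OF hom_Cst])
qed

lemma gen_nonzero:
  assumes "i < n" "card (lines i) = 2"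
  shows "\<exists>j<3. gen i j \<noteq> 0"
proof (rule ccontr)
  assume z: "\<not> ?thesis"
  define h where "h l = (if l = i then 1 else 0 :: mpoly)" for l
  have "(\<Sum>l<n. h l * gen l j) = gen i j" for j
    using assms(1) by (simp add: h_def if_distrib[of "\<lambda>x. x * _"] cong: if_cong)
  then have "q i dvd h i" using z assms(1) by (intro gen_independent) auto
  then have "q i dvd Cst 1" by (simp add: h_def)
  then show False using const_multiple_q[OF _ assms(2)] by fastforce
qed

text \<open>A generator at a double point is nonzero of degree card A - 2. All generators have at
  least this degree, so in a smaller degree the homogeneous part of any combination is an empty
  sum.\<close>

theorem mdr_F:
  assumes "\<And>i. i < n \<Longrightarrow> card (lines i) \<le> 2" and i: "i < n" "card (lines i) = 2"
  shows "mdr (cf F) = card A - 2"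
  unfolding mdr_cf
proof (rule Least_equality)
  define h where "h l = (if l = i then 1 else 0 :: mpoly)" for l
  have "(\<Sum>l<n. h l * gen l j) = gen i j" for j
    using i(1) by (simp add: h_def if_distrib[of "\<lambda>x. x * _"] cong: if_cong)
  then have "der (gen i) F = 0" unfolding derivations_generated by metis
  moreover have "\<forall>j<3. hom (card A - 2) (gen i j)" using hom_gen[OF i(1)] i(2) by simp
  ultimately show "\<exists>\<theta>. der \<theta> F = 0 \<and> (\<forall>i<3. hom (card A - 2) (\<theta> i)) \<and> (\<exists>i<3. \<theta> i \<noteq> 0)"
    using gen_nonzero[OF i] by blast
next
  fix r assume "\<exists>\<theta>. der \<theta> F = 0 \<and> (\<forall>i<3. hom r (\<theta> i)) \<and> (\<exists>i<3. \<theta> i \<noteq> 0)"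
  then obtain \<theta> j where t: "der \<theta> F = 0" "\<And>i. i < 3 \<Longrightarrow> hom r (\<theta> i)" and j: "j < 3" "\<theta> j \<noteq> 0" by blast
  obtain h where h: "\<And>j. j < 3 \<Longrightarrow> \<theta> j = (\<Sum>i<n. h i * gen i j)"
    using t(1) unfolding derivations_generated by blast
  show "card A - 2 \<le> r"
  proof (rule ccontr)
    assume "\<not> card A - 2 \<le> r"
    then have "\<not> gdeg l \<le> r" if "l < n" for l
      using assms(1)[OF that] unfolding gdeg_def by linarith
    then have "(\<Sum>i<n. if gdeg i \<le> r then hpart (r - gdeg i) (h i) * gen i j else 0) = 0"
      by (intro sum.neutral) simp
    moreover have "\<theta> j = (\<Sum>i<n. if gdeg i \<le> r then hpart (r - gdeg i) (h i) * gen i j else 0)"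
      by (rule hpart_gen_comb) (fact h t(2) j(1))+
    ultimately show False using j by simp
  qed
qed

lemma D0_F: "D0 (cf F) = {tov 3 \<theta> | \<theta>. \<exists>h. \<forall>j<3. \<theta> j = (\<Sum>i<n. h i * gen i j)}"
  unfolding D0_cf derivations_generated ..

theorem min_gen_by_gen:
  assumes \<delta>: "\<And>i. i < n \<Longrightarrow> card (lines i) = 2"
  shows "min_gen_by 3 (D0 (cf F)) (tol n 3 gen) (card A - 2)"
  unfolding min_gen_by_tol
proof (intro conjI allI impI)
  show "D0 (cf F) = {tov 3 \<theta> | \<theta>. \<exists>h. \<forall>j<3. \<theta> j = (\<Sum>i<n. h i * gen i j)}" by (rule D0_F)
  show "hom (card A - 2) (gen j i)" if "j < n" for i j using hom_gen[OF that, of i] \<delta>[OF that] by simp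
  fix j assume j: "j < n"
  show "\<not> (\<exists>h. \<forall>i<3. gen j i = (\<Sum>l\<in>{..<n} - {j}. h l * gen l i))"
  proof
    assume "\<exists>h. \<forall>i<3. gen j i = (\<Sum>l\<in>{..<n} - {j}. h l * gen l i)"
    then obtain h where h: "\<And>i. i < 3 \<Longrightarrow> gen j i = (\<Sum>l\<in>{..<n} - {j}. h l * gen l i)" by blast
    \<comment> \<open>The coefficient -1 at j turns redundancy of the j-th generator into a
      relation, which would make the quadric q j divide a nonzero constant.\<close>
    define h' where "h' l = (if l = j then Cst (-1) else h l)" for l
    have "(\<Sum>l<n. h' l * gen l i) = 0" if i: "i < 3" for i
    proof -
      have "(\<Sum>l<n. h' l * gen l i) = h' j * gen j i + (\<Sum>l\<in>{..<n} - {j}. h' l * gen l i)"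
        using j by (intro sum.remove) auto
      also have "(\<Sum>l\<in>{..<n} - {j}. h' l * gen l i) = gen j i"
        unfolding h[OF i] by (rule sum.cong) (auto simp: h'_def)
      finally show ?thesis by (simp add: h'_def Cst_minus)
    qed
    then have "q j dvd h' j" using j by (rule gen_independent)
    then have "q j dvd Cst (- 1)" by (simp only: h'_def if_True simp_thms)
    from const_multiple_q[OF this \<delta>[OF j]] show False by simp
  qed
qed

text \<open>The t-th relation among the vectors (xc l, yc l) writes vector t + 2 in terms of vectors
  0 and 1. The shift by 2 reflects that the relations among n vectors spanning a plane have
  dimension n - 2.\<close>

definition relc :: "nat \<Rightarrow> nat \<Rightarrow> complex" where
  "relc t l = (if l = t + 2 then 1
    else if l = 0 then - (xc (t + 2) * yc 1 - xc 1 * yc (t + 2)) / (xc 0 * yc 1 - xc 1 * yc 0)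
    else if l = 1 then - (xc 0 * yc (t + 2) - xc (t + 2) * yc 0) / (xc 0 * yc 1 - xc 1 * yc 0)
    else 0)"

lemma det01: "xc 0 * yc 1 - xc 1 * yc 0 \<noteq> 0"
  by (rule xy_det) (use n2 in auto)

lemma relc_relation:
  assumes t: "t < n - 2"
  shows "(\<Sum>l<n. relc t l * xc l) = 0" "(\<Sum>l<n. relc t l * yc l) = 0"
proof -
  have s: "(\<Sum>l<n. relc t l * z l) = relc t 0 * z 0 + relc t 1 * z 1 + z (t + 2)" for z
  proof -
    have "(\<Sum>l<n. relc t l * z l) = (\<Sum>l\<in>{0, 1, t + 2}. relc t l * z l)"
      using t by (intro sum.mono_neutral_right) (auto simp: relc_def)
    then show ?thesis by (simp add: relc_def)
  qed
  define D where "D = xc 0 * yc 1 - xc 1 * yc 0"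
  have D: "D \<noteq> 0" unfolding D_def by (rule det01)
  have r: "D * relc t 0 = - (xc (t + 2) * yc 1 - xc 1 * yc (t + 2))"
    "D * relc t 1 = - (xc 0 * yc (t + 2) - xc (t + 2) * yc 0)"
    using D unfolding D_def by (simp_all add: relc_def)
  have "D * (\<Sum>l<n. relc t l * xc l) = (D * relc t 0) * xc 0 + (D * relc t 1) * xc 1 + D * xc (t + 2)"
    unfolding s by (simp add: algebra_simps)
  also have "\<dots> = 0" unfolding r unfolding D_def by (simp add: algebra_simps)
  finally show "(\<Sum>l<n. relc t l * xc l) = 0" using D by simp
  have "D * (\<Sum>l<n. relc t l * yc l) = (D * relc t 0) * yc 0 + (D * relc t 1) * yc 1 + D * yc (t + 2)"
    unfolding s by (simp add: algebra_simps)
  also have "\<dots> = 0" unfolding r unfolding D_def by (simp add: algebra_simps)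
  finally show "(\<Sum>l<n. relc t l * yc l) = 0" using D by simp
qed

lemma relc_comb_relation:
  assumes "\<And>l. l < n \<Longrightarrow> c l = (\<Sum>t<n - 2. a t * Cst (relc t l))"
  shows "(\<Sum>l<n. c l * Cst (xc l)) = 0" "(\<Sum>l<n. c l * Cst (yc l)) = 0"
proof -
  have "(\<Sum>l<n. c l * Cst (z l)) = (\<Sum>t<n - 2. a t * Cst (\<Sum>l<n. relc t l * z l))" for z
  proof -
    have "(\<Sum>l<n. c l * Cst (z l)) = (\<Sum>l<n. \<Sum>t<n - 2. a t * Cst (relc t l * z l))"
      by (rule sum.cong) (auto simp: assms sum_distrib_right Cst_mult mult.assoc)
    also have "\<dots> = (\<Sum>t<n - 2. \<Sum>l<n. a t * Cst (relc t l * z l))" by (rule sum.swap)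
    finally show ?thesis by (simp add: Cst_sum sum_distrib_left)
  qed
  then show "(\<Sum>l<n. c l * Cst (xc l)) = 0" "(\<Sum>l<n. c l * Cst (yc l)) = 0"
    using relc_relation by simp_all
qed

text \<open>The entries from index 2 on are the coordinates. Subtracting the corresponding
  combination leaves a relation between vectors 0 and 1 only, which are independent.\<close>

lemma relation_expand:
  assumes r: "(\<Sum>l<n. c l * Cst (xc l)) = 0" "(\<Sum>l<n. c l * Cst (yc l)) = 0" and l: "l < n"
  shows "c l = (\<Sum>t<n - 2. c (t + 2) * Cst (relc t l))"
proof -
  define e where "e l = c l - (\<Sum>t<n - 2. c (t + 2) * Cst (relc t l))" for l
  have e0: "e l = 0" if "l < n" "2 \<le> l" for l
  proof -
    have "(\<Sum>t<n - 2. c (t + 2) * Cst (relc t l)) = (\<Sum>t<n - 2. if t = l - 2 then c l else 0)"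
      using that by (intro sum.cong) (auto simp: relc_def)
    also have "\<dots> = c l"
    proof -
      have "l - 2 < n - 2" using that by linarith
      then show ?thesis by simp
    qed
    finally show ?thesis by (simp add: e_def)
  qed
  have es: "(\<Sum>l<n. e l * Cst (z l)) = e 0 * Cst (z 0) + e 1 * Cst (z 1)" for z
  proof -
    have "(\<Sum>l<n. e l * Cst (z l)) = (\<Sum>l\<in>{0,1}. e l * Cst (z l))"
      using n2 e0 by (intro sum.mono_neutral_right) (auto simp: not_le numeral_2_eq_2 less_Suc_eq)
    then show ?thesis by simp
  qed
  have "(\<Sum>l<n. e l * Cst (xc l)) = 0" "(\<Sum>l<n. e l * Cst (yc l)) = 0"
    using r relc_comb_relation[of "\<lambda>l. \<Sum>t<n - 2. c (t + 2) * Cst (relc t l)" "\<lambda>t. c (t + 2)"]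
    unfolding e_def by (simp_all add: left_diff_distrib sum_subtractf)
  then have z: "e 0 * Cst (xc 0) + e 1 * Cst (xc 1) = 0" "e 0 * Cst (yc 0) + e 1 * Cst (yc 1) = 0"
    unfolding es by simp_all
  have "e 0 * Cst (xc 0 * yc 1 - xc 1 * yc 0) = 0" "e 1 * Cst (xc 0 * yc 1 - xc 1 * yc 0) = 0"
    unfolding Cst_diff Cst_mult using z by algebra+
  then have "e 0 = 0" "e 1 = 0" using det01 by auto
  then have "e l = 0" using e0 l by (cases "2 \<le> l") (auto simp: not_le numeral_2_eq_2 less_Suc_eq)
  then show ?thesis by (simp add: e_def)
qed

text \<open>Any two minimal generating systems in a single degree differ by constant matrices inverse to each
  other; comparing traces of the two products shows that the systems have equally many elements.\<close>
lemma transition_matrices: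
  assumes \<delta>: "\<And>i. i < n \<Longrightarrow> card (lines i) = 2"
    and mg: "min_gen_by 3 (D0 (cf F)) (tol m 3 g) (card A - 2)"
  shows "m = n \<and> (\<exists>a b. (\<forall>j<n. \<forall>i<3. g j i = (\<Sum>l<n. Cst (a j l) * gen l i)) \<and>
    (\<forall>l<n. \<forall>l'<n. (\<Sum>j<n. b l j * a j l') = (if l = l' then 1 else 0)) \<and>
    (\<forall>j<n. \<forall>j'<n. (\<Sum>l<n. a j l * b l j') = (if j = j' then 1 else 0)))"
proof -
  define r where "r = card A - 2"
  have gd: "gdeg i = r" if "i < n" for i using \<delta>[OF that] by (simp add: gdeg_def r_def)
  have M: "D0 (cf F) = {tov 3 \<theta> | \<theta>. \<exists>h. \<forall>i<3. \<theta> i = (\<Sum>j<m. h j * g j i)}"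
    and hg: "\<And>j i. j < m \<Longrightarrow> i < 3 \<Longrightarrow> hom r (g j i)"
    and min: "\<And>j. j < m \<Longrightarrow> \<not> (\<exists>h. \<forall>i<3. g j i = (\<Sum>l\<in>{..<m} - {j}. h l * g l i))"
    using mg unfolding min_gen_by_tol r_def by blast+
  have conv: "(\<exists>h. \<forall>i<3. \<theta> i = (\<Sum>j<m. h j * g j i)) \<longleftrightarrow> (\<exists>h. \<forall>i<3. \<theta> i = (\<Sum>l<n. h l * gen l i))" for \<theta>
  proof -
    have "tov 3 \<theta> \<in> {tov 3 \<theta> | \<theta>. \<exists>h. \<forall>i<3. \<theta> i = (\<Sum>j<m. h j * g j i)} \<longleftrightarrow>
      tov 3 \<theta> \<in> {tov 3 \<theta> | \<theta>. \<exists>h. \<forall>i<3. \<theta> i = (\<Sum>l<n. h l * gen l i)}"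
      using M D0_F by simp
    moreover have "tov 3 \<theta> \<in> {tov 3 \<theta> | \<theta>. \<exists>h. \<forall>i<3. \<theta> i = (\<Sum>j<m. h j * g j i)} \<longleftrightarrow>
        (\<exists>h. \<forall>i<3. \<theta> i = (\<Sum>j<m. h j * g j i))"
      by (rule tov_mem_iff) simp
    moreover have "tov 3 \<theta> \<in> {tov 3 \<theta> | \<theta>. \<exists>h. \<forall>i<3. \<theta> i = (\<Sum>l<n. h l * gen l i)} \<longleftrightarrow>
        (\<exists>h. \<forall>i<3. \<theta> i = (\<Sum>l<n. h l * gen l i))"
      by (rule tov_mem_iff) simp
    ultimately show ?thesis by (simp only:)
  qed
  \<comment> \<open>Both systems live in the same degree r, so only the constant part of each
    coefficient survives.\<close>
  have "\<exists>a. \<forall>i<3. g j i = (\<Sum>l<n. Cst (a l) * gen l i)" if j: "j < m" for j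
  proof -
    have "\<exists>h. \<forall>i<3. g j i = (\<Sum>l<m. h l * g l i)"
      using j by (intro exI[of _ "\<lambda>l. if l = j then 1 else 0"]) (simp add: if_distrib[of "\<lambda>x. x * _"] cong: if_cong)
    then obtain h where h: "\<And>i. i < 3 \<Longrightarrow> g j i = (\<Sum>l<n. h l * gen l i)" unfolding conv by blast
    have "g j i = (\<Sum>l<n. Cst (cf (hpart 0 (h l)) 0) * gen l i)" if i: "i < 3" for i
    proof -
      have "g j i = (\<Sum>l<n. if gdeg l \<le> r then hpart (r - gdeg l) (h l) * gen l i else 0)"
        by (rule hpart_gen_comb) (fact h hg[OF j] i)+
      also have "\<dots> = (\<Sum>l<n. Cst (cf (hpart 0 (h l)) 0) * gen l i)"
        by (rule sum.cong) (use gd hom_0_iff[of "hpart 0 _"] in auto)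
      finally show ?thesis .
    qed
    then show ?thesis by (intro exI[of _ "\<lambda>l. cf (hpart 0 (h l)) 0"]) blast
  qed
  then obtain a where a: "\<And>j i. j < m \<Longrightarrow> i < 3 \<Longrightarrow> g j i = (\<Sum>l<n. Cst (a j l) * gen l i)"
  proof -
    assume *: "\<And>j. j < m \<Longrightarrow> \<exists>a. \<forall>i<3. g j i = (\<Sum>l<n. Cst (a l) * gen l i)"
    show thesis
      by (rule that[of "\<lambda>j. SOME a. \<forall>i<3. g j i = (\<Sum>l<n. Cst (a l) * gen l i)"])
        (use someI_ex[OF *] in blast)
  qed
  have "\<exists>b. \<forall>i<3. gen l i = (\<Sum>j<m. Cst (b j) * g j i)" if l: "l < n" for l
  proof -
    have "\<exists>h. \<forall>i<3. gen l i = (\<Sum>l'<n. h l' * gen l' i)"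
      using l by (intro exI[of _ "\<lambda>l'. if l' = l then 1 else 0"]) (simp add: if_distrib[of "\<lambda>x. x * _"] cong: if_cong)
    then obtain h where h: "\<And>i. i < 3 \<Longrightarrow> gen l i = (\<Sum>j<m. h j * g j i)" unfolding conv[symmetric] by blast
    have "gen l i = (\<Sum>j<m. Cst (cf (hpart 0 (h j)) 0) * g j i)" if i: "i < 3" for i
    proof -
      have "gen l i = hpart r (gen l i)"
        using hom_gen[OF l, of i] gd[OF l] unfolding gdeg_def by (simp add: hom_eq_hpart)
      also have "\<dots> = (\<Sum>j<m. hpart 0 (h j) * g j i)"
        unfolding h[OF i] hpart_sum by (rule sum.cong) (simp_all add: hpart_mult[OF hg[OF _ i]])
      also have "\<dots> = (\<Sum>j<m. Cst (cf (hpart 0 (h j)) 0) * g j i)"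
        by (rule sum.cong) (use hom_0_iff[of "hpart 0 _"] in auto)
      finally show ?thesis .
    qed
    then show ?thesis by (intro exI[of _ "\<lambda>j. cf (hpart 0 (h j)) 0"]) blast
  qed
  then obtain b where b: "\<And>l i. l < n \<Longrightarrow> i < 3 \<Longrightarrow> gen l i = (\<Sum>j<m. Cst (b l j) * g j i)"
  proof -
    assume *: "\<And>l. l < n \<Longrightarrow> \<exists>b. \<forall>i<3. gen l i = (\<Sum>j<m. Cst (b j) * g j i)"
    show thesis
      by (rule that[of "\<lambda>l. SOME b. \<forall>i<3. gen l i = (\<Sum>j<m. Cst (b j) * g j i)"])
        (use someI_ex[OF *] in blast)
  qed
  \<comment> \<open>The deviation from the identity matrix is a relation of the \<open>gen\<close>
    with constant coefficients, excluded because the q l' are quadrics.\<close>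
  have BA: "(\<Sum>j<m. b l j * a j l') = (if l = l' then 1 else 0)" if l: "l < n" "l' < n" for l l'
  proof -
    define c where "c l' = (\<Sum>j<m. b l j * a j l') - (if l = l' then 1 else 0)" for l'
    have "(\<Sum>l'<n. Cst (c l') * gen l' i) = 0" if i: "i < 3" for i
    proof -
      have "gen l i = (\<Sum>j<m. \<Sum>l'<n. Cst (b l j * a j l') * gen l' i)"
        unfolding b[OF l(1) i] by (rule sum.cong) (simp_all only: a[OF _ i] sum_distrib_left Cst_mult mult.assoc lessThan_iff)
      also have "\<dots> = (\<Sum>l'<n. \<Sum>j<m. Cst (b l j * a j l') * gen l' i)" by (rule sum.swap)
      also have "\<dots> = (\<Sum>l'<n. Cst (\<Sum>j<m. b l j * a j l') * gen l' i)"
        by (simp add: Cst_sum sum_distrib_right)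
      finally have 1: "gen l i = (\<Sum>l'<n. Cst (\<Sum>j<m. b l j * a j l') * gen l' i)" .
      have "(\<Sum>l'<n. Cst (if l = l' then 1 else 0) * gen l' i) = (\<Sum>l'<n. if l = l' then gen l' i else 0)"
        by (rule sum.cong) auto
      also have "\<dots> = gen l i" using l by simp
      finally have 2: "(\<Sum>l'<n. Cst (if l = l' then 1 else 0) * gen l' i) = gen l i" .
      have "(\<Sum>l'<n. Cst (c l') * gen l' i) =
        (\<Sum>l'<n. Cst (\<Sum>j<m. b l j * a j l') * gen l' i) - (\<Sum>l'<n. Cst (if l = l' then 1 else 0) * gen l' i)"
        unfolding c_def Cst_diff left_diff_distrib sum_subtractf ..
      also have "\<dots> = gen l i - gen l i" using 1 2 by (simp only:)
      finally show ?thesis by simp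
    qed
    then have "q l' dvd Cst (c l')" using gen_independent[of "\<lambda>l'. Cst (c l')"] l(2) by blast
    then have "c l' = 0" using const_multiple_q \<delta>[OF l(2)] by blast
    then show ?thesis by (simp add: c_def)
  qed
  \<comment> \<open>Here independence over the constants comes from minimality of g: a nonzero
    constant coefficient could be divided out, making one g j' redundant.\<close>
  have AB: "(\<Sum>l<n. a j l * b l j') = (if j = j' then 1 else 0)" if j: "j < m" "j' < m" for j j'
  proof -
    define c where "c j' = (\<Sum>l<n. a j l * b l j') - (if j = j' then 1 else 0)" for j'
    have s: "(\<Sum>j'<m. Cst (c j') * g j' i) = 0" if i: "i < 3" for i
    proof -
      have "g j i = (\<Sum>l<n. \<Sum>j'<m. Cst (a j l * b l j') * g j' i)"
        unfolding a[OF j(1) i] by (rule sum.cong) (simp_all only: b[OF _ i] sum_distrib_left Cst_mult mult.assoc lessThan_iff)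
      also have "\<dots> = (\<Sum>j'<m. \<Sum>l<n. Cst (a j l * b l j') * g j' i)" by (rule sum.swap)
      also have "\<dots> = (\<Sum>j'<m. Cst (\<Sum>l<n. a j l * b l j') * g j' i)"
        by (simp add: Cst_sum sum_distrib_right)
      finally have 1: "g j i = (\<Sum>j'<m. Cst (\<Sum>l<n. a j l * b l j') * g j' i)" .
      have "(\<Sum>j'<m. Cst (if j = j' then 1 else 0) * g j' i) = (\<Sum>j'<m. if j = j' then g j' i else 0)"
        by (rule sum.cong) auto
      also have "\<dots> = g j i" using j by simp
      finally have 2: "(\<Sum>j'<m. Cst (if j = j' then 1 else 0) * g j' i) = g j i" .
      have "(\<Sum>j'<m. Cst (c j') * g j' i) =
        (\<Sum>j'<m. Cst (\<Sum>l<n. a j l * b l j') * g j' i) - (\<Sum>j'<m. Cst (if j = j' then 1 else 0) * g j' i)"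
        unfolding c_def Cst_diff left_diff_distrib sum_subtractf ..
      also have "\<dots> = g j i - g j i" using 1 2 by (simp only:)
      finally show ?thesis by simp
    qed
    have "c j' = 0"
    proof (rule ccontr)
      assume c: "c j' \<noteq> 0"
      have "g j' i = (\<Sum>l\<in>{..<m} - {j'}. Cst (- c l / c j') * g l i)" if i: "i < 3" for i
      proof -
        have "(\<Sum>l<m. Cst (c l) * g l i) = Cst (c j') * g j' i + (\<Sum>l\<in>{..<m} - {j'}. Cst (c l) * g l i)"
          using j(2) by (intro sum.remove) auto
        then have "Cst (c j') * g j' i = - (\<Sum>l\<in>{..<m} - {j'}. Cst (c l) * g l i)"
          using s[OF i] by (simp add: add_eq_0_iff2)
        then have "Cst (1 / c j') * (Cst (c j') * g j' i) = (\<Sum>l\<in>{..<m} - {j'}. Cst (1 / c j') * (- (Cst (c l) * g l i)))"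
          by (simp add: sum_distrib_left sum_negf)
        also have "\<dots> = (\<Sum>l\<in>{..<m} - {j'}. Cst (- c l / c j') * g l i)"
        proof (rule sum.cong[OF refl])
          fix l
          have "Cst (- c l / c j') = Cst (1 / c j') * - Cst (c l)" by (simp flip: Cst_mult Cst_minus)
          then show "Cst (1 / c j') * (- (Cst (c l) * g l i)) = Cst (- c l / c j') * g l i"
            by (simp only: mult.assoc mult_minus_left mult_minus_right)
        qed
        finally show ?thesis using c by (simp flip: Cst_mult mult.assoc)
      qed
      then have "\<exists>h. \<forall>i<3. g j' i = (\<Sum>l\<in>{..<m} - {j'}. h l * g l i)"
        by (intro exI[of _ "\<lambda>l. Cst (- c l / c j')"] allI impI)
      with min[OF j(2)] show False by (rule notE)
    qed
    then show ?thesis by (simp add: c_def)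
  qed
  have "(of_nat m :: complex) = (\<Sum>j<m. \<Sum>l<n. a j l * b l j)" using AB by simp
  also have "\<dots> = (\<Sum>l<n. \<Sum>j<m. b l j * a j l)" by (subst sum.swap) (simp add: mult.commute)
  also have "\<dots> = of_nat n" using BA by simp
  finally have "m = n" by (simp only: of_nat_eq_iff)
  then show ?thesis using a BA AB by blast
qed

text \<open>The transition matrices identify the syzygies of G with those of \<open>gen\<close>,
  where \<open>relc\<close> supplies n - 2 basic ones. Their entries are combinations of the
  quadrics q l, so such a syzygy has degree 2 + (d - 1) + r; comparison with e_j = d + r - 1 +
  epsilon_j gives epsilon_j = 2.\<close>

theorem min_gen_by_Syz:
  assumes \<delta>: "\<And>i. i < n \<Longrightarrow> card (lines i) = 2"
    and mg: "min_gen_by 3 (D0 (cf F)) G (card A - 2)"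
  shows "\<exists>H. length H = n - 2 \<and> min_gen_by n (Syz G) H 2"
proof -
  obtain g where g: "G = tol (length G) 3 g" using mg by (rule min_gen_by_imp_tol)
  have len: "length G = n" using transition_matrices[OF \<delta>] mg g by metis
  then have G: "G = tol n 3 g" using g by simp
  have "\<exists>a b. (\<forall>j<n. \<forall>i<3. g j i = (\<Sum>l<n. Cst (a j l) * gen l i)) \<and>
    (\<forall>l<n. \<forall>l'<n. (\<Sum>j<n. b l j * a j l') = (if l = l' then 1 else 0)) \<and>
    (\<forall>j<n. \<forall>j'<n. (\<Sum>l<n. a j l * b l j') = (if j = j' then 1 else 0))"
    by (rule transition_matrices[THEN conjunct2]) (fact \<delta>, fact mg[unfolded G])
  then obtain a b where ab: "\<forall>j<n. \<forall>i<3. g j i = (\<Sum>l<n. Cst (a j l) * gen l i)"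
    "\<forall>l<n. \<forall>l'<n. (\<Sum>j<n. b l j * a j l') = (if l = l' then 1 else 0)"
    "\<forall>j<n. \<forall>j'<n. (\<Sum>l<n. a j l * b l j') = (if j = j' then 1 else 0)"
    by (elim exE conjE) (rule that)
  then have a: "\<And>j i. j < n \<Longrightarrow> i < 3 \<Longrightarrow> g j i = (\<Sum>l<n. Cst (a j l) * gen l i)"
    and BA: "\<And>l l'. l < n \<Longrightarrow> l' < n \<Longrightarrow> (\<Sum>j<n. b l j * a j l') = (if l = l' then 1 else 0)"
    and AB: "\<And>j j'. j < n \<Longrightarrow> j' < n \<Longrightarrow> (\<Sum>l<n. a j l * b l j') = (if j = j' then 1 else 0)"
    by simp_all
  \<comment> \<open>The row h times the matrix a, that is, the coefficients of the same combination
    written in terms of \<open>gen\<close>; the matrix b inverts this.\<close>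
  define R where "R h l = (\<Sum>j<n. h j * Cst (a j l))" for h :: "nat \<Rightarrow> mpoly" and l
  have inv1: "h j = (\<Sum>l<n. R h l * Cst (b l j))" if j: "j < n" for h j
  proof -
    have "(\<Sum>l<n. R h l * Cst (b l j)) = (\<Sum>l<n. \<Sum>j'<n. h j' * Cst (a j' l * b l j))"
      by (simp add: R_def sum_distrib_right Cst_mult mult.assoc)
    also have "\<dots> = (\<Sum>j'<n. \<Sum>l<n. h j' * Cst (a j' l * b l j))" by (rule sum.swap)
    also have "\<dots> = (\<Sum>j'<n. h j' * Cst (\<Sum>l<n. a j' l * b l j))"
      by (simp add: Cst_sum sum_distrib_left)
    also have "\<dots> = (\<Sum>j'<n. if j' = j then h j' else 0)"
      by (rule sum.cong) (auto simp: AB j)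
    finally show ?thesis using j by simp
  qed
  have inv2: "R (\<lambda>j. \<Sum>l<n. p l * Cst (b l j)) l = p l" if l: "l < n" for p l
  proof -
    have "R (\<lambda>j. \<Sum>l<n. p l * Cst (b l j)) l = (\<Sum>j<n. \<Sum>l'<n. p l' * Cst (b l' j * a j l))"
      by (simp add: R_def sum_distrib_right Cst_mult mult.assoc)
    also have "\<dots> = (\<Sum>l'<n. \<Sum>j<n. p l' * Cst (b l' j * a j l))" by (rule sum.swap)
    also have "\<dots> = (\<Sum>l'<n. p l' * Cst (\<Sum>j<n. b l' j * a j l))"
      by (simp add: Cst_sum sum_distrib_left)
    also have "\<dots> = (\<Sum>l'<n. if l' = l then p l' else 0)"
      by (rule sum.cong) (auto simp: BA l)
    finally show ?thesis using l by simp
  qed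
  have comb: "(\<Sum>j<n. h j * g j i) = (\<Sum>l<n. R h l * gen l i)" if i: "i < 3" for h i
  proof -
    have "(\<Sum>j<n. h j * g j i) = (\<Sum>j<n. \<Sum>l<n. h j * Cst (a j l) * gen l i)"
      by (rule sum.cong) (simp_all only: a[OF _ i] sum_distrib_left mult.assoc lessThan_iff)
    also have "\<dots> = (\<Sum>l<n. \<Sum>j<n. h j * Cst (a j l) * gen l i)" by (rule sum.swap)
    finally show ?thesis by (simp add: R_def sum_distrib_right)
  qed
  define p where "p t l = q l * Cst (relc t l)" for t l
  \<comment> \<open>The basic syzygies p t of \<open>gen\<close>, transported to G by the inverse
    matrix.\<close>
  define k where "k t j = (\<Sum>l<n. p t l * Cst (b l j))" for t j
  have Rk: "R (\<lambda>j. \<Sum>t\<in>S. w t * k t j) l = q l * (\<Sum>t\<in>S. w t * Cst (relc t l))" if l: "l < n" for S w l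
  proof -
    have "R (\<lambda>j. \<Sum>t\<in>S. w t * k t j) l = R (\<lambda>j. \<Sum>l<n. (\<Sum>t\<in>S. w t * p t l) * Cst (b l j)) l"
    proof -
      have "(\<Sum>t\<in>S. w t * k t j) = (\<Sum>l<n. (\<Sum>t\<in>S. w t * p t l) * Cst (b l j))" for j
      proof -
        have "(\<Sum>t\<in>S. w t * k t j) = (\<Sum>t\<in>S. \<Sum>l<n. w t * p t l * Cst (b l j))"
          by (simp add: k_def sum_distrib_left mult.assoc)
        also have "\<dots> = (\<Sum>l<n. \<Sum>t\<in>S. w t * p t l * Cst (b l j))" by (rule sum.swap)
        finally show ?thesis by (simp add: sum_distrib_right)
      qed
      then show ?thesis by simp
    qed
    also have "\<dots> = (\<Sum>t\<in>S. w t * p t l)" by (rule inv2[OF l])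
    finally show ?thesis by (simp add: p_def sum_distrib_left mult.left_commute)
  qed
  have syz: "(\<forall>i<3. (\<Sum>j<n. h j * g j i) = 0) \<longleftrightarrow> (\<exists>w. \<forall>j<n. h j = (\<Sum>t<n - 2. w t * k t j))" for h
  proof
    assume "\<forall>i<3. (\<Sum>j<n. h j * g j i) = 0"
    then have "\<forall>i<3. (\<Sum>l<n. R h l * gen l i) = 0" using comb by simp
    then obtain c where c: "\<And>l. l < n \<Longrightarrow> R h l = q l * c l"
      "(\<Sum>l<n. c l * Cst (xc l)) = 0" "(\<Sum>l<n. c l * Cst (yc l)) = 0"
      unfolding gen_syzygies by blast
    have "h j = (\<Sum>t<n - 2. c (t + 2) * k t j)" if j: "j < n" for j
    proof -
      have "h j = (\<Sum>l<n. \<Sum>t<n - 2. c (t + 2) * (p t l * Cst (b l j)))"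
        unfolding inv1[OF j, of h]
      proof (rule sum.cong[OF refl])
        fix l assume "l \<in> {..<n}"
        then have l: "l < n" by simp
        have "R h l = q l * (\<Sum>t<n - 2. c (t + 2) * Cst (relc t l))"
          using c(1)[OF l] relation_expand[OF c(2,3) l] by simp
        then show "R h l * Cst (b l j) = (\<Sum>t<n - 2. c (t + 2) * (p t l * Cst (b l j)))"
          by (simp add: p_def sum_distrib_left sum_distrib_right algebra_simps)
      qed
      also have "\<dots> = (\<Sum>t<n - 2. \<Sum>l<n. c (t + 2) * (p t l * Cst (b l j)))" by (rule sum.swap)
      finally show ?thesis by (simp add: k_def sum_distrib_left)
    qed
    then show "\<exists>w. \<forall>j<n. h j = (\<Sum>t<n - 2. w t * k t j)" by (intro exI[of _ "\<lambda>t. c (t + 2)"]) blast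
  next
    assume "\<exists>w. \<forall>j<n. h j = (\<Sum>t<n - 2. w t * k t j)"
    then obtain w where w: "\<And>j. j < n \<Longrightarrow> h j = (\<Sum>t<n - 2. w t * k t j)" by blast
    have Rc: "R h l = q l * (\<Sum>t<n - 2. w t * Cst (relc t l))" if "l < n" for l
    proof -
      have "R h l = R (\<lambda>j. \<Sum>t<n - 2. w t * k t j) l" unfolding R_def by (rule sum.cong) (auto simp: w)
      then show ?thesis using Rk[OF that] by simp
    qed
    have "\<forall>i<3. (\<Sum>l<n. R h l * gen l i) = 0"
      unfolding gen_syzygies
      by (rule exI[of _ "\<lambda>l. \<Sum>t<n - 2. w t * Cst (relc t l)"])
        (intro conjI allI impI Rc relc_comb_relation[of _ w] refl)
    then show "\<forall>i<3. (\<Sum>j<n. h j * g j i) = 0" using comb by simp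
  qed
  have "min_gen_by n (Syz G) (tol (n - 2) n k) 2"
    unfolding min_gen_by_tol
  proof (intro conjI allI impI)
    show "Syz G = {tov n \<theta> | \<theta>. \<exists>h. \<forall>j<n. \<theta> j = (\<Sum>t<n - 2. h t * k t j)}"
      unfolding G Syz_tol syz ..
    show "hom 2 (k t j)" for t j
      unfolding k_def
    proof (rule hom_sum)
      fix l assume l: "l \<in> {..<n}"
      then have "hom 2 (q l)" using hom_q[of l] \<delta>[of l] by simp
      then have "hom 2 (Cst (relc t l * b l j) * q l)" by (rule hom_Cst_mult)
      then show "hom 2 (p t l * Cst (b l j))" by (simp add: p_def Cst_mult mult_ac)
    qed
    fix t assume t: "t < n - 2"
    show "\<not> (\<exists>h. \<forall>j<n. k t j = (\<Sum>t'\<in>{..<n - 2} - {t}. h t' * k t' j))"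
    proof
      assume "\<exists>h. \<forall>j<n. k t j = (\<Sum>t'\<in>{..<n - 2} - {t}. h t' * k t' j)"
      then obtain h where h: "\<And>j. j < n \<Longrightarrow> k t j = (\<Sum>t'\<in>{..<n - 2} - {t}. h t' * k t' j)" by blast
      have l: "t + 2 < n" using t by simp
      \<comment> \<open>At index t + 2 only the t-th relation has a nonzero entry, so expressing it
        by the others would force q (t + 2) = 0.\<close>
      have "R (\<lambda>j. \<Sum>t'\<in>{t}. 1 * k t' j) (t + 2) = R (\<lambda>j. \<Sum>t'\<in>{..<n - 2} - {t}. h t' * k t' j) (t + 2)"
        unfolding R_def by (rule sum.cong) (auto simp: h)
      also have "\<dots> = 0" unfolding Rk[OF l] by (simp add: relc_def)
      finally have "q (t + 2) = 0" unfolding Rk[OF l] by (simp add: relc_def)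
      then show False using q_nz[OF l] by simp
    qed
  qed
  then show ?thesis by (intro exI[of _ "tol (n - 2) n k"]) simp
qed

end

section \<open>Incidences\<close>

lemma ppoint_eq_iff: "ppoint u = ppoint v \<longleftrightarrow> prop_eq u v"
proof
  assume "ppoint u = ppoint v"
  moreover have "u \<in> ppoint u" unfolding ppoint_def
    by (cases u) (auto simp: smul3_def intro!: exI[of _ 1])
  ultimately show "prop_eq u v" unfolding ppoint_def prop_eq_def by auto
next
  assume uv: "prop_eq u v"
  have sub: "ppoint u \<subseteq> ppoint v" if "prop_eq u v" for u v
  proof
    fix w assume "w \<in> ppoint u"
    then have "prop_eq w u" unfolding ppoint_def prop_eq_def by blast
    then have "prop_eq w v" using that by (rule prop_eq_trans)
    then show "w \<in> ppoint v" unfolding ppoint_def prop_eq_def by blast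
  qed
  show "ppoint u = ppoint v" using sub[OF uv] sub[OF prop_eq_sym[OF uv]] by blast
qed

lemma dot_prop_eq: "prop_eq u v \<Longrightarrow> dot l u = 0 \<longleftrightarrow> dot l v = 0"
  unfolding prop_eq_def by (auto simp: dot_smul3)

lemma meet_iff:
  assumes "l \<noteq> (0,0,0)" "l' \<noteq> (0,0,0)" "\<not> prop_eq l l'" "p \<noteq> (0,0,0)"
  shows "dot l p = 0 \<and> dot l' p = 0 \<longleftrightarrow> ppoint (cross l l') = ppoint p"
proof
  have c: "cross l l' \<noteq> (0,0,0)" using assms prop_eq_iff_cross by blast
  show "ppoint (cross l l') = ppoint p" if "dot l p = 0 \<and> dot l' p = 0"
    using cross_nonzero_prop[OF _ _ assms(4) c] that prop_eq_sym unfolding ppoint_eq_iff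
    by (metis dot_commute)
  show "dot l p = 0 \<and> dot l' p = 0" if "ppoint (cross l l') = ppoint p"
    using that dot_prop_eq dot_cross unfolding ppoint_eq_iff by blast
qed

lemma mult_distinct: "distinct xs \<Longrightarrow> mult xs p = card {l \<in> set xs. dot l p = 0}"
proof -
  assume d: "distinct xs"
  have "bij_betw (\<lambda>i. xs ! i) {i. i < length xs \<and> on_line (xs ! i) p} {l \<in> set xs. dot l p = 0}"
    unfolding bij_betw_def
  proof
    show "inj_on ((!) xs) {i. i < length xs \<and> on_line (xs ! i) p}"
      using d by (auto simp: inj_on_def nth_eq_iff_index_eq)
    show "(!) xs ` {i. i < length xs \<and> on_line (xs ! i) p} = {l \<in> set xs. dot l p = 0}"
      unfolding on_line_iff set_conv_nth by blast
  qed
  then show ?thesis unfolding mult_def by (rule bij_betw_same_card)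
qed

lemma card_offdiag: "finite S \<Longrightarrow> card {(a, b). a \<in> S \<and> b \<in> S \<and> a \<noteq> b} = card S * card S - card S"
proof -
  assume f: "finite S"
  have "{(a, b). a \<in> S \<and> b \<in> S \<and> a \<noteq> b} = S \<times> S - (\<lambda>a. (a, a)) ` S" by auto
  moreover have "card ((\<lambda>a. (a, a)) ` S) = card S" by (rule card_image) (auto intro: inj_onI)
  moreover have "(\<lambda>a. (a, a)) ` S \<subseteq> S \<times> S" by auto
  ultimately show ?thesis using f by (simp add: card_Diff_subset card_cartesian_product)
qed

definition points_of_mult :: "vec3 set \<Rightarrow> nat \<Rightarrow> vec3 set set" where
  "points_of_mult B k = {ppoint p | p. p \<noteq> (0,0,0) \<and> card {l \<in> B. dot l p = 0} = k}"

text \<open>Count ordered pairs of distinct lines by their intersection point.\<close>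
lemma pair_count:
  assumes fin: "finite B" and B0: "\<And>l. l \<in> B \<Longrightarrow> l \<noteq> (0,0,0)"
    and Bp: "\<And>l l'. l \<in> B \<Longrightarrow> l' \<in> B \<Longrightarrow> l \<noteq> l' \<Longrightarrow> \<not> prop_eq l l'"
    and B3: "\<And>p. p \<noteq> (0,0,0) \<Longrightarrow> card {l \<in> B. dot l p = 0} \<le> 3"
  shows "card B * card B - card B = 2 * card (points_of_mult B 2) + 6 * card (points_of_mult B 3)"
proof -
  define T where "T = {(a, b). a \<in> B \<and> b \<in> B \<and> a \<noteq> b}"
  define \<psi> where "\<psi> t = ppoint (cross (fst t) (snd t))" for t
  have finT: "finite T" by (rule finite_subset[of _ "B \<times> B"]) (auto simp: T_def fin)
  \<comment> \<open>Pairs meeting at p are ordered pairs of distinct lines through p, so double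
    points have weight 2 and triple points weight 6.\<close>
  have fib: "card {t \<in> T. \<psi> t = ppoint p} = k * k - k"
    if "p \<noteq> (0,0,0)" "card {l \<in> B. dot l p = 0} = k" for p k
  proof -
    have "{t \<in> T. \<psi> t = ppoint p} =
        {(a, b). a \<in> {l \<in> B. dot l p = 0} \<and> b \<in> {l \<in> B. dot l p = 0} \<and> a \<noteq> b}"
    proof (rule set_eqI)
      fix t :: "vec3 \<times> vec3"
      obtain a b where t: "t = (a, b)" by (cases t)
      have "dot a p = 0 \<and> dot b p = 0 \<longleftrightarrow> ppoint (cross a b) = ppoint p" if "a \<in> B" "b \<in> B" "a \<noteq> b"
        using meet_iff[OF B0[OF that(1)] B0[OF that(2)] Bp[OF that] \<open>p \<noteq> (0,0,0)\<close>] .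
      then show "t \<in> {t \<in> T. \<psi> t = ppoint p} \<longleftrightarrow>
          t \<in> {(a, b). a \<in> {l \<in> B. dot l p = 0} \<and> b \<in> {l \<in> B. dot l p = 0} \<and> a \<noteq> b}"
        unfolding T_def \<psi>_def t by (cases "a \<in> B \<and> b \<in> B \<and> a \<noteq> b") auto
    qed
    then show ?thesis using card_offdiag[of "{l \<in> B. dot l p = 0}"] fin that(2) by simp
  qed
  have im: "\<psi> ` T = points_of_mult B 2 \<union> points_of_mult B 3"
  proof
    show "\<psi> ` T \<subseteq> points_of_mult B 2 \<union> points_of_mult B 3"
    proof
      fix c assume "c \<in> \<psi> ` T"
      then obtain t where t: "t \<in> T" "c = \<psi> t" by blast
      obtain a b where tab: "t = (a, b)" by (cases t)
      have ab: "a \<in> B" "b \<in> B" "a \<noteq> b" "c = ppoint (cross a b)"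
        using t unfolding T_def \<psi>_def tab by simp_all
      define p where "p = cross a b"
      have p: "p \<noteq> (0,0,0)" unfolding p_def using prop_eq_iff_cross B0 Bp ab by blast
      have "{a, b} \<subseteq> {l \<in> B. dot l p = 0}" using ab dot_cross by (auto simp: p_def)
      then have "card {a, b} \<le> card {l \<in> B. dot l p = 0}" using fin by (intro card_mono) auto
      then have "card {l \<in> B. dot l p = 0} = 2 \<or> card {l \<in> B. dot l p = 0} = 3"
        using B3[OF p] ab(3) by simp linarith
      then show "c \<in> points_of_mult B 2 \<union> points_of_mult B 3"
        using p ab(4) unfolding points_of_mult_def p_def[symmetric] by blast
    qed
    show "points_of_mult B 2 \<union> points_of_mult B 3 \<subseteq> \<psi> ` T"
    proof
      fix c assume "c \<in> points_of_mult B 2 \<union> points_of_mult B 3"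
      then obtain p k where p: "c = ppoint p" "p \<noteq> (0,0,0)" "card {l \<in> B. dot l p = 0} = k" "k = 2 \<or> k = 3"
        unfolding points_of_mult_def by blast
      then have "card {t \<in> T. \<psi> t = c} \<noteq> 0" using fib by auto
      then have "{t \<in> T. \<psi> t = c} \<noteq> {}" by (metis card.empty)
      then show "c \<in> \<psi> ` T" by blast
    qed
  qed
  \<comment> \<open>A projective point may be represented by several p, so its multiplicity is
    recovered from the size of its fibre: 2 in one case, 6 in the other.\<close>
  have disj: "points_of_mult B 2 \<inter> points_of_mult B 3 = {}"
  proof -
    have fc: "card {t \<in> T. \<psi> t = c} = k * k - k" if ck: "c \<in> points_of_mult B k" for c k
    proof -
      obtain p where "c = ppoint p" "p \<noteq> (0,0,0)" "card {l \<in> B. dot l p = 0} = k"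
        using ck unfolding points_of_mult_def by blast
      then show ?thesis using fib by simp
    qed
    have False if "c \<in> points_of_mult B 2" "c \<in> points_of_mult B 3" for c
      using fc[OF that(1)] fc[OF that(2)] by simp
    then show ?thesis by blast
  qed
  have finI: "finite (points_of_mult B 2)" "finite (points_of_mult B 3)"
    using finite_imageI[OF finT, of \<psi>] unfolding im by simp_all
  have "card T = (\<Sum>c\<in>\<psi> ` T. card {t \<in> T. \<psi> t = c})"
    unfolding card_eq_sum by (rule sum.image_gen[OF finT])
  also have "\<dots> = (\<Sum>c\<in>points_of_mult B 2. card {t \<in> T. \<psi> t = c}) + (\<Sum>c\<in>points_of_mult B 3. card {t \<in> T. \<psi> t = c})"
    unfolding im by (rule sum.union_disjoint[OF finI disj])
  also have "(\<Sum>c\<in>points_of_mult B 2. card {t \<in> T. \<psi> t = c}) = (\<Sum>c\<in>points_of_mult B 2. 2)"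
    by (rule sum.cong) (auto simp: points_of_mult_def fib)
  also have "(\<Sum>c\<in>points_of_mult B 3. card {t \<in> T. \<psi> t = c}) = (\<Sum>c\<in>points_of_mult B 3. 6)"
    by (rule sum.cong) (auto simp: points_of_mult_def fib)
  finally have "card T = 2 * card (points_of_mult B 2) + 6 * card (points_of_mult B 3)" by simp
  moreover have "card T = card B * card B - card B" unfolding T_def by (rule card_offdiag[OF fin])
  ultimately show ?thesis by simp
qed

text \<open>A double point on L lies on some line l of A, and l meets L in only one point, which is
  one of the v i.\<close>

lemma (in pencil_arrangement) count_double:
  "card {i. i < n \<and> card (lines i) = 2} =
    card {ppoint p | p. p \<noteq> (0,0,0) \<and> card {l \<in> A. dot l p = 0} = 2 \<and> dot L p = 0}"
proof (rule bij_betw_same_card[of "\<lambda>i. ppoint (v i)"], unfold bij_betw_def, intro conjI)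
  show "inj_on (\<lambda>i. ppoint (v i)) {i. i < n \<and> card (lines i) = 2}"
    by (rule inj_onI) (use v_prop ppoint_eq_iff in blast)
  show "(\<lambda>i. ppoint (v i)) ` {i. i < n \<and> card (lines i) = 2} =
    {ppoint p | p. p \<noteq> (0,0,0) \<and> card {l \<in> A. dot l p = 0} = 2 \<and> dot L p = 0}" (is "_ = ?R")
  proof
    show "(\<lambda>i. ppoint (v i)) ` {i. i < n \<and> card (lines i) = 2} \<subseteq> ?R"
      using v0 Lv unfolding lines_def by blast
    show "?R \<subseteq> (\<lambda>i. ppoint (v i)) ` {i. i < n \<and> card (lines i) = 2}"
    proof
      fix c assume "c \<in> ?R"
      then obtain p where p: "c = ppoint p" "p \<noteq> (0,0,0)" "card {l \<in> A. dot l p = 0} = 2" "dot L p = 0"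
        by blast
      have "{l \<in> A. dot l p = 0} \<noteq> {}" using p(3) by (metis card.empty zero_neq_numeral)
      then obtain l where l: "l \<in> A" "dot l p = 0" by blast
      obtain i where i: "i < n" "dot l (v i) = 0" using A_v[OF l(1)] by blast
      have "ppoint p = ppoint (cross L l)" "ppoint (v i) = ppoint (cross L l)"
        using meet_iff[OF L0 A0[OF l(1)] L_prop[OF l(1)]] p(2,4) l(2) v0[OF i(1)] Lv[OF i(1)] i(2)
        by metis+
      then have e: "ppoint p = ppoint (v i)" by simp
      then have "lines i = {l \<in> A. dot l p = 0}"
        unfolding lines_def using dot_prop_eq ppoint_eq_iff by blast
      then show "c \<in> (\<lambda>i. ppoint (v i)) ` {i. i < n \<and> card (lines i) = 2}"
        using e i(1) p(1,3) by auto
    qed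
  qed
qed

lemma other_point_on_line:
  assumes "L \<noteq> (0,0,0)" "p \<noteq> (0,0,0)" "dot L p = 0"
  obtains u where "u \<noteq> (0,0,0)" "dot L u = 0" "\<not> prop_eq u p"
proof -
  obtain w where w: "dot p w = 1" using dot_eq_1[OF assms(2)] by blast
  have w0: "w \<noteq> (0,0,0)"
  proof
    assume "w = (0,0,0)"
    then show False using w dot_commute[of p w] by simp
  qed
  \<comment> \<open>Pairing with p is 0 on L but 1 on w. Likewise pairing with w is 0 on
    \<open>cross L w\<close> but 1 on p, so this new point of L differs from p.\<close>
  have "\<not> prop_eq L w"
    using dot_prop_eq[of L w p] assms(3) w by (auto simp: dot_commute)
  then have c: "cross L w \<noteq> (0,0,0)" using prop_eq_iff_cross assms(1) w0 by blast
  have "\<not> prop_eq (cross L w) p"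
    using dot_prop_eq[of "cross L w" p w] dot_cross(2) w by (auto simp: dot_commute)
  then show ?thesis using that c dot_cross by blast
qed

text \<open>If all lines of A meet L in one point, a second point of L lying on no line of A is added,
  so that the points always determine L.\<close>
lemma exists_pencil_arrangement:
  assumes fin: "finite A" and ne: "A \<noteq> {}" and L0: "L \<noteq> (0,0,0)"
    and A0: "\<And>l. l \<in> A \<Longrightarrow> l \<noteq> (0,0,0)"
    and A_prop: "\<And>l l'. l \<in> A \<Longrightarrow> l' \<in> A \<Longrightarrow> l \<noteq> l' \<Longrightarrow> \<not> prop_eq l l'"
    and L_prop: "\<And>l. l \<in> A \<Longrightarrow> \<not> prop_eq L l"
    and nodal: "\<And>p. p \<noteq> (0,0,0) \<Longrightarrow> card {l \<in> A. dot l p = 0} \<le> 2"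
  shows "\<exists>v n. pencil_arrangement A L v n \<and> (3 \<le> card A \<longrightarrow> (\<forall>i<n. {l \<in> A. dot l (v i) = 0} \<noteq> {}))"
proof -
  have nod3: False if "l \<in> A" "l' \<in> A" "l'' \<in> A" "l \<noteq> l'" "l \<noteq> l''" "l' \<noteq> l''"
    "p \<noteq> (0,0,0)" "dot l p = 0" "dot l' p = 0" "dot l'' p = 0" for l l' l'' p
  proof -
    have "card {l, l', l''} \<le> card {l \<in> A. dot l p = 0}" using that fin by (intro card_mono) auto
    then show False using nodal[OF that(7)] that(4-6) by simp
  qed
  define P where "P = (\<lambda>l. ppoint (cross L l)) ` A"
  have finP: "finite P" unfolding P_def using fin by simp
  obtain f where f: "bij_betw f {0..<card P} P" using ex_bij_betw_nat_finite[OF finP] by blast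
  have "\<exists>w. \<forall>i<card P. w i \<noteq> (0,0,0) \<and> dot L (w i) = 0 \<and> ppoint (w i) = f i \<and> {l \<in> A. dot l (w i) = 0} \<noteq> {}"
  proof -
    have "\<exists>u. u \<noteq> (0,0,0) \<and> dot L u = 0 \<and> ppoint u = f i \<and> {l \<in> A. dot l u = 0} \<noteq> {}" if "i < card P" for i
    proof -
      have "f i \<in> P" using f that by (auto simp: bij_betw_def)
      then obtain l where l: "l \<in> A" "f i = ppoint (cross L l)" unfolding P_def by blast
      have "cross L l \<noteq> (0,0,0)" using prop_eq_iff_cross L0 A0 L_prop l(1) by blast
      moreover have "l \<in> {l' \<in> A. dot l' (cross L l) = 0}" using l(1) dot_cross by blast
      ultimately show ?thesis using l(2) dot_cross(1)[of L l] by (intro exI[of _ "cross L l"]) blast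
    qed
    then obtain w where "\<And>i. i < card P \<Longrightarrow> w i \<noteq> (0,0,0) \<and> dot L (w i) = 0 \<and> ppoint (w i) = f i \<and> {l \<in> A. dot l (w i) = 0} \<noteq> {}"
    proof -
      assume *: "\<And>i. i < card P \<Longrightarrow> \<exists>u. u \<noteq> (0,0,0) \<and> dot L u = 0 \<and> ppoint u = f i \<and> {l \<in> A. dot l u = 0} \<noteq> {}"
      show thesis
        by (rule that[of "\<lambda>i. SOME u. u \<noteq> (0,0,0) \<and> dot L u = 0 \<and> ppoint u = f i \<and> {l \<in> A. dot l u = 0} \<noteq> {}"])
          (rule someI_ex[OF *])
    qed
    then show ?thesis by blast
  qed
  then obtain w where w: "\<And>i. i < card P \<Longrightarrow> w i \<noteq> (0,0,0)" "\<And>i. i < card P \<Longrightarrow> dot L (w i) = 0"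
    "\<And>i. i < card P \<Longrightarrow> ppoint (w i) = f i" "\<And>i. i < card P \<Longrightarrow> {l \<in> A. dot l (w i) = 0} \<noteq> {}" by blast
  have wp: "\<not> prop_eq (w i) (w j)" if "i < card P" "j < card P" "i \<noteq> j" for i j
  proof -
    have "f i \<noteq> f j" using f that by (auto simp: bij_betw_def inj_on_def)
    then show ?thesis using w(3) that ppoint_eq_iff by metis
  qed
  have Aw: "\<exists>i<card P. dot l (w i) = 0" if l: "l \<in> A" for l
  proof -
    have "ppoint (cross L l) \<in> f ` {0..<card P}" using f l by (auto simp: bij_betw_def P_def)
    then obtain i where i: "i < card P" "f i = ppoint (cross L l)" by auto
    then show ?thesis using meet_iff[OF L0 A0[OF l] L_prop[OF l] w(1)[OF i(1)]] w(3) by metis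
  qed
  have P0: "card P \<noteq> 0" using ne finP unfolding P_def by simp
  show ?thesis
  proof (cases "2 \<le> card P")
    case True
    have "pencil_arrangement A L w (card P)"
      by unfold_locales (fact fin True L0 | rule A0 A_prop L_prop w wp Aw nod3, assumption+)+
    then show ?thesis using w(4) by blast
  next
    case False
    then have P1: "card P = 1" using P0 by linarith
    obtain u where u: "u \<noteq> (0,0,0)" "dot L u = 0" "\<not> prop_eq u (w 0)"
      using other_point_on_line[OF L0 w(1,2)[of 0]] P1 by auto
    define v where "v i = (if i = 0 then w 0 else u)" for i :: nat
    have c2: "i = 0 \<or> i = 1" if "i < 2" for i :: nat using that by auto
    have "pencil_arrangement A L v 2"
    proof
      show "v i \<noteq> (0,0,0)" "dot L (v i) = 0" if "i < 2" for i using u w(1,2) P1 by (auto simp: v_def)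
      show "\<not> prop_eq (v i) (v j)" if "i < 2" "j < 2" "i \<noteq> j" for i j
        using c2[OF that(1)] c2[OF that(2)] that(3) u(3) prop_eq_sym[of "w 0" u] by (auto simp: v_def)
      show "\<exists>i<2. dot l (v i) = 0" if "l \<in> A" for l
        using Aw[OF that] P1 by (intro exI[of _ 0]) (simp add: v_def)
    qed (fact fin L0 order.refl | rule A0 A_prop L_prop nod3, assumption+)+
    moreover have "\<not> 3 \<le> card A"
    proof -
      have "A = {l \<in> A. dot l (w 0) = 0}" using Aw P1 by auto
      then show ?thesis using nodal[OF w(1), of 0] P1 by simp
    qed
    ultimately show ?thesis by blast
  qed
qed

section \<open>The theorem for arrangements given as lists of lines\<close>

theorem theorem6p2:
  fixes ls :: "vec3 list" and L :: vec3 and s d' d :: nat and f :: poly3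
  assumes arr: "line_arrangement ls"
    and d'_def: "d' = length ls" and d'_ge: "d' \<ge> 2"
    and nod: "nodal ls"
    and L_nz: "L \<noteq> (0,0,0)"
    and L_new: "\<forall>l\<in>set ls. \<not> prop_eq L l"
    and s_def: "s = card {ppoint v | v. v \<noteq> (0,0,0) \<and> mult ls v = 2 \<and> on_line L v}"
    and s_ge: "s \<ge> 1"
    and f_def: "f = arr_poly (ls @ [L])"
    and d_def: "d = d' + 1"
  shows
    "(\<forall>v. v \<noteq> (0,0,0) \<longrightarrow> mult (ls @ [L]) v \<le> 3)
     \<and> int (npts (ls @ [L]) 2) = int (d choose 2) - 3 * int s
     \<and> npts (ls @ [L]) 3 = s
     \<and> 2 * s \<le> d'
     \<and> tjurina f = (d choose 2) + s
     \<and> mdr f = d - 3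
     \<and> (\<forall>k::nat. d' = 2 * k \<longrightarrow> k \<ge> 2 \<longrightarrow> s = k \<longrightarrow>
          curve_type f (2 * k + 1) (2 * k - 2) k
          \<and> (2 * (int (2 * k) - 2) - int (2 * k + 1) + 3) - int k = int k - 2
          \<and> (\<forall>G. min_gen_by 3 (D0 f) G (2 * k - 2) \<longrightarrow>
                 (\<exists>H. length H = k - 2 \<and> min_gen_by k (Syz G) H 2)))"
proof -
  define A where "A = set ls"
  have dist: "distinct ls"
    using arr prop_eq_refl unfolding line_arrangement_def distinct_conv_nth by metis
  have fin: "finite A" by (simp add: A_def)
  have A0: "l \<noteq> (0,0,0)" if "l \<in> A" for l using arr that by (auto simp: line_arrangement_def A_def)
  have A_prop: "\<not> prop_eq l l'" if "l \<in> A" "l' \<in> A" "l \<noteq> l'" for l l'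
    using arr that unfolding line_arrangement_def A_def in_set_conv_nth by metis
  have L_prop: "\<not> prop_eq L l" if "l \<in> A" for l using L_new that by (simp add: A_def)
  have LA: "L \<notin> A" using L_prop prop_eq_refl by blast
  have cA: "card A = d'" unfolding A_def d'_def by (rule distinct_card[OF dist])
  have distL: "distinct (ls @ [L])" using dist LA by (simp add: A_def)
  have multA: "mult ls p = card {l \<in> A. dot l p = 0}" for p
    unfolding A_def by (rule mult_distinct[OF dist])
  have multB: "mult (ls @ [L]) p = card {l \<in> insert L A. dot l p = 0}" for p
    using mult_distinct[OF distL, of p] by (simp add: A_def)
  have nodal2: "card {l \<in> A. dot l p = 0} \<le> 2" if "p \<noteq> (0,0,0)" for p
    using nod that unfolding nodal_def multA by blast
  have cB: "card {l \<in> insert L A. dot l p = 0} = card {l \<in> A. dot l p = 0} + (if dot L p = 0 then 1 else 0)" for p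
  proof (cases "dot L p = 0")
    case True
    then have "{l \<in> insert L A. dot l p = 0} = insert L {l \<in> A. dot l p = 0}" by auto
    then show ?thesis using True LA fin by simp
  next
    case False
    then have "{l \<in> insert L A. dot l p = 0} = {l \<in> A. dot l p = 0}" by auto
    then show ?thesis using False by simp
  qed
  have B3: "card {l \<in> insert L A. dot l p = 0} \<le> 3" if "p \<noteq> (0,0,0)" for p
    using nodal2[OF that] unfolding cB by simp
  have n: "npts (ls @ [L]) k = card (points_of_mult (insert L A) k)" for k
    unfolding npts_def points_of_mult_def multB ..
  have s_eq: "s = card {ppoint p | p. p \<noteq> (0,0,0) \<and> card {l \<in> A. dot l p = 0} = 2 \<and> dot L p = 0}"
    unfolding s_def multA on_line_iff ..
  have "points_of_mult (insert L A) 3 =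
      {ppoint p | p. p \<noteq> (0,0,0) \<and> card {l \<in> A. dot l p = 0} = 2 \<and> dot L p = 0}"
  proof -
    have "card {l \<in> insert L A. dot l p = 0} = 3 \<longleftrightarrow> card {l \<in> A. dot l p = 0} = 2 \<and> dot L p = 0"
      if "p \<noteq> (0,0,0)" for p using nodal2[OF that] unfolding cB by auto
    then show ?thesis unfolding points_of_mult_def by blast
  qed
  then have n3: "npts (ls @ [L]) 3 = s" unfolding n s_eq by simp
  \<comment> \<open>Triple points are now known to be the double points of A on L, so counting pairs
    of lines determines the number of double points.\<close>
  have "card (insert L A) * card (insert L A) - card (insert L A) =
      2 * card (points_of_mult (insert L A) 2) + 6 * card (points_of_mult (insert L A) 3)"
  proof (rule pair_count)
    show "finite (insert L A)" using fin by simp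
    show "l \<noteq> (0,0,0)" if "l \<in> insert L A" for l using that L_nz A0 by auto
    show "\<not> prop_eq l l'" if "l \<in> insert L A" "l' \<in> insert L A" "l \<noteq> l'" for l l'
      using that A_prop L_prop prop_eq_sym by blast
  qed (rule B3)
  then have "d * d - d = 2 * npts (ls @ [L]) 2 + 6 * s"
    using cA LA fin n3 unfolding n d_def by simp
  moreover have "d * d - d = 2 * (d choose 2)"
    unfolding choose_two by (simp add: diff_mult_distrib2)
  ultimately have npts2: "int (npts (ls @ [L]) 2) = int (d choose 2) - 3 * int s" by linarith
  have ne: "A \<noteq> {}" using cA d'_ge by auto
  obtain v n where pa: "pencil_arrangement A L v n"
    and ne3: "3 \<le> card A \<longrightarrow> (\<forall>i<n. {l \<in> A. dot l (v i) = 0} \<noteq> {})"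
    using exists_pencil_arrangement[OF fin ne L_nz A0 A_prop L_prop nodal2] by blast
  interpret pencil_arrangement A L v n by (rule pa)
  have "F = prod_list (map LF (ls @ [L]))"
    using prod.distinct_set_conv_list[OF distL, of LF] unfolding F_def unfolding A_def by simp
  with cf_prod_list_LF[of "ls @ [L]"] have f: "f = cf F" unfolding f_def by (simp only:)
  have \<delta>: "card (lines i) \<le> 2" if "i < n" for i
    unfolding lines_def using nodal2 v0[OF that] .
  define I where "I = {i. i < n \<and> card (lines i) = 2}"
  have finI: "finite I" and In: "I \<subseteq> {..<n}" by (auto simp: I_def)
  have sI: "s = card I" unfolding s_eq I_def count_double ..
  \<comment> \<open>Each line of A meets L in exactly one v i, and each of the s double points uses
    two lines. Hence 2s is at most d', and equality leaves no line for the other indices.\<close>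
  have sum: "d' = 2 * s + (\<Sum>i\<in>{..<n} - I. card (lines i))"
  proof -
    have "d' = (\<Sum>i\<in>{..<n} - I. card (lines i)) + (\<Sum>i\<in>I. card (lines i))"
      unfolding cA[symmetric] card_A by (rule sum.subset_diff[OF In]) simp
    also have "(\<Sum>i\<in>I. card (lines i)) = (\<Sum>i\<in>I. 2)" by (rule sum.cong) (auto simp: I_def)
    finally show ?thesis unfolding sI by simp
  qed
  have "tjurina f = (Suc (card A) choose 2) + card I"
    unfolding f I_def by (rule tjurina_F) (rule \<delta>)
  then have tj: "tjurina f = (d choose 2) + s" unfolding cA d_def sI by simp
  have "I \<noteq> {}" using s_ge sI by auto
  then obtain i where i: "i < n" "card (lines i) = 2" unfolding I_def by blast
  have "mdr f = card A - 2" unfolding f by (rule mdr_F[OF _ i]) (rule \<delta>)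
  then have md: "mdr f = d - 3" by (simp add: cA d_def)
  have part2: "curve_type f (2 * k + 1) (2 * k - 2) k
      \<and> (2 * (int (2 * k) - 2) - int (2 * k + 1) + 3) - int k = int k - 2
      \<and> (\<forall>G. min_gen_by 3 (D0 f) G (2 * k - 2) \<longrightarrow>
            (\<exists>H. length H = k - 2 \<and> min_gen_by k (Syz G) H 2))"
    if k: "d' = 2 * k" "2 \<le> k" "s = k" for k
  proof -
    have "card (lines i) = 0" if "i \<in> {..<n} - I" for i
      using sum k that by (simp add: sum_eq_0_iff)
    \<comment> \<open>There are at least four lines, so no auxiliary point was added and every v i
      carries a line. Together with the equality d' = 2s this makes every q i a quadric and n =
      k.\<close>
    moreover have "card (lines i) \<noteq> 0" if "i < n" for i
      using ne3 cA k that unfolding lines_def by (simp add: fin)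
    ultimately have nI: "I = {..<n}" using In by blast
    then have nk: "n = k" using sI k by simp
    have \<delta>2: "card (lines i) = 2" if "i < n" for i using that nI I_def by blast
    have "min_gen_by 3 (D0 f) (tol n 3 gen) (2 * k - 2)"
      unfolding f k(1)[symmetric] cA[symmetric] by (rule min_gen_by_gen) (rule \<delta>2)
    moreover have "homog (2 * k + 1) f" using hom_F unfolding f cA k by simp
    moreover have "f \<noteq> pzero" unfolding f cf_0[symmetric] using F_nz by simp
    ultimately have "curve_type f (2 * k + 1) (2 * k - 2) k"
      unfolding curve_type_def nk[symmetric] by (metis length_tol)
    moreover have "\<exists>H. length H = k - 2 \<and> min_gen_by k (Syz G) H 2"
      if "min_gen_by 3 (D0 f) G (2 * k - 2)" for G
    proof -
      have "\<exists>H. length H = n - 2 \<and> min_gen_by n (Syz G) H 2"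
      proof (rule min_gen_by_Syz)
        show "min_gen_by 3 (D0 (cf F)) G (card A - 2)" using that unfolding f cA k(1) .
      qed (rule \<delta>2)
      then show ?thesis unfolding nk .
    qed
    ultimately show ?thesis by simp
  qed
  show ?thesis
    using B3 npts2 n3 sum tj md part2 unfolding multB by simp
qed

end
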